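(* Let $n \geq 2$ and let $\mathcal{F}$ be a real algebraic Levi-flat foliation of real codimension one on $\mathbb{P}^{n} = \mathbb{P}^n_{\mathbb{C}}$, induced in homogeneous coordinates $z = (z_0,\ldots,z_n) \in \mathbb{C}^{n+1}$, $z_j = x_j + i y_j$, by an integrable real $1$-form $\omega = \sum_{j=0}^n (A_j\,dx_j + B_j\,dy_j)$ with relatively prime real-valued polynomial coefficients $A_j, B_j \in \mathbb{C}[z,\bar z]$, satisfying the following two conditions: (i) $i_{\boldsymbol{r}}\omega = i_{\boldsymbol{r}}\omega^{\sharp} = 0$, where $\omega^{\sharp} = \sum_{j=0}^n (-B_j\,dx_j + A_j\,dy_j)$ and $i_{\boldsymbol{r}}$ is the contraction by the real radial vector field $\boldsymbol{r} = \sum_{j=0}^n \left(x_j\,\partial/\partial x_j + y_j\,\partial/\partial y_j\right)$; (ii) $(\Lambda_\lambda)^*\omega = |\lambda|^{2d}\omega$ for some $d \geq 1$ and for every $\lambda \in \mathbb{C}^*$, where $\Lambda_\lambda(z) = \lambda z$ is the homothety of $\mathbb{C}^{n+1}$. If the Levi foliation $\mathcal{L} = \mathcal{L}(\mathcal{F})$ is holomorphic, then at least one of the following two possibilities occurs: (a) $\omega = |\psi|^2\, \mathrm{Re}(\tau)$, where $\tau$ is a closed complex rational $1$-form that defines $\mathcal{L}$ and $\psi \in \mathbb{C}[z]$ is a homogeneous equation for the polar set of $\tau$. (b) $\omega = \mathrm{Re}(\kappa\,d\rho)$, where $\rho$ is a complex rational function that is a first integral for $\mathcal{L}$, and $\kappa$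 is a real rational function of bidegree $(d,d)$, for some $d \geq 1$, defined as a quotient of relatively prime homogeneous polynomials in $\mathbb{C}[z,\bar z]$, such that $\kappa/\bar\kappa$ is constant along the leaves of $\mathcal{L}$.
   Context: Geometric objects in $\mathbb{P}^n$ are identified with their cones in $\mathbb{C}^{n+1}\setminus\{0\}$. Integrable means $\omega \wedge d\omega = 0$. Conditions (i) and (ii) ensure that the foliation defined by $\omega$ on $\mathbb{C}^{n+1}\setminus\{0\}$ contains the complex lines through the origin and descends to $\mathbb{P}^n$. Write $\omega = \mathrm{Re}(\eta)$ with $\eta = \sum_{j=0}^n (A_j - iB_j)\,dz_j$. Levi-flat means that $\mathcal{F}$ is a local Levi-flat foliation at each point of $\mathbb{P}^n$: outside the singular set of $\mathcal{F}$, the distribution of complex hyperplanes contained in the tangent spaces of the leaves of $\mathcal{F}$ (defined in homogeneous coordinates by $\eta$) is integrable. Its leaves are immersed complex manifolds of complex codimension one contained in the leaves of $\mathcal{F}$ and form the Levi foliation $\mathcal{L}$. "$\mathcal{L}$ is holomorphic" means that it is a singular holomorphic foliation of codimension one on $\mathbb{P}^n$. In homogeneous coordinates, a complex rational function on $\mathbb{P}^n$ is a quotient of homogeneous polynomials in $\mathbb{C}[z]$ of the same degree, and a first integral is a non-constant such function that is constant along the leaves of $\mathcal{L}$. A real rational function is a (complex-valued) quotient of polynomials in $\mathbb{C}[z,\bar z]$; it has bidegree $(d,d)$ if the bidegrees (in $z$ and $\bar z$) of the numerator and denominator differ by $(d,d)$, so that $\kappa(\lambda z) = |\lambda|^{2d}\kappa(z)$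 for $\lambda \in \mathbb{C}^*$. An equation for the polar set of $\tau$ is taken with multiplicities, i.e. $\psi$ is a minimal polynomial denominator of $\tau$ (constant if there are no poles). *)

theory Defs
  imports "HOL-Analysis.Analysis"
begin

text \<open>
  The homogeneous coordinates z = (z_0, ..., z_n) are the components of a vector of type
  \<open>complex ^ 'n\<close> with \<open>CARD('n) = n + 1\<close>, and objects on the projective space are represented by
  their cones in this vector space.

  Polynomials are represented by the functions they induce, which determine them because the field
  of complex numbers is infinite.  The ring C[z, zbar] is the library's \<open>polynomial_function\<close> at type
  \<open>complex ^ 'n \<Rightarrow> complex\<close> (complex polynomials in the real coordinates x_j, y_j), its real-valued
  elements are \<open>real_polynomial_function\<close>, and C[z] is \<open>holomorphic_polynomial\<close> below.
\<close>

inductive holomorphic_polynomial :: "(complex ^ 'n \<Rightarrow> complex) \<Rightarrow> bool" where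
  const: "holomorphic_polynomial (\<lambda>z. c)"
| coord: "holomorphic_polynomial (\<lambda>z. z $ j)"
| add: "holomorphic_polynomial f \<Longrightarrow> holomorphic_polynomial g \<Longrightarrow> holomorphic_polynomial (\<lambda>z. f z + g z)"
| mult: "holomorphic_polynomial f \<Longrightarrow> holomorphic_polynomial g \<Longrightarrow> holomorphic_polynomial (\<lambda>z. f z * g z)"

definition homogeneous :: "nat \<Rightarrow> (complex ^ 'n \<Rightarrow> complex) \<Rightarrow> bool" where
  "homogeneous k f \<longleftrightarrow> (\<forall>c z. f (c *s z) = c ^ k * f z)"

definition bihomogeneous :: "nat \<Rightarrow> nat \<Rightarrow> (complex ^ 'n \<Rightarrow> complex) \<Rightarrow> bool" where
  "bihomogeneous a b f \<longleftrightarrow> (\<forall>c z. f (c *s z) = c ^ a * cnj c ^ b * f z)"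

text \<open>
  A family of elements of the polynomial ring \<open>R\<close> is relatively prime if the common divisors in \<open>R\<close>
  are the units, i.e. the nonzero constants.  A family all of whose members vanish is not relatively
  prime.
\<close>

definition relatively_prime ::
    "((complex ^ 'n \<Rightarrow> complex) \<Rightarrow> bool) \<Rightarrow> (complex ^ 'n \<Rightarrow> complex) set \<Rightarrow> bool" where
  "relatively_prime R F \<longleftrightarrow>
     (\<forall>h. R h \<longrightarrow> (\<forall>f\<in>F. \<exists>g. R g \<and> f = (\<lambda>z. h z * g z)) \<longrightarrow> (\<exists>c. c \<noteq> 0 \<and> h = (\<lambda>z. c)))"

text \<open>
  A 1-form maps a point and a (real) tangent vector at this point to a scalar.
\<close>

type_synonym ('n, 'b) form1 = "complex ^ 'n \<Rightarrow> complex ^ 'n \<Rightarrow> 'b"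

definition real_form ::
    "('n::finite \<Rightarrow> complex ^ 'n \<Rightarrow> real) \<Rightarrow> ('n \<Rightarrow> complex ^ 'n \<Rightarrow> real) \<Rightarrow> ('n, real) form1" where
  "real_form A B z v = (\<Sum>j\<in>UNIV. A j z * Re (v $ j) + B j z * Im (v $ j))"

definition sharp_form ::
    "('n::finite \<Rightarrow> complex ^ 'n \<Rightarrow> real) \<Rightarrow> ('n \<Rightarrow> complex ^ 'n \<Rightarrow> real) \<Rightarrow> ('n, real) form1" where
  "sharp_form A B = real_form (\<lambda>j z. - B j z) A"

text \<open>The form of type (1,0) with coefficients \<open>P j\<close> of dz_j.\<close>

definition complex_form :: "('n::finite \<Rightarrow> complex ^ 'n \<Rightarrow> complex) \<Rightarrow> ('n, complex) form1" where
  "complex_form P z v = (\<Sum>j\<in>UNIV. P j z * v $ j)"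

definition eta_form ::
    "('n::finite \<Rightarrow> complex ^ 'n \<Rightarrow> real) \<Rightarrow> ('n \<Rightarrow> complex ^ 'n \<Rightarrow> real) \<Rightarrow> ('n, complex) form1" where
  "eta_form A B = complex_form (\<lambda>j z. Complex (A j z) (- B j z))"

lemma Re_eta_form: "Re (eta_form A B z v) = real_form A B z v"
  by (simp add: eta_form_def complex_form_def real_form_def)

lemma Im_eta_form: "Im (eta_form A B z v) = sharp_form A B z v"
  by (simp add: eta_form_def complex_form_def real_form_def sharp_form_def algebra_simps)

text \<open>
  The real exterior derivative of a 1-form, evaluated on constant vector fields \<open>u\<close> and \<open>v\<close> (whose
  bracket vanishes), and the wedge product of a 1-form with a 2-form.
\<close>

definition ext_deriv ::
    "('n::finite, 'b::real_normed_vector) form1 \<Rightarrow>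
     complex ^ 'n \<Rightarrow> complex ^ 'n \<Rightarrow> complex ^ 'n \<Rightarrow> 'b" where
  "ext_deriv \<alpha> z u v =
     frechet_derivative (\<lambda>x. \<alpha> x v) (at z) u - frechet_derivative (\<lambda>x. \<alpha> x u) (at z) v"

definition wedge12 ::
    "('n, 'b::comm_ring) form1 \<Rightarrow>
     (complex ^ 'n \<Rightarrow> complex ^ 'n \<Rightarrow> complex ^ 'n \<Rightarrow> 'b) \<Rightarrow>
     complex ^ 'n \<Rightarrow> complex ^ 'n \<Rightarrow> complex ^ 'n \<Rightarrow> complex ^ 'n \<Rightarrow> 'b" where
  "wedge12 \<alpha> \<beta> z u v w = \<alpha> z u * \<beta> z v w + \<alpha> z v * \<beta> z w u + \<alpha> z w * \<beta> z u v"

definition integrable_form :: "('n::finite, 'b::real_normed_field) form1 \<Rightarrow> bool" where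
  "integrable_form \<alpha> \<longleftrightarrow> (\<forall>z u v w. wedge12 \<alpha> (ext_deriv \<alpha>) z u v w = 0)"

definition regular_set ::
    "('n \<Rightarrow> complex ^ 'n \<Rightarrow> real) \<Rightarrow> ('n \<Rightarrow> complex ^ 'n \<Rightarrow> real) \<Rightarrow> (complex ^ 'n) set" where
  "regular_set A B = {z. z \<noteq> 0 \<and> (\<exists>j. A j z \<noteq> 0 \<or> B j z \<noteq> 0)}"

text \<open>
  The foliation is Levi-flat if through every regular point there is an integral manifold of the
  distribution of complex hyperplanes \<open>ker \<eta>\<close>.  This manifold is given locally as a level set of a
  continuously real differentiable map to the plane; the map is a submersion along the level set
  because \<open>ker \<eta>\<close> has real codimension two at regular points.
\<close>

definition levi_flat ::
    "('n::finite \<Rightarrow> complex ^ 'n \<Rightarrow> real) \<Rightarrow> ('n \<Rightarrow> complex ^ 'n \<Rightarrow> real) \<Rightarrow> bool" where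
  "levi_flat A B \<longleftrightarrow>
     (\<forall>p\<in>regular_set A B. \<exists>U (f :: complex ^ 'n \<Rightarrow> complex) f'.
        open U \<and> p \<in> U \<and> U \<subseteq> regular_set A B \<and> f p = 0 \<and>
        (\<forall>z\<in>U. (f has_derivative blinfun_apply (f' z)) (at z)) \<and> continuous_on U f' \<and>
        (\<forall>z\<in>U. f z = 0 \<longrightarrow> {v. blinfun_apply (f' z) v = 0} = {v. eta_form A B z v = 0}))"

text \<open>
  Two points lie in the same leaf of the Levi foliation if they are joined by a piecewise
  continuously differentiable path of regular points that is tangent to \<open>ker \<eta>\<close>.
\<close>

definition same_levi_leaf ::
    "('n::finite \<Rightarrow> complex ^ 'n \<Rightarrow> real) \<Rightarrow> ('n \<Rightarrow> complex ^ 'n \<Rightarrow> real) \<Rightarrow>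
     complex ^ 'n \<Rightarrow> complex ^ 'n \<Rightarrow> bool" where
  "same_levi_leaf A B z w \<longleftrightarrow>
     (\<exists>\<gamma> S. valid_path \<gamma> \<and> pathstart \<gamma> = z \<and> pathfinish \<gamma> = w \<and>
        path_image \<gamma> \<subseteq> regular_set A B \<and> finite S \<and>
        (\<forall>t\<in>{0..1} - S. eta_form A B (\<gamma> t) (vector_derivative \<gamma> (at t)) = 0))"

definition constant_along_levi_leaves ::
    "('n::finite \<Rightarrow> complex ^ 'n \<Rightarrow> real) \<Rightarrow> ('n \<Rightarrow> complex ^ 'n \<Rightarrow> real) \<Rightarrow>
     (complex ^ 'n) set \<Rightarrow> (complex ^ 'n \<Rightarrow> complex) \<Rightarrow> bool" where
  "constant_along_levi_leaves A B D g \<longleftrightarrow>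
     (\<forall>z\<in>D. \<forall>w\<in>D. same_levi_leaf A B z w \<longrightarrow> g z = g w)"

text \<open>
  A nonzero 1-form on the domain \<open>D\<close> (the complement of its poles) defines the Levi foliation if,
  away from its own zeros and from the singular set, its kernels are the tangent spaces of the leaves.
\<close>

definition defines_levi ::
    "('n::finite \<Rightarrow> complex ^ 'n \<Rightarrow> real) \<Rightarrow> ('n \<Rightarrow> complex ^ 'n \<Rightarrow> real) \<Rightarrow>
     (complex ^ 'n) set \<Rightarrow> ('n, complex) form1 \<Rightarrow> bool" where
  "defines_levi A B D \<alpha> \<longleftrightarrow>
     (\<exists>z\<in>D. \<exists>v. \<alpha> z v \<noteq> 0) \<and>
     (\<forall>z\<in>D \<inter> regular_set A B. (\<exists>v. \<alpha> z v \<noteq> 0) \<longrightarrow> {v. \<alpha> z v = 0} = {v. eta_form A B z v = 0})"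

text \<open>
  A singular holomorphic foliation of codimension one on projective space is given in homogeneous
  coordinates by an integrable form with relatively prime homogeneous coefficients in C[z] of the
  same degree, annihilated by the complex radial vector field, whose value at \<open>z\<close> is \<open>z\<close> itself.
\<close>

definition holomorphic_foliation :: "('n::finite \<Rightarrow> complex ^ 'n \<Rightarrow> complex) \<Rightarrow> bool" where
  "holomorphic_foliation P \<longleftrightarrow>
     (\<forall>j. holomorphic_polynomial (P j)) \<and> (\<exists>k. \<forall>j. homogeneous k (P j)) \<and>
     relatively_prime holomorphic_polynomial (range P) \<and>
     (\<forall>z. complex_form P z z = 0) \<and> integrable_form (complex_form P)"

definition levi_foliation_holomorphic ::
    "('n::finite \<Rightarrow> complex ^ 'n \<Rightarrow> real) \<Rightarrow> ('n \<Rightarrow> complex ^ 'n \<Rightarrow> real) \<Rightarrow> bool" where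
  "levi_foliation_holomorphic A B \<longleftrightarrow>
     (\<exists>P. holomorphic_foliation P \<and> defines_levi A B UNIV (complex_form P))"

text \<open>
  A rational 1-form on projective space with coefficients \<open>a j / \<psi>\<close> in homogeneous coordinates: it is
  invariant under homotheties and annihilated by the radial vector field.  Relative primeness of all
  the numerators together with \<open>\<psi>\<close> says that \<open>\<psi>\<close> is a minimal denominator, i.e. an equation of the
  polar set with multiplicities.
\<close>

definition rational_form ::
    "('n::finite \<Rightarrow> complex ^ 'n \<Rightarrow> complex) \<Rightarrow> (complex ^ 'n \<Rightarrow> complex) \<Rightarrow> ('n, complex) form1" where
  "rational_form a \<psi> = complex_form (\<lambda>j z. a j z / \<psi> z)"

definition projective_rational_form ::
    "('n::finite \<Rightarrow> complex ^ 'n \<Rightarrow> complex) \<Rightarrow> (complex ^ 'n \<Rightarrow> complex) \<Rightarrow> bool" where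
  "projective_rational_form a \<psi> \<longleftrightarrow>
     (\<forall>j. holomorphic_polynomial (a j)) \<and> holomorphic_polynomial \<psi> \<and>
     (\<exists>z. \<psi> z \<noteq> 0) \<and> (\<exists>e. homogeneous e \<psi>) \<and>
     relatively_prime holomorphic_polynomial (insert \<psi> (range a)) \<and>
     (\<forall>z v c. c \<noteq> 0 \<longrightarrow> \<psi> z \<noteq> 0 \<longrightarrow> rational_form a \<psi> (c *s z) (c *s v) = rational_form a \<psi> z v) \<and>
     (\<forall>z. \<psi> z \<noteq> 0 \<longrightarrow> rational_form a \<psi> z z = 0)"

definition closed_on :: "(complex ^ 'n::finite) set \<Rightarrow> ('n, complex) form1 \<Rightarrow> bool" where
  "closed_on D \<alpha> \<longleftrightarrow> (\<forall>z\<in>D. \<forall>u v. ext_deriv \<alpha> z u v = 0)"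

text \<open>The rational function \<open>p / q\<close> is a first integral of the Levi foliation.\<close>

definition rational_first_integral ::
    "('n::finite \<Rightarrow> complex ^ 'n \<Rightarrow> real) \<Rightarrow> ('n \<Rightarrow> complex ^ 'n \<Rightarrow> real) \<Rightarrow>
     (complex ^ 'n \<Rightarrow> complex) \<Rightarrow> (complex ^ 'n \<Rightarrow> complex) \<Rightarrow> bool" where
  "rational_first_integral A B p q \<longleftrightarrow>
     holomorphic_polynomial p \<and> holomorphic_polynomial q \<and> (\<exists>z. q z \<noteq> 0) \<and>
     (\<exists>k. homogeneous k p \<and> homogeneous k q) \<and>
     \<not> (\<exists>c. \<forall>z. q z \<noteq> 0 \<longrightarrow> p z / q z = c) \<and>
     constant_along_levi_leaves A B {z. q z \<noteq> 0} (\<lambda>z. p z / q z)"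

text \<open>
  The real rational function \<open>N / M\<close>, in lowest terms, has bidegree \<open>(d, d)\<close>.
\<close>

definition real_rational_bidegree ::
    "nat \<Rightarrow> (complex ^ 'n::finite \<Rightarrow> complex) \<Rightarrow> (complex ^ 'n \<Rightarrow> complex) \<Rightarrow> bool" where
  "real_rational_bidegree d N M \<longleftrightarrow>
     polynomial_function N \<and> polynomial_function M \<and> (\<exists>z. M z \<noteq> 0) \<and>
     relatively_prime polynomial_function {N, M} \<and>
     (\<exists>a b. bihomogeneous (a + d) (b + d) N \<and> bihomogeneous a b M)"

end

theory Submission
  imports Defs "HOL-Computational_Algebra.Fundamental_Theorem_Algebra"
begin

text \<open>
  Treat \<open>z\<close> and its conjugate as independent variables \<open>(z, w)\<close>.  Comparing kernels, \<open>\<eta> = H \<theta>\<close>, where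
  \<open>\<theta> = \<Sum>j. P j dz_j\<close> is the polynomial form of the holomorphic foliation and \<open>H\<close> is a polynomial in
  \<open>(z, w)\<close>.  Let \<open>K\<close> be its conjugate; relative primeness of the coefficients of \<open>\<omega>\<close> makes \<open>H\<close> and \<open>K\<close>
  coprime.  The component of type (2,1) of \<open>\<omega> \<and> d\<omega> = 0\<close> says that \<open>(H / K) \<theta>\<close> is closed in \<open>z\<close> for every
  fixed \<open>w\<close>, so quotients of the functions \<open>H(\<cdot>, w) / K(\<cdot>, w)\<close> for different \<open>w\<close> are first integrals.
  If all of these are constant, then \<open>H(z, w)\<close> splits as \<open>a(z) b(w)\<close>, which is possibility (a) with
  \<open>\<psi>(z) = cnj (b (cnj z))\<close> and \<open>\<tau> = (a / \<psi>) \<theta>\<close>.  Otherwise a nonconstant one, \<open>\<rho>\<close>, satisfies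
  \<open>d\<rho> = g \<theta>\<close>, and \<open>\<kappa> = H / g\<close> gives possibility (b).

  The same closed forms supply local holomorphic first integrals near each regular point \<open>x0\<close>: take
  \<open>w = cnj x0\<close>, where \<open>H\<close> and \<open>K\<close> do not vanish.  They are needed because a path inside a leaf may meet
  the zero sets of numerators and denominators, and may have infinite length.
\<close>

section \<open>Polynomials along complex lines\<close>

text \<open>If two closed forms are multiples of the same \<theta>, their quotient f satisfies df
  \<and> \<theta> = 0. All the global first integrals arise in this way, and so does the constancy
  of \<kappa> divided by its conjugate: up to a factor in \<open>w\<close> alone it is the quotient
  of (H / K) \<theta> by d\<rho>. If all quotients are constant in \<open>z\<close>, it is first H /
  K that splits into a function of \<open>z\<close> and a function of \<open>w\<close>; by
  coprimality \<open>H\<close> then divides a product a(z) b(w), and only therefore splits itself.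
  Fractions in lowest terms are the recurring need: \<open>\<psi>\<close> must be a minimal
  denominator, \<kappa> must be reduced, and constancy of R / S along a leaf requires control where
  \<open>S\<close> vanishes. In lowest terms \<open>S\<close> divides its own derivatives along the
  leaves, so by uniqueness for linear differential equations a leaf that meets the zero set of
  \<open>S\<close> stays in it. The algebra behind lowest terms is reduced to one variable by
  restricting polynomials to parallel lines in a direction in which a given polynomial is
  monic.\<close>

abbreviation hpoly :: "(complex ^ 'm \<Rightarrow> complex) \<Rightarrow> bool" where
  "hpoly \<equiv> holomorphic_polynomial"

lemmas hpoly_intros = holomorphic_polynomial.intros

lemma hpoly_uminus: "hpoly f \<Longrightarrow> hpoly (\<lambda>z. - f z)"
  using holomorphic_polynomial.mult[OF holomorphic_polynomial.const[of "-1"], of f] by simp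

lemma hpoly_diff: "hpoly f \<Longrightarrow> hpoly g \<Longrightarrow> hpoly (\<lambda>z. f z - g z)"
  using holomorphic_polynomial.add[OF _ hpoly_uminus, of f g] by simp

lemma hpoly_sum: "(\<And>i. i \<in> I \<Longrightarrow> hpoly (f i)) \<Longrightarrow> hpoly (\<lambda>z. \<Sum>i\<in>I. f i z)"
  by (induction I rule: infinite_finite_induct) (auto intro: hpoly_intros)

lemma hpoly_power: "hpoly f \<Longrightarrow> hpoly (\<lambda>z. f z ^ n)"
  by (induction n) (auto intro: hpoly_intros)

lemmas hpoly_closed = hpoly_intros hpoly_uminus hpoly_diff hpoly_sum hpoly_power

lemma hpoly_compose:
  fixes g :: "complex ^ 'k \<Rightarrow> complex ^ 'm"
  assumes "hpoly f" and "\<And>j. hpoly (\<lambda>z. g z $ j)"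
  shows "hpoly (\<lambda>z. f (g z))"
  using assms(1) by induction (auto intro: hpoly_intros assms(2))

lemma continuous_on_hpoly:
  fixes f :: "complex ^ 'm::finite \<Rightarrow> complex"
  assumes "hpoly f"
  shows "continuous_on S f"
  using assms by induction (auto intro!: continuous_intros)

text \<open>These are the elements of the ring C[z][t], written as functions of \<open>z\<close>.
  The degree bound is uniform in \<open>a\<close> because pointwise finiteness alone would also
  admit power series in \<open>t\<close>.\<close>

definition poly_family :: "(complex ^ 'm \<Rightarrow> complex poly) \<Rightarrow> bool" where
  "poly_family G \<longleftrightarrow>
     (\<forall>i. hpoly (\<lambda>a. coeff (G a) i)) \<and> (\<exists>N. \<forall>a. degree (G a) \<le> N)"

lemma poly_family_coeff: "poly_family G \<Longrightarrow> hpoly (\<lambda>a. coeff (G a) i)"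
  by (simp add: poly_family_def)

lemma poly_familyI:
  assumes "\<And>i. hpoly (\<lambda>a. coeff (G a) i)" "\<And>a. degree (G a) \<le> N"
  shows "poly_family G"
  using assms by (auto simp: poly_family_def)

lemma poly_family_add:
  assumes "poly_family F" "poly_family G"
  shows "poly_family (\<lambda>a. F a + G a)"
proof -
  from assms obtain M N where "\<And>a. degree (F a) \<le> M" "\<And>a. degree (G a) \<le> N"
    by (auto simp: poly_family_def)
  then show ?thesis
    using assms
    by (intro poly_familyI[where N = "max M N"])
       (auto simp: poly_family_def intro!: hpoly_intros degree_add_le intro: le_max_iff_disj[THEN
           iffD2])
qed

lemma poly_family_mult:
  assumes "poly_family F" "poly_family G"
  shows "poly_family (\<lambda>a. F a * G a)"
proof -
  from assms obtain M N where *: "\<And>a. degree (F a) \<le> M" "\<And>a. degree (G a) \<le> N"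
    by (auto simp: poly_family_def)
  show ?thesis
  proof (rule poly_familyI[where N = "M + N"])
    show "degree (F a * G a) \<le> M + N" for a
      using degree_mult_le[of "F a" "G a"] *[of a] by linarith
    show "hpoly (\<lambda>a. coeff (F a * G a) i)" for i
      using assms by (auto simp: coeff_mult poly_family_def intro!: hpoly_closed)
  qed
qed

lemma poly_family_monom: "hpoly c \<Longrightarrow> poly_family (\<lambda>a. monom (c a) n)"
proof (rule poly_familyI[where N = n])
  show "hpoly (\<lambda>a. coeff (monom (c a) n) i)" if "hpoly c" for i
    using that by (cases "n = i") (auto intro: hpoly_intros)
qed (auto simp: degree_monom_le)

lemma poly_family_const: "hpoly c \<Longrightarrow> poly_family (\<lambda>a. [:c a:])"
  using poly_family_monom[of c 0] by (simp add: monom_0)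

lemma poly_family_smult: "hpoly c \<Longrightarrow> poly_family F \<Longrightarrow> poly_family (\<lambda>a. smult (c a) (F a))"
  using poly_family_mult[OF poly_family_const, of c F] by simp

lemma poly_family_diff:
  assumes "poly_family F" "poly_family G"
  shows "poly_family (\<lambda>a. F a - G a)"
  using poly_family_add[OF assms(1) poly_family_smult[OF holomorphic_polynomial.const[of "-1"]
      assms(2)]]
  by simp

lemma hpoly_poly:
  assumes "poly_family G"
  shows "hpoly (\<lambda>a. poly (G a) t)"
proof -
  obtain N where N: "\<And>a. degree (G a) \<le> N" using assms by (auto simp: poly_family_def)
  have "poly (G a) t = (\<Sum>i\<le>N. coeff (G a) i * t ^ i)" for a
    unfolding poly_altdef using N[of a]
    by (intro sum.mono_neutral_left) (auto simp: coeff_eq_0)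
  then show ?thesis
    using assms by (auto simp: poly_family_def intro!: hpoly_closed)
qed

text \<open>Three instances are used: parallel lines of fixed direction, lines through the origin,
  whose coefficients are the homogeneous components, and the scaling of one block of
  coordinates.\<close>

lemma hpoly_pencil:
  fixes u v :: "complex ^ 'k \<Rightarrow> complex ^ 'm"
  assumes "hpoly F" and u: "\<And>j. hpoly (\<lambda>x. u x $ j)" and v: "\<And>j. hpoly (\<lambda>x. v x $ j)"
  shows "\<exists>G. poly_family G \<and> (\<forall>x t. poly (G x) t = F (u x + t *s v x))"
  using assms(1)
proof induction
  case (const c)
  then show ?case by (intro exI[of _ "\<lambda>x. [:c:]"]) (auto intro!: poly_family_const hpoly_intros)
next
  case (coord j)
  have "poly_family (\<lambda>x. [:u x $ j:] + monom (v x $ j) 1)"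
    by (intro poly_family_add poly_family_const poly_family_monom u v)
  then show ?case
    by (intro exI[of _ "\<lambda>x. [:u x $ j:] + monom (v x $ j) 1"]) (auto simp: poly_monom mult.commute)
next
  case (add f g)
  then obtain F G where "poly_family F" "\<forall>x t. poly (F x) t = f (u x + t *s v x)"
    "poly_family G" "\<forall>x t. poly (G x) t = g (u x + t *s v x)" by blast
  then show ?case
    by (intro exI[of _ "\<lambda>x. F x + G x"]) (auto intro!: poly_family_add)
next
  case (mult f g)
  then obtain F G where "poly_family F" "\<forall>x t. poly (F x) t = f (u x + t *s v x)"
    "poly_family G" "\<forall>x t. poly (G x) t = g (u x + t *s v x)" by blast
  then show ?case
    by (intro exI[of _ "\<lambda>x. F x * G x"]) (auto intro!: poly_family_mult)
qed

text \<open>The direction is the first argument so that \<open>line b F\<close> is a family in the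
  base point: the Taylor expansion of \<open>F\<close> in direction \<open>b\<close>, an element of
  C[z][t]. Its value at t = 0 gives back \<open>F\<close>.\<close>

definition line :: "complex ^ 'm \<Rightarrow> (complex ^ 'm \<Rightarrow> complex) \<Rightarrow> complex ^ 'm \<Rightarrow> complex poly" where
  "line b F a = (SOME p. \<forall>t. poly p t = F (a + t *s b))"

lemma hpoly_line_exists:
  assumes "hpoly F"
  shows "\<exists>G. poly_family G \<and> (\<forall>a t. poly (G a) t = F (a + t *s b))"
  by (rule hpoly_pencil[OF assms, of "\<lambda>a. a" "\<lambda>a. b"]) (auto intro: hpoly_intros)

lemma poly_eqI_fun: "(\<And>t. poly p t = poly q t) \<Longrightarrow> p = (q :: complex poly)"
  by (simp add: poly_eq_poly_eq_iff[symmetric] fun_eq_iff)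

lemma poly_line: "hpoly F \<Longrightarrow> poly (line b F a) t = F (a + t *s b)"
  unfolding line_def using hpoly_line_exists[of F b] someI_ex[of "\<lambda>p. \<forall>t. poly p t = F (a
      + t *s b)"]
  by blast

lemma line_unique: "hpoly F \<Longrightarrow> (\<And>t. poly p t = F (a + t *s b)) \<Longrightarrow> line b F a = p"
  by (rule poly_eqI_fun) (simp add: poly_line)

lemma poly_family_line:
  assumes "hpoly F"
  shows "poly_family (line b F)"
proof -
  obtain G where G: "poly_family G" "\<And>a t. poly (G a) t = F (a + t *s b)"
    using hpoly_line_exists[OF assms] by blast
  then have "line b F = G" by (auto simp: fun_eq_iff intro!: line_unique assms)
  with G show ?thesis by simp
qed

lemma line_mult: "hpoly F \<Longrightarrow> hpoly G \<Longrightarrow> line b (\<lambda>z. F z * G z) a = line b F a * line b G a"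
  by (rule line_unique) (auto simp: poly_line intro: hpoly_intros)

lemma line_add: "hpoly F \<Longrightarrow> hpoly G \<Longrightarrow> line b (\<lambda>z. F z + G z) a = line b F a + line b G a"
  by (rule line_unique) (auto simp: poly_line intro: hpoly_intros)

lemma line_const: "line b (\<lambda>z. c) a = [:c:]"
  by (rule line_unique) (auto intro: hpoly_intros)

lemma line_coord: "line b (\<lambda>z. z $ j) a = [:a $ j, b $ j:]"
  by (rule line_unique) (auto intro: hpoly_intros)

text \<open>Join a point where \<open>F\<close> is nonzero to one where \<open>G\<close> is nonzero:
  on this line both factors are nonzero polynomials in one variable.\<close>

lemma hpoly_mult_eq_0:
  assumes "hpoly F" "hpoly G" and eq: "\<And>z. F z * G z = 0" and "\<exists>z. F z \<noteq> 0"
  shows "G z = 0"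
proof (rule ccontr)
  assume z: "G z \<noteq> 0"
  obtain a where a: "F a \<noteq> 0" using assms(4) by blast
  define b where "b = z - a"
  have "line b F a * line b G a = 0"
    by (rule poly_eqI_fun) (simp add: poly_line assms)
  moreover have "poly (line b F a) 0 \<noteq> 0" "poly (line b G a) 1 \<noteq> 0"
    using a z by (auto simp: poly_line assms b_def)
  ultimately show False by auto
qed

lemma hpoly_cancel:
  assumes "hpoly F" "hpoly G" "hpoly H" "\<And>z. F z * G z = F z * H z" "\<exists>z. F z \<noteq> 0"
  shows "G z = H z"
  using hpoly_mult_eq_0[of F "\<lambda>z. G z - H z" z] assms
  by (auto simp: algebra_simps intro: hpoly_closed)

lemma poly_nowhere_zero_const:
  fixes p :: "complex poly"
  assumes "\<And>t. poly p t \<noteq> 0"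
  shows "poly p s = poly p t"
proof -
  have "constant (poly p)" using fundamental_theorem_of_algebra assms by blast
  then show ?thesis by (simp add: constant_def)
qed

lemma hpoly_nowhere_zero_const:
  assumes "hpoly F" "\<And>z. F z \<noteq> 0"
  shows "F z = F w"
  using poly_nowhere_zero_const[of "line (w - z) F z" 0 1] assms by (simp add: poly_line)

section \<open>Denominator ideals are principal\<close>

definition monic_family :: "nat \<Rightarrow> (complex ^ 'm \<Rightarrow> complex poly) \<Rightarrow> bool" where
  "monic_family e g \<longleftrightarrow> poly_family g \<and> (\<forall>a. degree (g a) = e \<and> coeff (g a) e = 1)"

lemma poly_eq_oneI: "degree p = 0 \<Longrightarrow> coeff p 0 = 1 \<Longrightarrow> p = 1"
  by (metis degree_0_id one_pCons)

lemma degree_le_decrease: "degree p \<le> Suc N \<Longrightarrow> coeff p (Suc N) = 0 \<Longrightarrow> degree p \<le> N"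
  by (metis degree_0 le_Suc_eq leading_coeff_0_iff zero_le)

lemma poly_eq_cofinite:
  fixes p q :: "complex poly"
  assumes "finite Z" "\<And>t. t \<notin> Z \<Longrightarrow> poly p t = poly q t"
  shows "p = q"
proof (rule ccontr)
  assume "p \<noteq> q"
  then have "finite {t. poly (p - q) t = 0}" by (intro poly_roots_finite) simp
  moreover have "UNIV \<subseteq> Z \<union> {t. poly (p - q) t = 0}" using assms(2) by auto
  ultimately have "finite (UNIV :: complex set)"
    using assms(1) by (meson finite_UnI finite_subset)
  then show False by (simp add: infinite_UNIV_char_0)
qed

text \<open>Because the leading coefficient of the divisor is 1, Euclidean division needs no
  denominators, and quotient and remainder stay in C[z][t].\<close>

lemma monic_family_division:
  fixes g F :: "complex ^ 'm \<Rightarrow> complex poly"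
  assumes g: "monic_family e g" and "poly_family F"
  shows "\<exists>Q R. poly_family Q \<and> poly_family R \<and>
           (\<forall>a. F a = g a * Q a + R a \<and> (R a = 0 \<or> degree (R a) < e))"
proof -
  have "\<exists>Q R. poly_family Q \<and> poly_family R \<and>
           (\<forall>a. F a = g a * Q a + R a \<and> (R a = 0 \<or> degree (R a) < e))"
    if "poly_family F" "\<forall>a. degree (F a) \<le> N" for N and F :: "complex ^ 'm \<Rightarrow> complex poly"
    using that
  proof (induction N arbitrary: F)
    case 0
    show ?case
    proof (cases "e = 0")
      case True
      with g have "g a = 1" for a
        by (intro poly_eq_oneI) (auto simp: monic_family_def)
      then show ?thesis using 0
        by (intro exI[of _ F] exI[of _ "\<lambda>a. 0"]) (auto intro: poly_family_const[of
            "\<lambda>a. 0", simplified] hpoly_intros)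
    next
      case False
      then show ?thesis using 0
        by (intro exI[of _ F] exI[of _ "\<lambda>a. 0"] exI[of _ "\<lambda>a. 0"] exI[of _ F])
           (auto intro: poly_family_const[of "\<lambda>a. 0", simplified] hpoly_intros)
    qed
  next
    case (Suc N)
    show ?case
    proof (cases "Suc N < e")
      case True
      then show ?thesis using Suc.prems
        by (intro exI[of _ "\<lambda>a. 0"] exI[of _ F])
           (auto intro: poly_family_const[of "\<lambda>a. 0", simplified] hpoly_intros le_less_trans)
    next
      case False
      define M where "M a = monom (coeff (F a) (Suc N)) (Suc N - e)" for a
      have M: "poly_family M" unfolding M_def
        using Suc.prems by (intro poly_family_monom poly_family_coeff)
      have pg: "poly_family g" using g by (simp add: monic_family_def)
      have deg: "degree (F a - M a * g a) \<le> N" for a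
      proof (rule degree_le_decrease)
        have "degree (M a * g a) \<le> degree (M a) + degree (g a)" by (rule degree_mult_le)
        also have "\<dots> \<le> Suc N - e + e"
          using g by (intro add_mono) (auto simp: M_def degree_monom_le monic_family_def)
        finally show "degree (F a - M a * g a) \<le> Suc N"
          using False Suc.prems by (intro degree_diff_le) auto
        show "coeff (F a - M a * g a) (Suc N) = 0"
          using False g by (simp add: M_def coeff_monom_mult monic_family_def)
      qed
      obtain Q R where QR: "poly_family Q" "poly_family R"
        "\<forall>a. F a - M a * g a = g a * Q a + R a \<and> (R a = 0 \<or> degree (R a) < e)"
        using Suc.IH[OF poly_family_diff[OF Suc.prems(1) poly_family_mult[OF M pg]]] deg by blast
      then show ?thesis
        by (intro exI[of _ "\<lambda>a. Q a + M a"] exI[of _ R])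
           (auto intro!: poly_family_add M simp: algebra_simps)
    qed
  qed
  moreover obtain N where "\<forall>a. degree (F a) \<le> N" using assms(2) by (auto simp: poly_family_def)
  ultimately show ?thesis using assms(2) by blast
qed

text \<open>Divisibility is needed only off the zeros of \<open>c\<close>. There the remainder of
  the division vanishes, so its coefficients times \<open>c\<close> are the zero polynomial and the
  coefficients themselves are zero.\<close>

lemma monic_family_dvd:
  assumes g: "monic_family e g" and F: "poly_family F"
    and c: "hpoly c" "\<exists>a. c a \<noteq> 0" and dvd: "\<And>a. c a \<noteq> 0 \<Longrightarrow> g a dvd F a"
  shows "\<exists>Q. poly_family Q \<and> (\<forall>a. F a = g a * Q a)"
proof -
  obtain Q R where QR: "poly_family Q" "poly_family R"
    "\<And>a. F a = g a * Q a + R a" "\<And>a. R a = 0 \<or> degree (R a) < e"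
    using monic_family_division[OF g F] by blast
  have R0: "R a = 0" if "c a \<noteq> 0" for a
  proof (rule ccontr)
    assume "R a \<noteq> 0"
    moreover have "g a dvd R a"
      using dvd[OF that] QR(3)[of a] by (simp add: dvd_add_right_iff)
    ultimately show False
      using QR(4)[of a] g dvd_imp_degree_le[of "g a" "R a"] by (auto simp: monic_family_def)
  qed
  have "coeff (R a) i = 0" for a i
    using hpoly_mult_eq_0[OF c(1) poly_family_coeff[OF QR(2)] _ c(2), of i a] R0
    by (metis coeff_0 mult_eq_0_iff)
  then have "R a = 0" for a by (simp add: poly_eqI)
  with QR show ?thesis by auto
qed

text \<open>From F(a + t b) = t^k F(b + a / t), the polynomial on one line is, up to powers of
  \<open>t\<close>, the reversal of the polynomial on the line with \<open>a\<close> and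
  \<open>b\<close> exchanged. The coefficient of t^k is thus the constant term of the other
  one.\<close>

lemma degree_line_homogeneous:
  assumes "hpoly F" "homogeneous k F"
  shows "degree (line b F a) \<le> k" "coeff (line b F a) k = F b"
proof -
  define p q where "p = line b F a" and "q = line a F b"
  define n where "n = degree q"
  have *: "monom 1 n * p = monom 1 k * reflect_poly q"
  proof (rule poly_eq_cofinite)
    fix t :: complex assume "t \<notin> {0}"
    then have "t \<noteq> 0" by simp
    have "F (a + t *s b) = t ^ k * F (b + inverse t *s a)"
    proof -
      have "t *s (b + inverse t *s a) = a + t *s b"
        using \<open>t \<noteq> 0\<close> by (simp add: vec_eq_iff field_simps)
      then show ?thesis using assms(2) unfolding homogeneous_def by metis
    qed
    then show "poly (monom 1 n * p) t = poly (monom 1 k * reflect_poly q) t"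
      using \<open>t \<noteq> 0\<close>
      by (simp add: p_def q_def n_def poly_monom poly_reflect_poly_nz poly_line assms)
  qed simp
  have "degree (monom 1 k * reflect_poly q) \<le> k + n"
    using degree_mult_le[of "monom 1 k" "reflect_poly q"] degree_reflect_poly_le[of q]
      degree_monom_le[of "1::complex" k] unfolding n_def by linarith
  then have "p = 0 \<or> degree p + n \<le> k + n"
    unfolding *[symmetric] by (cases "p = 0") (simp_all add: degree_mult_eq degree_monom_eq)
  then show "degree (line b F a) \<le> k" by (auto simp: p_def)
  have "coeff (monom 1 n * p) (n + k) = coeff (monom 1 k * reflect_poly q) (n + k)"
    by (simp only: *)
  then have "coeff p k = coeff q 0"
    by (simp add: coeff_monom_mult n_def coeff_reflect_poly)
  also have "\<dots> = F b"
    using poly_line[OF assms(1), of a b 0] by (simp add: q_def poly_0_coeff_0)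
  finally show "coeff (line b F a) k = F b" by (simp add: p_def)
qed


text \<open>Choose \<open>b\<close> outside the zero set of the top homogeneous component of
  \<open>F\<close>. The leading coefficient on every line of direction \<open>b\<close> is then the
  value of this component at \<open>b\<close>, which does not depend on the base point.\<close>

lemma monic_line_exists:
  fixes F :: "complex ^ 'm \<Rightarrow> complex"
  assumes F: "hpoly F" and nz: "\<exists>z. F z \<noteq> 0"
  shows "\<exists>b e k. k \<noteq> 0 \<and> monic_family e (\<lambda>a. smult k (line b F a))"
proof -
  \<comment> \<open>The homogeneous components of \<open>F\<close> are the coefficients of F(t z) as
    a polynomial in \<open>t\<close>.\<close>
  obtain G where G: "poly_family G" "\<And>z t. poly (G z) t = F (t *s z)"
    using hpoly_pencil[OF F, of "\<lambda>x. 0" "\<lambda>x. x"] by (auto intro: hpoly_intros)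
  define Fi where "Fi i = (\<lambda>z. coeff (G z) i)" for i
  have Fi: "hpoly (Fi i)" for i unfolding Fi_def by (rule poly_family_coeff[OF G(1)])
  have hom: "homogeneous i (Fi i)" for i
  proof (unfold homogeneous_def, intro allI)
    fix c z
    have "G (c *s z) = G z \<circ>\<^sub>p [:0, c:]"
      by (rule poly_eqI_fun) (simp add: poly_pcompose G(2) mult.commute)
    then show "Fi i (c *s z) = c ^ i * Fi i z"
      by (simp add: Fi_def coeff_pcompose_linear)
  qed
  obtain N where N: "\<And>z. degree (G z) \<le> N" using G(1) by (auto simp: poly_family_def)
  have sumN: "F z = (\<Sum>i\<le>N. Fi i z)" for z
  proof -
    have "F z = poly (G z) 1" by (simp add: G(2))
    also have "\<dots> = (\<Sum>i\<le>N. coeff (G z) i)"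
      unfolding poly_altdef using N[of z]
      by (simp, intro sum.mono_neutral_left) (auto simp: coeff_eq_0)
    finally show ?thesis by (simp add: Fi_def)
  qed
  define E where "E = {i. i \<le> N \<and> (\<exists>z. Fi i z \<noteq> 0)}"
  have "finite E" "E \<noteq> {}"
    using nz sumN by (auto simp: E_def) (metis sum.neutral atMost_iff)
  define e where "e = Max E"
  have "e \<in> E" using \<open>finite E\<close> \<open>E \<noteq> {}\<close> by (simp add: e_def)
  then obtain b where b: "Fi e b \<noteq> 0" and "e \<le> N" by (auto simp: E_def)
  have zero: "Fi i z = 0" if "i > e" "i \<le> N" for i z
    using that \<open>finite E\<close> Max_ge[of E i] unfolding e_def E_def by fastforce
  have sume: "F z = (\<Sum>i\<le>e. Fi i z)" for z
    unfolding sumN using \<open>e \<le> N\<close> zero by (intro sum.mono_neutral_right) auto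
  have line: "line b F a = (\<Sum>i\<le>e. line b (Fi i) a)" for a
    by (rule line_unique[OF F]) (simp add: poly_sum poly_line Fi sume)
  have deg: "degree (line b F a) \<le> e" for a
    unfolding line
  proof (intro degree_sum_le)
    fix i assume "i \<in> {..e}"
    then show "degree (line b (Fi i) a) \<le> e"
      using degree_line_homogeneous(1)[OF Fi hom, of b i a] by simp
  qed simp
  have "coeff (line b F a) e = Fi e b" for a
  proof -
    have "coeff (line b F a) e = (\<Sum>i\<le>e. coeff (line b (Fi i) a) e)"
      by (simp add: line coeff_sum)
    also have "\<dots> = (\<Sum>i\<in>{e}. coeff (line b (Fi i) a) e)"
    proof (intro sum.mono_neutral_right ballI)
      fix i assume "i \<in> {..e} - {e}"
      then show "coeff (line b (Fi i) a) e = 0"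
        using degree_line_homogeneous(1)[OF Fi hom, of b i a] by (intro coeff_eq_0) auto
    qed auto
    finally show ?thesis by (simp add: degree_line_homogeneous(2)[OF Fi hom])
  qed
  with b deg have "degree (line b F a) = e" for a
    by (metis le_antisym le_degree)
  then have "monic_family e (\<lambda>a. smult (1 / Fi e b) (line b F a))"
    using b \<open>\<And>a. coeff (line b F a) e = Fi e b\<close>
    by (auto simp: monic_family_def intro!: poly_family_smult poly_family_line F hpoly_intros)
  then show ?thesis using b by (intro exI[of _ b] exI[of _ e] exI[of _ "1 / Fi e b"]) simp
qed

section \<open>Divisibility from local bounds on a quotient\<close>

lemma norm_vector_scalar_mult: "norm (c *s (v :: complex ^ 'm)) = cmod c * norm v"
  by (simp add: norm_vec_def L2_set_def norm_mult power_mult_distrib real_sqrt_mult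
        flip: sum_distrib_left)

text \<open>By continuity the bound forces \<open>p\<close> to vanish at every root of
  \<open>q\<close>, and the roots are split off one at a time. The finite set \<open>Z\<close> of
  exceptions comes from the induction: after division by t - x the bound is lost at \<open>x\<close>
  itself.\<close>

lemma poly_dvd_if_bounded:
  fixes p q :: "complex poly"
  assumes "q \<noteq> 0" "finite Z"
    and "\<And>r. \<exists>C. \<forall>t. cmod t \<le> r \<longrightarrow> t \<notin> Z \<longrightarrow> cmod (poly p t) \<le> C * cmod (poly q t)"
  shows "q dvd p"
  using assms
proof (induction "degree q" arbitrary: p q Z)
  case 0
  then show ?case by (metis is_unit_iff_degree unit_imp_dvd)
next
  case (Suc n)
  then obtain x where x: "poly q x = 0"
    using fundamental_theorem_of_algebra[of q] constant_degree by force
  obtain C where C: "\<And>t. cmod t \<le> cmod x + 1 \<Longrightarrow> t \<notin> Z \<Longrightarrow> cmod (poly p t) \<le> C * cmod (poly q t)"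
    using Suc.prems(3) by metis
  have "cmod (poly p x) \<le> C * cmod (poly q x)"
  proof (rule tendsto_le[where F = "at x"])
    show "((\<lambda>t. C * cmod (poly q t)) \<longlongrightarrow> C * cmod (poly q x)) (at x)"
      by (intro tendsto_intros)
    show "((\<lambda>t. cmod (poly p t)) \<longlongrightarrow> cmod (poly p x)) (at x)"
      by (intro tendsto_intros)
    obtain d where "d > 0" "\<forall>t\<in>Z. t \<noteq> x \<longrightarrow> d \<le> dist x t"
      using finite_set_avoid[OF Suc.prems(2)] by blast
    moreover have "cmod t \<le> cmod x + 1" if "dist t x < 1" for t
      using norm_triangle_ineq2[of t x] that by (simp add: dist_norm)
    ultimately show "\<forall>\<^sub>F t in at x. cmod (poly p t) \<le> C * cmod (poly q t)"
      unfolding eventually_at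
      by (intro exI[of _ "min d 1"]) (force simp: dist_commute intro!: C)
  qed simp
  then have "poly p x = 0" using x by simp
  then obtain p' q' where p': "p = [:-x, 1:] * p'" and q': "q = [:-x, 1:] * q'"
    using x by (meson poly_eq_0_iff_dvd dvdE)
  have "q' \<noteq> 0" using q' Suc.prems by auto
  moreover have "n = degree q'"
    using Suc.hyps(2) q' \<open>q' \<noteq> 0\<close> by (simp add: degree_mult_eq del: mult_pCons_left)
  moreover have "\<exists>C. \<forall>t. cmod t \<le> r \<longrightarrow> t \<notin> insert x Z \<longrightarrow> cmod (poly p' t) \<le> C * cmod (poly q' t)"
      for r
  proof -
    obtain C where C: "\<And>t. cmod t \<le> r \<Longrightarrow> t \<notin> Z \<Longrightarrow> cmod (poly p t) \<le> C * cmod (poly q t)"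
      using Suc.prems(3) by metis
    have "cmod (poly p' t) \<le> C * cmod (poly q' t)" if "cmod t \<le> r" "t \<notin> insert x Z" for t
    proof -
      have "cmod (t - x) * cmod (poly p' t) \<le> cmod (t - x) * (C * cmod (poly q' t))"
        using C[of t] that unfolding p' q' poly_mult norm_mult by (simp add: algebra_simps)
      then show ?thesis using that by simp
    qed
    then show ?thesis by blast
  qed
  ultimately have "q' dvd p'"
    using Suc.hyps(1)[of q' "insert x Z" p'] Suc.prems(2) by blast
  then show ?case unfolding p' q' by (rule mult_dvd_mono[OF dvd_refl])
qed

text \<open>A locally bounded quotient of polynomials is a polynomial. On lines in a direction where
  \<open>q\<close> is monic this is the statement in one variable, and division by a monic family
  makes the quotient polynomial in the base point as well.\<close>

lemma hpoly_dvd_if_bounded: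
  fixes p q :: "complex ^ 'm::finite \<Rightarrow> complex"
  assumes p: "hpoly p" and q: "hpoly q" "\<exists>z. q z \<noteq> 0"
    and bd: "\<And>r. \<exists>C. \<forall>a. norm a \<le> r \<longrightarrow> q a \<noteq> 0 \<longrightarrow> cmod (p a) \<le> C * cmod (q a)"
  shows "\<exists>h. hpoly h \<and> (\<forall>a. p a = q a * h a)"
proof -
  obtain b e k where k: "k \<noteq> 0" and mon: "monic_family e (\<lambda>a. smult k (line b q a))"
    using monic_line_exists[OF q] by blast
  have "line b q a dvd line b p a" for a
  proof (rule poly_dvd_if_bounded)
    show nz: "line b q a \<noteq> 0" using mon by (metis monic_family_def coeff_0 smult_0_right
        zero_neq_one)
    show "finite {t. poly (line b q a) t = 0}" using nz by (rule poly_roots_finite)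
    fix r
    obtain C where C: "\<And>x. norm x \<le> norm a + r * norm b \<Longrightarrow> q x \<noteq> 0 \<Longrightarrow> cmod (p x) \<le> C * cmod (q x)"
      using bd by metis
    have "norm (a + t *s b) \<le> norm a + r * norm b" if "cmod t \<le> r" for t
      using that by (intro norm_triangle_le add_left_mono)
        (simp add: norm_vector_scalar_mult mult_right_mono)
    then show "\<exists>C. \<forall>t. cmod t \<le> r \<longrightarrow> t \<notin> {t. poly (line b q a) t = 0} \<longrightarrow>
        cmod (poly (line b p a) t) \<le> C * cmod (poly (line b q a) t)"
      using C by (intro exI[of _ C]) (auto simp: poly_line p q)
  qed
  then have "smult k (line b q a) dvd line b p a" for a
    using k by (simp add: smult_dvd_iff)
  then obtain Q where Q: "poly_family Q" "\<And>a. line b p a = smult k (line b q a) * Q a"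
    using monic_family_dvd[OF mon poly_family_line[OF p, of b], of "\<lambda>_. 1"] hpoly_intros(1)[of 1]
    by auto
  have "p a = q a * (k * poly (Q a) 0)" for a
    using arg_cong[OF Q(2)[of a], of "\<lambda>s. poly s 0"] by (simp add: poly_line p q)
  moreover have "hpoly (\<lambda>a. k * poly (Q a) 0)" by (intro hpoly_intros hpoly_poly Q)
  ultimately show ?thesis by blast
qed

text \<open>Cauchy's bound: if |x| > 1, solve for x^e and divide by |x|^(e - 1). The bound is
  continuous in the coefficients, hence locally bounded along a monic family.\<close>

lemma root_bound:
  fixes g :: "complex poly"
  assumes "coeff g e = 1" "degree g = e" "poly g x = 0"
  shows "cmod x \<le> 1 + (\<Sum>i<e. cmod (coeff g i))"
proof (cases "cmod x \<le> 1")
  case True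
  moreover have "0 \<le> (\<Sum>i<e. cmod (coeff g i))" by (simp add: sum_nonneg)
  ultimately show ?thesis by simp
next
  case False
  then have x: "cmod x > 1" by simp
  have "e \<noteq> 0"
    using assms poly_eq_oneI[of g] by (metis poly_1 zero_neq_one)
  have "0 = (\<Sum>i<e. coeff g i * x ^ i) + x ^ e"
    using assms by (simp add: poly_altdef flip: lessThan_Suc_atMost)
  then have "cmod (x ^ e) = cmod (\<Sum>i<e. coeff g i * x ^ i)"
    by (metis add.commute add_eq_0_iff norm_minus_cancel)
  also have "\<dots> \<le> (\<Sum>i<e. cmod (coeff g i) * cmod x ^ (e - 1))"
  proof (intro sum_norm_le)
    fix i assume "i \<in> {..<e}"
    then have "cmod x ^ i \<le> cmod x ^ (e - 1)" using x by (intro power_increasing) auto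
    then show "cmod (coeff g i * x ^ i) \<le> cmod (coeff g i) * cmod x ^ (e - 1)"
      by (simp add: norm_mult norm_power mult_left_mono)
  qed
  also have "\<dots> = (\<Sum>i<e. cmod (coeff g i)) * cmod x ^ (e - 1)"
    by (simp add: sum_distrib_right)
  finally have "cmod x * cmod x ^ (e - 1) \<le> (\<Sum>i<e. cmod (coeff g i)) * cmod x ^ (e - 1)"
    using \<open>e \<noteq> 0\<close> by (cases e) (auto simp: norm_mult norm_power)
  moreover have "0 < cmod x ^ (e - 1)" using x by (intro zero_less_power) linarith
  ultimately have "cmod x \<le> (\<Sum>i<e. cmod (coeff g i))"
    by (intro mult_right_le_imp_le[of "cmod x" "cmod x ^ (e - 1)"]) auto
  then show ?thesis by simp
qed

text \<open>Splitting off a factor t - x with |x| at most \<open>R\<close> enlarges the bound on the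
  coefficients by at most the factor 1 + R.\<close>

lemma coeff_bound_roots:
  fixes m :: "complex poly"
  assumes "lead_coeff m = 1" "R \<ge> 0" "\<And>x. poly m x = 0 \<Longrightarrow> cmod x \<le> R"
  shows "cmod (coeff m i) \<le> (1 + R) ^ degree m"
  using assms
proof (induction "degree m" arbitrary: m i)
  case 0
  then have "m = 1" by (intro poly_eq_oneI) auto
  then show ?case by (cases i) auto
next
  case (Suc n)
  then obtain x where x: "poly m x = 0"
    using fundamental_theorem_of_algebra[of m] constant_degree by force
  then obtain m' where m': "m = [:-x, 1:] * m'" by (meson poly_eq_0_iff_dvd dvdE)
  have "m' \<noteq> 0" using m' Suc.prems by auto
  then have deg: "degree m = Suc (degree m')"
    unfolding m' by (simp add: degree_mult_eq del: mult_pCons_left)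
  have lead: "lead_coeff m' = 1"
    using Suc.prems(1) lead_coeff_mult[of "[:-x, 1:]" m'] unfolding m' by simp
  have IH: "cmod (coeff m' j) \<le> (1 + R) ^ n" for j
    using Suc.hyps(1)[of m' j] Suc.hyps(2) deg lead Suc.prems m' by auto
  have R: "cmod x \<le> R" using Suc.prems x by blast
  have "cmod (coeff m i) \<le> cmod (coeff (pCons 0 m') i) + cmod x * cmod (coeff m' i)"
    unfolding m' using norm_triangle_ineq4[of "coeff (pCons 0 m') i" "x * coeff m' i"]
    by (simp add: norm_mult)
  also have "\<dots> \<le> (1 + R) ^ n + R * (1 + R) ^ n"
    using IH Suc.prems R
    by (intro add_mono mult_mono) (auto simp: coeff_pCons split: nat.split)
  also have "\<dots> = (1 + R) ^ degree m" using Suc.hyps(2)[symmetric] by (simp add: algebra_simps)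
  finally show ?case .
qed


text \<open>
  A substitute for unique factorization: the denominators of \<open>f / g\<close> form a principal ideal.  In a
  direction in which \<open>g\<close> is monic, take a denominator \<open>v\<close> of least degree, with leading coefficient
  \<open>lc\<close>.  Where \<open>lc\<close> does not vanish, \<open>v\<close> divides \<open>g\<close>, so the roots of \<open>v\<close> are bounded by those of \<open>g\<close>
  and the coefficients of \<open>v / lc\<close> are locally bounded, hence polynomials.  Division by the monic
  polynomial \<open>v / lc\<close> then shows that it generates the ideal.
\<close>

lemma hpoly_denominator:
  fixes f g :: "complex ^ 'm::finite \<Rightarrow> complex"
  assumes f: "hpoly f" and g: "hpoly g" "\<exists>z. g z \<noteq> 0"
  shows "\<exists>u w. hpoly u \<and> hpoly w \<and> (\<forall>z. f z * u z = g z * w z) \<and>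
           (\<forall>v h. hpoly v \<longrightarrow> hpoly h \<longrightarrow> (\<forall>z. f z * v z = g z * h z) \<longrightarrow>
             (\<exists>k. hpoly k \<and> (\<forall>z. v z = u z * k z)))"
proof -
  obtain b e0 k where k: "k \<noteq> 0" and mon: "monic_family e0 (\<lambda>a. smult k (line b g a))"
    using monic_line_exists[OF g] by blast
  define F where "F = line b f"
  define G where "G = (\<lambda>a. smult k (line b g a))"
  have F: "poly_family F" unfolding F_def by (rule poly_family_line[OF f])
  have monG: "monic_family e0 G" using mon by (simp add: G_def)
  then have G: "poly_family G" by (simp add: monic_family_def)
  \<comment> \<open>The denominators are collected in C[z][t] instead of C[z], so that a degree in
    \<open>t\<close> is available for choosing a smallest one.\<close>
  define I where "I = {v. poly_family v \<and> (\<exists>w. poly_family w \<and> (\<forall>a. F a * v a = G a * w a))}"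
  have I_family: "poly_family v" if "v \<in> I" for v using that by (simp add: I_def)
  have I_diff: "(\<lambda>a. v a - w a) \<in> I" if vw: "v \<in> I" "w \<in> I" for v w
  proof -
    from vw obtain v' w' where "poly_family v'" "poly_family w'"
      "\<forall>a. F a * v a = G a * v' a" "\<forall>a. F a * w a = G a * w' a" by (auto simp: I_def)
    then show ?thesis using vw
      by (auto simp: I_def algebra_simps intro!: poly_family_diff exI[of _ "\<lambda>a. v' a - w' a"])
  qed
  have I_mult: "(\<lambda>a. c a * v a) \<in> I" if vc: "v \<in> I" "poly_family c" for v c
  proof -
    from vc obtain v' where "poly_family v'" "\<forall>a. F a * v a = G a * v' a" by (auto simp: I_def)
    then show ?thesis using vc
      by (auto simp: I_def algebra_simps intro!: poly_family_mult exI[of _ "\<lambda>a. c a * v' a"])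
  qed
  have GI: "G \<in> I" using F G by (auto simp: I_def mult.commute intro!: exI[of _ F])
  have G1: "degree (G a) = e0" "coeff (G a) e0 = 1" for a
    using monG by (auto simp: monic_family_def)
  define nz where "nz N v \<longleftrightarrow> v \<in> I \<and> (\<exists>a. v a \<noteq> 0) \<and> (\<forall>a. degree (v a) \<le> N)" for N v
  define e where "e = (LEAST N. \<exists>v. nz N v)"
  have "nz e0 G" using GI G1 unfolding nz_def by (metis coeff_0 order_refl zero_neq_one)
  then have "\<exists>N. \<exists>v. nz N v" by blast
  then have "\<exists>v. nz e v" unfolding e_def by (rule LeastI_ex)
  then obtain v where v: "nz e v" by blast
  have least: "w a = 0" if "w \<in> I" "\<And>a. degree (w a) \<le> N" "N < e" for w a N
  proof (rule ccontr)
    assume "w a \<noteq> 0"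
    then have "nz N w" using that by (auto simp: nz_def)
    then have "e \<le> N" unfolding e_def by (intro Least_le) blast
    then show False using \<open>N < e\<close> by simp
  qed
  have vI: "v \<in> I" and vdeg: "degree (v a) \<le> e" for a using v by (auto simp: nz_def)
  define lc where "lc a = coeff (v a) e" for a
  have lc: "hpoly lc" unfolding lc_def using vI by (intro poly_family_coeff I_family)
  have lc0: "\<exists>a. lc a \<noteq> 0"
  proof (rule ccontr)
    assume "\<not> ?thesis"
    then have z: "coeff (v a) e = 0" for a by (simp add: lc_def)
    have "v a = 0" for a
    proof (cases e)
      case 0
      then show ?thesis using z[of a] vdeg[of a] by (metis le_zero_eq leading_coeff_0_iff)
    next
      case (Suc N)
      then have "degree (v a) \<le> N" for a using z[of a] vdeg[of a]
          by (auto intro: degree_le_decrease)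
      then show ?thesis using least[OF vI, of N] Suc by blast
    qed
    then show False using v by (auto simp: nz_def)
  qed
  \<comment> \<open>Pseudo-division by \<open>v\<close>: each step first multiplies by
    \<open>lc\<close>, so that coefficients remain polynomials. A remainder of degree below
    \<open>e\<close> is again a denominator and vanishes by minimality of \<open>e\<close>.\<close>
  have pseudo: "\<exists>s. \<forall>a. v a dvd smult (lc a ^ s) (w a)"
    if "w \<in> I" "\<And>a. degree (w a) \<le> N" for w N
    using that
  proof (induction N arbitrary: w)
    case 0
    show ?case
    proof (cases "e = 0")
      case True
      have "v a dvd smult (lc a) (w a)" for a
      proof -
        have "v a = [:lc a:]" using vdeg[of a] True by (simp add: lc_def degree_0_id)
        then have "smult (lc a) (w a) = v a * w a" by simp
        then show ?thesis by simp
      qed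
      then show ?thesis by (intro exI[of _ 1]) simp
    next
      case False
      then have "w a = 0" for a using least[OF 0(1), of 0] 0(2) by blast
      then show ?thesis by simp
    qed
  next
    case (Suc N)
    show ?case
    proof (cases "Suc N < e")
      case True
      then have "w a = 0" for a using least[OF Suc.prems(1), of "Suc N"] Suc.prems(2) by blast
      then show ?thesis by simp
    next
      case False
      define M where "M a = monom (coeff (w a) (Suc N)) (Suc N - e)" for a
      have M: "poly_family M" unfolding M_def
        using Suc.prems by (intro poly_family_monom poly_family_coeff I_family)
      define w' where "w' a = [:lc a:] * w a - M a * v a" for a
      have "w' \<in> I" unfolding w'_def
        by (intro I_diff I_mult Suc.prems vI M poly_family_const lc)
      moreover have "degree (w' a) \<le> N" for a
      proof (rule degree_le_decrease)
        have "degree (M a * v a) \<le> degree (M a) + degree (v a)" by (rule degree_mult_le)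
        also have "\<dots> \<le> Suc N - e + e"
          using vdeg by (intro add_mono) (auto simp: M_def degree_monom_le)
        finally show "degree (w' a) \<le> Suc N" unfolding w'_def
          using False Suc.prems(2)[of a]
          by (intro degree_diff_le) (auto intro: order_trans[OF degree_smult_le])
        show "coeff (w' a) (Suc N) = 0"
          using False by (simp add: w'_def M_def coeff_monom_mult lc_def)
      qed
      ultimately obtain s where s: "\<And>a. v a dvd smult (lc a ^ s) (w' a)"
        using Suc.IH[of w'] by blast
      have "v a dvd smult (lc a ^ Suc s) (w a)" for a
      proof -
        have "smult (lc a ^ Suc s) (w a) = smult (lc a ^ s) (w' a) + smult (lc a ^ s) (M a) * v a"
          by (simp add: w'_def algebra_simps smult_diff_right)
        then show ?thesis using s[of a] by (metis dvd_add dvd_triv_right)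
      qed
      then show ?thesis by blast
    qed
  qed
  obtain s where s: "\<And>a. v a dvd smult (lc a ^ s) (G a)"
    using pseudo[OF GI, of e0] G1 by auto
  have vG: "v a dvd G a" if "lc a \<noteq> 0" for a
    using s[of a] that by (metis dvd_smult_cancel power_not_zero)
  define R where "R a = 1 + (\<Sum>i<e0. cmod (coeff (G a) i))" for a
  have R0: "R a \<ge> 0" for a unfolding R_def by (simp add: sum_nonneg add_nonneg_nonneg)
  have coeff_le: "cmod (coeff (v a) i) \<le> (1 + R a) ^ e * cmod (lc a)" if "lc a \<noteq> 0" for a i
  proof -
    define m where "m = smult (1 / lc a) (v a)"
    have "degree (v a) = e"
      using vdeg[of a] that by (intro antisym le_degree) (auto simp: lc_def)
    then have m: "degree m = e" "lead_coeff m = 1" using that by (auto simp: m_def lc_def)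
    have "cmod x \<le> R a" if "poly m x = 0" for x
    proof -
      have "poly (v a) x = 0" using that \<open>lc a \<noteq> 0\<close> by (simp add: m_def)
      then have "poly (G a) x = 0" using vG[OF \<open>lc a \<noteq> 0\<close>] by (meson dvd_trans poly_eq_0_iff_dvd)
      then show ?thesis unfolding R_def by (intro root_bound G1)
    qed
    then have "cmod (coeff m i) \<le> (1 + R a) ^ e"
      using coeff_bound_roots[of m "R a" i] m R0 by simp
    then show ?thesis using that by (simp add: m_def norm_divide field_simps)
  qed
  have contR: "continuous_on S R" for S unfolding R_def
    using G by (intro continuous_intros continuous_on_hpoly poly_family_coeff)
  have "\<exists>h. hpoly h \<and> (\<forall>a. coeff (v a) i = lc a * h a)" for i
  proof (rule hpoly_dvd_if_bounded[OF _ lc lc0])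
    show "hpoly (\<lambda>a. coeff (v a) i)" by (intro poly_family_coeff I_family vI)
    fix r
    have "compact (R ` cball 0 r)" by (intro compact_continuous_image contR compact_cball)
    then obtain C where C: "\<And>a. norm a \<le> r \<Longrightarrow> R a \<le> C"
      by (force dest!: compact_imp_bounded simp: bounded_real abs_le_iff)
    have "cmod (coeff (v a) i) \<le> (1 + C) ^ e * cmod (lc a)" if "norm a \<le> r" "lc a \<noteq> 0" for a
    proof -
      have "(1 + R a) ^ e \<le> (1 + C) ^ e"
        using C[OF that(1)] R0[of a] by (intro power_mono) auto
      then show ?thesis using coeff_le[OF that(2), of i]
        by (meson mult_right_mono norm_ge_zero order_trans)
    qed
    then show "\<exists>C. \<forall>a. norm a \<le> r \<longrightarrow> lc a \<noteq> 0 \<longrightarrow> cmod (coeff (v a) i) \<le> C * cmod (lc a)"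
      by blast
  qed
  then obtain h where h: "\<And>i. hpoly (h i)" "\<And>i a. coeff (v a) i = lc a * h i a" by metis
  define v' where "v' a = (\<Sum>i<e. monom (h i a) i) + monom 1 e" for a
  have coeff_v': "coeff (v' a) i = (if i < e then h i a else if i = e then 1 else 0)" for a i
    by (auto simp: v'_def coeff_sum)
  have "degree (v' a) = e" for a
    by (intro antisym degree_le le_degree) (auto simp: coeff_v')
  moreover have "poly_family v'"
  proof (rule poly_familyI[where N = e])
    show "hpoly (\<lambda>a. coeff (v' a) i)" for i
      using h(1) by (cases i e rule: linorder_cases) (auto simp: coeff_v' intro: hpoly_intros)
  qed (simp add: \<open>\<And>a. degree (v' a) = e\<close>)
  ultimately have monv': "monic_family e v'" by (simp add: monic_family_def coeff_v')
  have vv': "v a = smult (lc a) (v' a)" for a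
  proof (rule poly_eqI)
    fix i show "coeff (v a) i = coeff (smult (lc a) (v' a)) i"
      using vdeg[of a] h(2)[of a i] by (auto simp: coeff_v' lc_def coeff_eq_0)
  qed
  \<comment> \<open>Removing the factor \<open>lc\<close> keeps \<open>v'\<close> a denominator: the
    monic \<open>G\<close> divides F v' wherever \<open>lc\<close> is nonzero, hence
    everywhere.\<close>
  have "\<exists>Q. poly_family Q \<and> (\<forall>a. F a * v' a = G a * Q a)"
  proof (rule monic_family_dvd[OF monG _ lc lc0])
    show "poly_family (\<lambda>a. F a * v' a)"
      using monv' by (intro poly_family_mult F) (simp add: monic_family_def)
    fix a assume "lc a \<noteq> 0"
    have "G a dvd F a * v a" using vI by (auto simp: I_def)
    then show "G a dvd F a * v' a" using \<open>lc a \<noteq> 0\<close> by (simp add: vv' dvd_smult_iff)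
  qed
  then have v'I: "v' \<in> I" using monv' by (auto simp: I_def monic_family_def)
  then obtain W where W: "poly_family W" "\<And>a. F a * v' a = G a * W a" by (auto simp: I_def)
  have gen: "\<exists>Q. poly_family Q \<and> (\<forall>a. w a = v' a * Q a)" if wI: "w \<in> I" for w
  proof -
    obtain Q R where Q: "poly_family Q" and QR: "\<And>a. w a = v' a * Q a + R a"
      and R: "\<And>a. R a = 0 \<or> degree (R a) < e"
      using monic_family_division[OF monv' I_family[OF wI]] by blast
    have "R = (\<lambda>a. w a - Q a * v' a)" by (simp add: QR fun_eq_iff)
    then have "R \<in> I" using I_diff[OF wI I_mult[OF v'I Q]] by simp
    have "R a = 0" for a
    proof (cases e)
      case (Suc N)
      then have "degree (R a) \<le> N" for a using R[of a] by auto
      then show ?thesis using least[OF \<open>R \<in> I\<close>, of N] Suc by blast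
    qed (use R in auto)
    then show ?thesis using Q QR by auto
  qed
  \<comment> \<open>Evaluation at t = 0 returns from C[z][t] to C[z]; \<open>k\<close> is the
    constant that made \<open>g\<close> monic.\<close>
  have poly_F: "poly (F a) 0 = f a" and poly_G: "poly (G a) 0 = k * g a" for a
    by (simp_all add: F_def G_def poly_line f g)
  show ?thesis
  proof (rule exI, rule exI, intro conjI allI impI)
    show "hpoly (\<lambda>a. poly (v' a) 0)" by (intro hpoly_poly I_family v'I)
    show "hpoly (\<lambda>a. k * poly (W a) 0)" by (intro hpoly_intros hpoly_poly W)
    show "f a * poly (v' a) 0 = g a * (k * poly (W a) 0)" for a
      using arg_cong[OF W(2)[of a], of "\<lambda>p. poly p 0"] by (simp add: poly_F poly_G)
    fix x h assume x: "hpoly x" and h: "hpoly h" and eq: "\<forall>z. f z * x z = g z * h z"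
    have "F a * line b x a = G a * smult (1 / k) (line b h a)" for a
      by (rule poly_eqI_fun) (use k eq in \<open>simp add: F_def G_def poly_line f g x h\<close>)
    then have "line b x \<in> I"
      by (auto simp: I_def intro!: poly_family_line x exI[of _ "\<lambda>a. smult (1 / k) (line b h a)"]
           poly_family_smult hpoly_intros h)
    then obtain Q where Q: "poly_family Q" "\<And>a. line b x a = v' a * Q a" using gen by blast
    have "x a = poly (v' a) 0 * poly (Q a) 0" for a
      using arg_cong[OF Q(2)[of a], of "\<lambda>p. poly p 0"] by (simp add: poly_line x)
    then show "\<exists>q. hpoly q \<and> (\<forall>a. x a = poly (v' a) 0 * q a)"
      using hpoly_poly[OF Q(1), of 0] by blast
  qed
qed

section \<open>Divisibility and partial derivatives\<close>

lemma hpoly_divide: "hpoly f \<Longrightarrow> hpoly (\<lambda>z. f z / c)"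
  using holomorphic_polynomial.mult[OF holomorphic_polynomial.const[of "1 / c"], of f] by simp

definition hdvd :: "(complex ^ 'm \<Rightarrow> complex) \<Rightarrow> (complex ^ 'm \<Rightarrow> complex) \<Rightarrow> bool" where
  "hdvd f g \<longleftrightarrow> (\<exists>h. hpoly h \<and> (\<forall>z. g z = f z * h z))"

text \<open>Coprimality is encoded as the conclusion of Euclid's lemma, in both directions, since
  this is the form in which it is applied. \<open>hcoprime_common_divisor\<close> and
  \<open>hcoprimeI\<close> connect it with common divisors being constant.\<close>

definition hcoprime :: "(complex ^ 'm \<Rightarrow> complex) \<Rightarrow> (complex ^ 'm \<Rightarrow> complex) \<Rightarrow> bool" where
  "hcoprime f g \<longleftrightarrow>
     (\<forall>h. hpoly h \<longrightarrow> hdvd g (\<lambda>z. f z * h z) \<longrightarrow> hdvd g h) \<and>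
     (\<forall>h. hpoly h \<longrightarrow> hdvd f (\<lambda>z. g z * h z) \<longrightarrow> hdvd f h)"

lemma hdvdI: "hpoly h \<Longrightarrow> (\<And>z. g z = f z * h z) \<Longrightarrow> hdvd f g"
  by (auto simp: hdvd_def)

lemma hdvdE:
  assumes "hdvd f g" obtains h where "hpoly h" "\<And>z. g z = f z * h z"
  using assms by (auto simp: hdvd_def)

lemma hcoprimeD1: "hcoprime f g \<Longrightarrow> hpoly h \<Longrightarrow> hdvd g (\<lambda>z. f z * h z) \<Longrightarrow> hdvd g h"
  by (simp add: hcoprime_def)

lemma hcoprimeD2: "hcoprime f g \<Longrightarrow> hpoly h \<Longrightarrow> hdvd f (\<lambda>z. g z * h z) \<Longrightarrow> hdvd f h"
  by (simp add: hcoprime_def)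

lemma hpoly_unit:
  assumes "hpoly h" "hpoly k" "\<And>z. h z * k z = 1"
  shows "\<exists>c. c \<noteq> 0 \<and> h = (\<lambda>z. c)"
proof -
  have nz: "h z \<noteq> 0" for z using assms(3)[of z] by auto
  then have "h z = h 0" for z using hpoly_nowhere_zero_const[OF assms(1)] by blast
  then show ?thesis using nz by (intro exI[of _ "h 0"]) auto
qed

lemma hcoprime_common_divisor:
  assumes cop: "hcoprime f g" and g: "hpoly g" "\<exists>z. g z \<noteq> 0"
    and h: "hpoly h" "hdvd h f" "hdvd h g"
  shows "\<exists>c. c \<noteq> 0 \<and> h = (\<lambda>z. c)"
proof -
  obtain m k where m: "hpoly m" "\<And>z. f z = h z * m z" and k: "hpoly k" "\<And>z. g z = h z * k z"
    using h by (elim hdvdE) blast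
  have "hdvd g (\<lambda>z. f z * k z)" using m k by (intro hdvdI[of m]) auto
  then have "hdvd g k" by (rule hcoprimeD1[OF cop k(1)])
  then obtain l where l: "hpoly l" "\<And>z. k z = g z * l z"
    unfolding hdvd_def by blast
  have "h z * l z = 1" for z
  proof (rule hpoly_cancel[where F = g])
    show "g z * (h z * l z) = g z * 1" for z using k(2)[of z] l(2)[of z] by simp
  qed (auto intro: hpoly_closed h l g)
  then show ?thesis using hpoly_unit h(1) l(1) by blast
qed

text \<open>The reduced denominator is the generator \<open>u\<close> of the denominator ideal of f
  / g, and \<open>D\<close> is g / u, which exists because \<open>g\<close> is itself a denominator.
  Coprimality holds because each divisibility in Euclid's lemma exhibits a further denominator,
  which \<open>u\<close> must divide.\<close>

lemma hpoly_reduce: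
  fixes f g :: "complex ^ 'm::finite \<Rightarrow> complex"
  assumes f: "hpoly f" and g: "hpoly g" "\<exists>z. g z \<noteq> 0"
  obtains D f' g' where "hpoly D" "hpoly f'" "hpoly g'" "\<And>z. f z = D z * f' z"
    "\<And>z. g z = D z * g' z" "hcoprime f' g'"
proof -
  obtain u w where u: "hpoly u" and w: "hpoly w" and fu: "\<And>z. f z * u z = g z * w z"
    and gen: "\<And>v h. hpoly v \<Longrightarrow> hpoly h \<Longrightarrow> (\<And>z. f z * v z = g z * h z) \<Longrightarrow>
                \<exists>k. hpoly k \<and> (\<forall>z. v z = u z * k z)"
    using hpoly_denominator[OF f g] by metis
  obtain D where D: "hpoly D" "\<And>z. g z = u z * D z"
    using gen[OF g(1) f] by (auto simp: mult.commute)
  have nz: "\<exists>z. u z \<noteq> 0" "\<exists>z. D z \<noteq> 0" using g(2) D(2) by auto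
  have fD: "f z = D z * w z" for z
    by (rule hpoly_cancel[OF u f _ _ nz(1)]) (use fu D in \<open>auto intro: hpoly_intros w simp:
        algebra_simps\<close>)
  have "hcoprime w u"
    unfolding hcoprime_def
  proof (intro conjI allI impI)
    fix h assume h: "hpoly h" and "hdvd u (\<lambda>z. w z * h z)"
    then obtain k where k: "hpoly k" "\<And>z. w z * h z = u z * k z" by (elim hdvdE) blast
    then have "f z * h z = g z * k z" for z by (simp add: fD D(2) mult.assoc)
    then show "hdvd u h" using gen[OF h k(1)] by (auto simp: hdvd_def)
  next
    fix h assume h: "hpoly h" and "hdvd w (\<lambda>z. u z * h z)"
    then obtain k where k: "hpoly k" "\<And>z. u z * h z = w z * k z" by (elim hdvdE) blast
    have "f z * k z = D z * (w z * k z)" for z by (simp add: fD)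
    then have "f z * k z = g z * h z" for z by (simp add: k(2)[symmetric] D(2))
    then obtain l where l: "hpoly l" "\<And>z. k z = u z * l z" using gen[OF k(1) h] by blast
    have "h z = w z * l z" for z
      by (rule hpoly_cancel[OF u h _ _ nz(1)]) (use k l in \<open>auto intro: hpoly_intros w simp:
          algebra_simps\<close>)
    then show "hdvd w h" using l(1) by (rule hdvdI[rotated])
  qed
  then show ?thesis using that[OF D(1) w u fD] D(2) by (simp add: mult.commute)
qed

lemma relatively_prime_constD:
  assumes "relatively_prime hpoly X" "hpoly h" "\<And>f. f \<in> X \<Longrightarrow> hdvd h f"
  shows "\<exists>c. c \<noteq> 0 \<and> h = (\<lambda>z. c)"
proof -
  have "\<exists>g. hpoly g \<and> f = (\<lambda>z. h z * g z)" if "f \<in> X" for f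
    using assms(3)[OF that] by (auto simp: hdvd_def fun_eq_iff)
  then show ?thesis using assms(1,2) unfolding relatively_prime_def by blast
qed

lemma relatively_primeI:
  assumes "\<And>h. hpoly h \<Longrightarrow> (\<And>f. f \<in> X \<Longrightarrow> hdvd h f) \<Longrightarrow> \<exists>c. c \<noteq> 0 \<and> h = (\<lambda>z. c)"
  shows "relatively_prime hpoly X"
  unfolding relatively_prime_def
proof (intro allI impI)
  fix h :: "complex ^ 'a \<Rightarrow> complex"
  assume "hpoly h" "\<forall>f\<in>X. \<exists>g. hpoly g \<and> f = (\<lambda>z. h z * g z)"
  then have "hdvd h f" if "f \<in> X" for f using that by (force simp: hdvd_def)
  then show "\<exists>c. c \<noteq> 0 \<and> h = (\<lambda>z. c)" using assms \<open>hpoly h\<close> by blast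
qed

lemma relatively_prime_nonzero:
  assumes "relatively_prime hpoly X" shows "\<exists>f\<in>X. \<exists>z. f z \<noteq> 0"
proof (rule ccontr)
  assume "\<not> ?thesis"
  then have "hdvd (\<lambda>z. 0) f" if "f \<in> X" for f
    using that by (intro hdvdI[of "\<lambda>z. 0"]) (auto intro: hpoly_intros)
  then have "\<exists>c. c \<noteq> 0 \<and> (\<lambda>z::complex^'a. 0) = (\<lambda>z. c::complex)"
    by (intro relatively_prime_constD[OF assms]) (auto intro: hpoly_intros)
  then show False by (metis)
qed

text \<open>The factor cancelled in passing to lowest terms is a common divisor, hence a nonzero
  constant, and such constants do not affect divisibility.\<close>

lemma hcoprimeI:
  fixes f g :: "complex ^ 'm::finite \<Rightarrow> complex"
  assumes f: "hpoly f" and g: "hpoly g" "\<exists>z. g z \<noteq> 0"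
    and const: "\<And>h. hpoly h \<Longrightarrow> hdvd h f \<Longrightarrow> hdvd h g \<Longrightarrow> \<exists>c. c \<noteq> 0 \<and> h = (\<lambda>z. c)"
  shows "hcoprime f g"
proof -
  obtain D f' g' where D: "hpoly D" and f': "hpoly f'" "\<And>z. f z = D z * f' z"
    and g': "hpoly g'" "\<And>z. g z = D z * g' z" and cop: "hcoprime f' g'"
    using hpoly_reduce[OF f g] by metis
  obtain c where c: "c \<noteq> 0" "D = (\<lambda>z. c)"
    using const[OF D] f' g' by (auto simp: hdvd_def)
  have dvd: "hdvd (\<lambda>z. c * a z) h \<longleftrightarrow> hdvd a h" "hdvd a (\<lambda>z. c * b z * h z) \<longleftrightarrow> hdvd a (\<lambda>z. b z * h z)"
    if "hpoly a" for a b h :: "complex ^ 'm \<Rightarrow> complex"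
  proof -
    show "hdvd (\<lambda>z. c * a z) h \<longleftrightarrow> hdvd a h"
    proof
      assume "hdvd (\<lambda>z. c * a z) h"
      then obtain k where "hpoly k" "\<And>z. h z = c * a z * k z" by (elim hdvdE) blast
      then show "hdvd a h" by (intro hdvdI[of "\<lambda>z. c * k z"]) (auto intro: hpoly_intros)
    next
      assume "hdvd a h"
      then obtain k where "hpoly k" "\<And>z. h z = a z * k z" by (elim hdvdE) blast
      then show "hdvd (\<lambda>z. c * a z) h"
        using c(1) by (intro hdvdI[of "\<lambda>z. 1 / c * k z"]) (auto intro: hpoly_intros hpoly_divide)
    qed
    show "hdvd a (\<lambda>z. c * b z * h z) \<longleftrightarrow> hdvd a (\<lambda>z. b z * h z)"
    proof
      assume "hdvd a (\<lambda>z. c * b z * h z)"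
      then obtain k where "hpoly k" "\<And>z. c * b z * h z = a z * k z" by (elim hdvdE) blast
      then show "hdvd a (\<lambda>z. b z * h z)"
        using c(1) by (intro hdvdI[of "\<lambda>z. 1 / c * k z"]) (auto intro: hpoly_intros hpoly_divide
            simp: field_simps)
    next
      assume "hdvd a (\<lambda>z. b z * h z)"
      then obtain k where "hpoly k" "\<And>z. b z * h z = a z * k z" by (elim hdvdE) blast
      then show "hdvd a (\<lambda>z. c * b z * h z)"
        by (intro hdvdI[of "\<lambda>z. c * k z"]) (auto intro: hpoly_intros)
    qed
  qed
  have "f = (\<lambda>z. c * f' z)" "g = (\<lambda>z. c * g' z)" using f' g' c by auto
  then show ?thesis using cop f'(1) g'(1) by (simp add: hcoprime_def dvd)
qed

text \<open>Write one ratio X / Q as f / g in lowest terms. Proportionality makes \<open>g\<close>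
  divide every f Q_j, hence every Q_j, so \<open>g\<close> is constant. This produces the factor
  \<open>H\<close> of \<eta> and the factor \<open>G\<close> of d\<rho>.\<close>

lemma proportional_multiple:
  fixes Q X :: "'i \<Rightarrow> complex ^ 'm::finite \<Rightarrow> complex"
  assumes Q: "\<And>i. hpoly (Q i)" and prime: "relatively_prime hpoly (range Q)"
    and X: "\<And>i. hpoly (X i)" and eq: "\<And>i j z. X i z * Q j z = X j z * Q i z"
  shows "\<exists>H. hpoly H \<and> (\<forall>i z. X i z = H z * Q i z)"
proof -
  obtain i0 where i0: "\<exists>z. Q i0 z \<noteq> 0" using relatively_prime_nonzero[OF prime] by blast
  obtain D f g where D: "hpoly D" and f: "hpoly f" "\<And>z. X i0 z = D z * f z"
    and g: "hpoly g" "\<And>z. Q i0 z = D z * g z" and cop: "hcoprime f g"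
    using hpoly_reduce[OF X Q i0] by metis
  have D0: "\<exists>z. D z \<noteq> 0" using i0 g by auto
  have fg: "f z * Q j z = g z * X j z" for j z
    by (rule hpoly_cancel[OF D _ _ _ D0])
       (use eq[of i0 _ j] f g in \<open>auto intro!: hpoly_intros Q X simp: algebra_simps\<close>)
  have "hdvd g (Q j)" for j
    by (rule hcoprimeD1[OF cop Q]) (use fg X in \<open>auto simp: hdvd_def\<close>)
  then obtain c where c: "c \<noteq> 0" "g = (\<lambda>z. c)"
    using relatively_prime_constD[OF prime g(1)] by blast
  have "X j z = (1 / c * f z) * Q j z" for j z
    using fg[of z j] c by (simp add: field_simps)
  then show ?thesis using f(1) by (intro exI[of _ "\<lambda>z. 1 / c * f z"]) (auto intro: hpoly_intros
      hpoly_divide)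
qed

section \<open>Factors of polynomials that are independent of, or homogeneous in, some
  variables\<close>

definition depends_on :: "'m set \<Rightarrow> (complex ^ 'm \<Rightarrow> complex) \<Rightarrow> bool" where
  "depends_on S F \<longleftrightarrow> (\<forall>x y. (\<forall>k\<in>S. x $ k = y $ k) \<longrightarrow> F x = F y)"

text \<open>Along a direction in which F G is constant and nonzero, \<open>F\<close> has no zeros
  and is therefore constant. The remaining points, where F G vanishes, are covered by multiplying
  the difference with F G.\<close>

lemma depends_on_factor:
  fixes F G :: "complex ^ 'm \<Rightarrow> complex"
  assumes F: "hpoly F" and G: "hpoly G" and dep: "depends_on S (\<lambda>x. F x * G x)"
    and nz: "\<exists>x. F x * G x \<noteq> 0"
  shows "depends_on S F"
  unfolding depends_on_def
proof (intro allI impI)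
  fix x y :: "complex ^ 'm" assume "\<forall>k\<in>S. x $ k = y $ k"
  define v where "v = y - x"
  have v: "v $ k = 0" if "k \<in> S" for k
    using that \<open>\<forall>k\<in>S. x $ k = y $ k\<close> by (simp add: v_def)
  have "F (z + v) - F z = 0" for z
  proof (rule hpoly_mult_eq_0[where F = "\<lambda>x. F x * G x" and G = "\<lambda>z. F (z + v) - F z"])
    show "hpoly (\<lambda>z. F (z + v) - F z)"
      by (intro hpoly_diff F hpoly_compose[OF F]) (auto intro: hpoly_intros)
    show "hpoly (\<lambda>x. F x * G x)" by (intro hpoly_intros F G)
    show "F z * G z * (F (z + v) - F z) = 0" for z
    proof (cases "F z * G z = 0")
      case False
      have eq: "F (z + t *s v) * G (z + t *s v) = F z * G z" for t
        using dep v unfolding depends_on_def by (auto dest!: spec[of _ "z + t *s v"] spec[of _ z])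
      have "F (z + t *s v) \<noteq> 0" for t using False eq[of t] by (metis mult_zero_left)
      then have "poly (line v F z) t \<noteq> 0" for t by (simp add: poly_line F)
      then have "poly (line v F z) 1 = poly (line v F z) 0" by (rule poly_nowhere_zero_const)
      then show ?thesis by (simp add: poly_line F)
    qed auto
  qed (use nz in auto)
  from this[of x] show "F x = F y" by (simp add: v_def)
qed

definition scale_coords :: "'m set \<Rightarrow> complex \<Rightarrow> complex ^ 'm \<Rightarrow> complex ^ 'm" where
  "scale_coords S c x = (\<chi> k. if k \<in> S then c * x $ k else x $ k)"

text \<open>Only 0 can be a root of \<open>p\<close>; after division by the full power of t the
  remaining factor has no root and is constant.\<close>

lemma factor_of_monom:
  fixes p q :: "complex poly"
  assumes eq: "p * q = monom a n" and a: "a \<noteq> 0"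
  shows "\<exists>c l. p = monom c l"
proof -
  have nz: "p \<noteq> 0" using assms by (metis monom_eq_0_iff mult_zero_left)
  obtain r where r: "p = [:- 0, 1:] ^ order 0 p * r" "\<not> [:- 0, 1:] dvd r"
    using order_decomp[OF nz, of 0] by blast
  have "poly r t \<noteq> 0" for t
  proof (cases "t = 0")
    case True
    then show ?thesis using r(2) by (simp add: poly_eq_0_iff_dvd)
  next
    case False
    have "poly p t * poly q t = a * t ^ n" using eq by (metis poly_monom poly_mult)
    then have "poly p t \<noteq> 0" using False a by auto
    then show ?thesis using r(1) by (metis mult_zero_right poly_mult)
  qed
  then have "poly r t = poly r 0" for t by (rule poly_nowhere_zero_const)
  then have "r = [:poly r 0:]" by (intro poly_eqI_fun) simp
  then have eq: "p = [:0, 1:] ^ order 0 p * [:poly r 0:]" using r(1) by simp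
  have "poly p t = poly r 0 * t ^ order 0 p" for t
    using arg_cong[OF eq, of "\<lambda>p. poly p t"] by (simp add: mult.commute)
  then have "p = monom (poly r 0) (order 0 p)"
    by (intro poly_eqI_fun) (simp add: poly_monom)
  then show ?thesis by blast
qed

text \<open>For fixed \<open>x\<close> with X Y nonzero, X(scaled x) is a polynomial in
  \<open>c\<close> dividing a monomial, so it is a monomial. The factor c^k1 allows the weight k2 -
  k1 to be given as a difference.\<close>

lemma factor_homogeneous:
  fixes X Y :: "complex ^ 'm \<Rightarrow> complex"
  assumes X: "hpoly X" and Y: "hpoly Y"
    and hom: "\<And>c x. c ^ k1 * (X (scale_coords S c x) * Y (scale_coords S c x))
        = c ^ k2 * (X x * Y x)"
    and nz: "\<exists>x. X x * Y x \<noteq> 0"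
  shows "\<exists>l. \<forall>c x. X (scale_coords S c x) = c ^ l * X x"
proof -
  define u v :: "complex ^ 'm \<Rightarrow> complex ^ 'm"
    where "u x = (\<chi> k. if k \<in> S then 0 else x $ k)" and "v x = (\<chi> k. if k \<in> S then x $ k else 0)"
        for x
  have uv: "hpoly (\<lambda>x. u x $ j)" "hpoly (\<lambda>x. v x $ j)" for j
    by (cases "j \<in> S"; auto simp: u_def v_def intro: hpoly_intros)+
  have sc: "u x + c *s v x = scale_coords S c x" for x c
    by (auto simp: u_def v_def scale_coords_def vec_eq_iff)
  obtain GX where GX: "poly_family GX" "\<And>x c. poly (GX x) c = X (scale_coords S c x)"
    using hpoly_pencil[OF X uv] unfolding sc by blast
  obtain GY where GY: "poly_family GY" "\<And>x c. poly (GY x) c = Y (scale_coords S c x)"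
    using hpoly_pencil[OF Y uv] unfolding sc by blast
  have mon: "monom 1 k1 * (GX x * GY x) = monom (X x * Y x) k2" for x
    by (rule poly_eqI_fun) (simp add: GX GY poly_monom hom mult.commute mult.left_commute)
  \<comment> \<open>That no two coefficients of different index are ever both nonzero is a
    polynomial identity, which makes the exponent independent of \<open>x\<close>.\<close>
  have prod0: "coeff (GX x) i * coeff (GX x) j = 0" if "i \<noteq> j" for i j x
  proof (rule hpoly_mult_eq_0[where F = "\<lambda>x. X x * Y x"])
    fix x show "X x * Y x * (coeff (GX x) i * coeff (GX x) j) = 0"
    proof (cases "X x * Y x = 0")
      case False
      have "GX x * (monom 1 k1 * GY x) = monom (X x * Y x) k2"
        using mon[of x] by (simp add: ac_simps)
      from factor_of_monom[OF this False] show ?thesis using that by auto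
    qed simp
  qed (use nz in \<open>auto intro!: hpoly_intros X Y poly_family_coeff GX\<close>)
  obtain x0 where "X x0 \<noteq> 0" using nz by auto
  have sc1: "scale_coords S 1 x = x" for x by (simp add: scale_coords_def vec_eq_iff)
  have "GX x0 \<noteq> 0" using \<open>X x0 \<noteq> 0\<close> GX(2)[of x0 1] sc1 by auto
  then obtain l where l: "coeff (GX x0) l \<noteq> 0" by (metis leading_coeff_0_iff)
  have "coeff (GX x) j = 0" if "j \<noteq> l" for j x
    by (rule hpoly_mult_eq_0[OF poly_family_coeff[OF GX(1)] poly_family_coeff[OF GX(1)]])
       (use prod0[of l j] that l in auto)
  then have GXl: "GX x = monom (coeff (GX x) l) l" for x
    by (intro poly_eqI) auto
  have "X (scale_coords S c x) = c ^ l * X x" for c x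
  proof -
    have *: "X (scale_coords S c x) = coeff (GX x) l * c ^ l" for c
      using GX(2)[of x c] GXl[of x] by (metis poly_monom)
    from *[of 1] *[of c] show ?thesis by (simp add: sc1)
  qed
  then show ?thesis by blast
qed


text \<open>The linear Taylor coefficient in an axis direction: this is a polynomial by
  construction, and the Leibniz rule is the formula for a coefficient of a product.\<close>

definition pd :: "'m \<Rightarrow> (complex ^ 'm \<Rightarrow> complex) \<Rightarrow> complex ^ 'm \<Rightarrow> complex" where
  "pd k F a = coeff (line (axis k 1) F a) 1"

lemma hpoly_pd: "hpoly F \<Longrightarrow> hpoly (pd k F)"
  using poly_family_coeff[OF poly_family_line, of F "axis k 1" 1]
  by (simp add: pd_def[abs_def])

lemma pd_const: "pd k (\<lambda>z. c) a = 0"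
  by (simp add: pd_def line_const)

lemma pd_coord: "pd k (\<lambda>z. z $ j) a = (if j = k then 1 else 0)"
  by (simp add: pd_def line_coord axis_def)

lemma pd_add: "hpoly F \<Longrightarrow> hpoly G \<Longrightarrow> pd k (\<lambda>z. F z + G z) a = pd k F a + pd k G a"
  by (simp add: pd_def line_add)

lemma pd_mult:
  assumes "hpoly F" "hpoly G"
  shows "pd k (\<lambda>z. F z * G z) a = pd k F a * G a + F a * pd k G a"
proof -
  have "coeff (line (axis k 1) H a) 0 = H a" if "hpoly H" for H
    using poly_line[OF that, of "axis k 1" a 0] by (simp add: poly_0_coeff_0)
  then show ?thesis by (simp add: pd_def line_mult assms coeff_mult atMost_Suc)
qed

lemma pd_cmult: "hpoly F \<Longrightarrow> pd k (\<lambda>z. c * F z) a = c * pd k F a"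
  by (simp add: pd_mult pd_const hpoly_intros)

lemma pd_uminus: "hpoly F \<Longrightarrow> pd k (\<lambda>z. - F z) a = - pd k F a"
  using pd_cmult[of F k "-1" a] by simp

lemma pd_diff: "hpoly F \<Longrightarrow> hpoly G \<Longrightarrow> pd k (\<lambda>z. F z - G z) a = pd k F a - pd k G a"
  using pd_add[OF _ hpoly_uminus, of F G k a] by (simp add: pd_uminus)

lemma pd_commute:
  assumes "hpoly F"
  shows "pd i (pd j F) a = pd j (pd i F) a"
proof -
  have c: "pd i (\<lambda>z. c) = (\<lambda>z. 0)" for i :: 'a and c by (simp add: pd_const fun_eq_iff)
  show ?thesis using assms
  proof (induction arbitrary: a)
    case (coord k)
    have "pd i (\<lambda>z. z $ k) = (\<lambda>z. if k = i then 1 else 0)" for i by (simp add: pd_coord fun_eq_iff)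
    then show ?case by (simp add: pd_const)
  next
    case (add f g)
    have "pd i (\<lambda>z. f z + g z) = (\<lambda>z. pd i f z + pd i g z)" for i
      using add by (simp add: pd_add fun_eq_iff)
    then show ?case using add by (simp add: pd_add hpoly_pd)
  next
    case (mult f g)
    have "pd i (\<lambda>z. f z * g z) = (\<lambda>z. pd i f z * g z + f z * pd i g z)" for i
      using mult by (simp add: pd_mult fun_eq_iff)
    then show ?case using mult by (simp add: pd_add pd_mult hpoly_pd hpoly_intros)
  qed (simp add: c)
qed

lemma pd_depends_on:
  assumes "hpoly F" "depends_on S F" "k \<notin> S"
  shows "pd k F a = 0"
proof -
  have "line (axis k 1) F a = [:F a:]"
  proof (rule line_unique[OF assms(1)])
    show "poly [:F a:] t = F (a + t *s axis k 1)" for t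
    proof -
      have "\<forall>j\<in>S. (a + t *s axis k 1) $ j = a $ j" using assms(3) by (auto simp: axis_def)
      then have "F (a + t *s axis k 1) = F a" using assms(2) unfolding depends_on_def by blast
      then show ?thesis by simp
    qed
  qed
  then show ?thesis by (simp add: pd_def)
qed

lemma has_derivative_hpoly:
  fixes F :: "complex ^ 'm::finite \<Rightarrow> complex"
  assumes "hpoly F"
  shows "(F has_derivative (\<lambda>v. \<Sum>k\<in>UNIV. pd k F a * v $ k)) (at a)"
  using assms
proof induction
  case (coord j)
  have "(\<Sum>k\<in>UNIV. pd k (\<lambda>z. z $ j) a * v $ k) = v $ j" for v :: "complex ^ 'm"
    by (simp add: pd_coord if_distrib[of "\<lambda>x. x * _"] cong: if_cong)
  then show ?case by (simp add: bounded_linear_imp_has_derivative bounded_linear_vec_nth)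
next
  case (add f g)
  from has_derivative_add[OF add.IH] show ?case
    by (rule has_derivative_eq_rhs) (simp add: pd_add add sum.distrib distrib_right)
next
  case (mult f g)
  from has_derivative_mult[OF mult.IH] show ?case
    by (rule has_derivative_eq_rhs)
       (simp add: pd_mult mult sum.distrib distrib_right sum_distrib_left sum_distrib_right
           algebra_simps)
qed (simp add: pd_const)

lemma has_derivative_hpoly_quotient:
  fixes a f s :: "complex ^ 'm::finite \<Rightarrow> complex"
  assumes a: "hpoly a" and f: "hpoly f" and s: "hpoly s" and nz: "s z \<noteq> 0"
  shows "((\<lambda>z. a z * f z / s z) has_derivative
    (\<lambda>v. \<Sum>k\<in>UNIV. ((pd k a z * f z + a z * pd k f z) * s z
        - a z * f z * pd k s z) / (s z * s z) * v $ k)) (at z)"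
  using has_derivative_divide'[OF has_derivative_hpoly[OF holomorphic_polynomial.mult[OF a f]]
      has_derivative_hpoly[OF s] nz]
  by (rule has_derivative_eq_rhs)
     (simp add: fun_eq_iff pd_mult a f sum_divide_distrib sum_subtractf[symmetric]
       sum_distrib_left sum_distrib_right algebra_simps)

lemma poly_pderiv_line:
  fixes F :: "complex ^ 'm::finite \<Rightarrow> complex"
  assumes "hpoly F"
  shows "poly (pderiv (line b F a)) t = (\<Sum>k\<in>UNIV. pd k F (a + t *s b) * b $ k)"
proof -
  have "linear (\<lambda>h. h *s b)"
    by (intro linearI) (auto simp: vec_eq_iff algebra_simps)
  then have "((\<lambda>t. a + t *s b) has_derivative (\<lambda>h. h *s b)) (at t)"
    by (auto intro!: derivative_eq_intros bounded_linear_imp_has_derivative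
        simp: linear_conv_bounded_linear)
  note der = has_derivative_compose[OF this has_derivative_hpoly[OF assms]]
  have "poly (line b F a) = (\<lambda>t. F (a + t *s b))"
    by (simp add: fun_eq_iff poly_line assms)
  with der have "(poly (line b F a) has_derivative
          (\<lambda>h. \<Sum>k\<in>UNIV. pd k F (a + t *s b) * (h * b $ k))) (at t)"
    by simp
  moreover have "(poly (line b F a) has_derivative (\<lambda>h. poly (pderiv (line b F a)) t * h)) (at t)"
    using poly_DERIV[of "line b F a" t] by (simp add: has_field_derivative_def)
  ultimately have "(\<lambda>h. poly (pderiv (line b F a)) t * h) =
      (\<lambda>h. \<Sum>k\<in>UNIV. pd k F (a + t *s b) * (h * b $ k))"
    by (rule has_derivative_unique[rotated])
  from fun_cong[OF this, of 1] show ?thesis by simp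
qed

text \<open>Compare orders of vanishing at 0: the derivative of a nonzero \<open>P\<close> with P(0)
  = 0 has order exactly one less than \<open>P\<close>, whereas \<open>Q\<close> has order
  0.\<close>

lemma poly_wronskian_zero:
  fixes P Q :: "complex poly"
  assumes eq: "Q * pderiv P = P * pderiv Q" and "poly P 0 = 0" "poly Q 0 \<noteq> 0"
  shows "P = 0"
proof (rule ccontr)
  assume P: "P \<noteq> 0"
  have "pderiv P \<noteq> 0"
  proof
    assume "pderiv P = 0"
    then obtain c where "P = [:c:]" using pderiv_iszero by blast
    then show False using P assms(2) by simp
  qed
  moreover have Q: "Q \<noteq> 0" using assms(3) by auto
  ultimately have nz: "Q * pderiv P \<noteq> 0" "P * pderiv Q \<noteq> 0" using eq by auto
  have "order 0 P = Suc (order 0 (pderiv P))"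
    using order_pderiv[of P 0] P assms(2) by simp
  moreover have "order 0 Q = 0" using assms(3) by (simp add: order_0I)
  ultimately show False
    using order_mult[OF nz(1), of 0] order_mult[OF nz(2), of 0] eq by simp
qed

text \<open>Subtracting the multiple of \<open>q\<close> that agrees with \<open>p\<close> at
  \<open>a\<close> preserves the vanishing of the Wronskian, and the difference is then zero on
  every line through \<open>a\<close>.\<close>

lemma hpoly_proportional_const:
  fixes p q :: "complex ^ 'm::finite \<Rightarrow> complex"
  assumes p: "hpoly p" and q: "hpoly q" and a: "q a \<noteq> 0"
    and eq: "\<And>k z. q z * pd k p z = p z * pd k q z"
  shows "p z = p a / q a * q z"
proof -
  define c where "c = p a / q a"
  define b where "b = z - a"
  define r where "r z = p z - c * q z" for z
  have r: "hpoly r" unfolding r_def by (intro hpoly_closed p q)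
  have pd_r: "pd k r x = pd k p x - c * pd k q x" for k x
    unfolding r_def by (simp add: pd_diff pd_cmult p q hpoly_intros)
  have req: "q x * pd k r x = r x * pd k q x" for k x
    using eq[of x k] by (simp add: pd_r r_def algebra_simps)
  have "line b r a = 0"
  proof (rule poly_wronskian_zero)
    show "line b q a * pderiv (line b r a) = line b r a * pderiv (line b q a)"
      by (rule poly_eqI_fun)
         (simp add: poly_pderiv_line poly_line q r sum_distrib_left mult.assoc[symmetric] req)
    show "poly (line b r a) 0 = 0" using a by (simp add: poly_line r) (simp add: r_def c_def)
    show "poly (line b q a) 0 \<noteq> 0" using a by (simp add: poly_line q)
  qed
  then have "r z = 0" using poly_line[OF r, of b a 1] by (simp add: b_def)
  then show ?thesis by (simp add: r_def c_def)
qed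

section \<open>Polynomials in the coordinates and their conjugates\<close>

definition join :: "complex ^ 'n \<Rightarrow> complex ^ 'n \<Rightarrow> complex ^ ('n + 'n)" where
  "join z w = (\<chi> k. case k of Inl i \<Rightarrow> z $ i | Inr i \<Rightarrow> w $ i)"

definition lpart :: "complex ^ ('n::finite + 'n) \<Rightarrow> complex ^ 'n" where
  "lpart x = (\<chi> i. x $ Inl i)"

definition rpart :: "complex ^ ('n::finite + 'n) \<Rightarrow> complex ^ 'n" where
  "rpart x = (\<chi> i. x $ Inr i)"

definition conj_vec :: "complex ^ 'n \<Rightarrow> complex ^ 'n" where
  "conj_vec z = (\<chi> i. cnj (z $ i))"

text \<open>
  A polynomial in the coordinates and their conjugates is \<open>\<lambda>z. F (dbl z)\<close> for a unique holomorphic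
  polynomial \<open>F\<close> in twice as many variables.
\<close>

definition dbl :: "complex ^ 'n \<Rightarrow> complex ^ ('n + 'n)" where
  "dbl z = join z (conj_vec z)"

lemma vec_simps [simp]:
  "join z w $ Inl i = z $ i" "join z w $ Inr i = w $ i"
  "lpart x $ i = x $ Inl i" "rpart x $ i = x $ Inr i" "conj_vec z $ i = cnj (z $ i)"
  "lpart (join z w) = z" "rpart (join z w) = w" "join (lpart x) (rpart x) = x"
  "conj_vec (conj_vec z) = z" "dbl z $ Inl i = z $ i" "dbl z $ Inr i = cnj (z $ i)"
  "lpart (dbl z) = z" "rpart (dbl z) = conj_vec z"
  by (simp_all add: join_def lpart_def rpart_def conj_vec_def dbl_def vec_eq_iff split: sum.split)

lemma vec_sum_eqI:
  fixes x y :: "'b ^ ('n::finite + 'n)"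
  shows "(\<And>i. x $ Inl i = y $ Inl i) \<Longrightarrow> (\<And>i. x $ Inr i = y $ Inr i) \<Longrightarrow> x = y"
  by (metis vec_eq_iff sumE)

lemma hpoly_join:
  assumes "hpoly F" "\<And>i. hpoly (\<lambda>x. u x $ i)" "\<And>i. hpoly (\<lambda>x. v x $ i)"
  shows "hpoly (\<lambda>x. F (join (u x) (v x)))"
proof (rule hpoly_compose[OF assms(1)])
  show "hpoly (\<lambda>x. join (u x) (v x) $ j)" for j using assms(2,3) by (cases j) auto
qed

lemma hpoly_lpart: "hpoly f \<Longrightarrow> hpoly (\<lambda>x. f (lpart x))"
  by (rule hpoly_compose) (auto intro: hpoly_intros)

lemma hpoly_rpart: "hpoly f \<Longrightarrow> hpoly (\<lambda>x. f (rpart x))"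
  by (rule hpoly_compose) (auto intro: hpoly_intros)

lemma linear_dbl: "linear (dbl :: complex ^ 'n \<Rightarrow> _)"
  by (intro linearI vec_sum_eqI) (auto simp: scaleR_conv_of_real[where 'a = complex])

lemma dbl_add: "dbl (u + v) = dbl u + dbl v"
  and dbl_scaleR: "dbl (t *\<^sub>R v) = t *\<^sub>R dbl v"
  using linear_dbl by (auto simp: linear_iff)

text \<open>The vectors \<open>dbl u\<close> form the real subspace fixed by the antilinear
  involution that exchanges and conjugates the two blocks. The two summands are the parts of
  \<open>x\<close> on which it acts as 1 and -1.\<close>

lemma dbl_decompose:
  fixes x :: "complex ^ ('n::finite + 'n)"
  shows "\<exists>u v. x = dbl u + \<i> *s dbl v"
proof -
  define u v :: "complex ^ 'n" where "u = (\<chi> i. (x $ Inl i + cnj (x $ Inr i)) / 2)"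
    and "v = (\<chi> i. (x $ Inl i - cnj (x $ Inr i)) / (2 * \<i>))"
  have "x = dbl u + \<i> *s dbl v"
    by (rule vec_sum_eqI) (auto simp: u_def v_def field_simps)
  then show ?thesis by blast
qed

text \<open>On the complex line dbl u + t dbl v the polynomial vanishes for all real
  \<open>t\<close>, hence for t = \<i>. By \<open>dbl_decompose\<close> this reaches every point; it
  is the principle by which conjugates become independent variables.\<close>

lemma hpoly_dbl_zero:
  assumes F: "hpoly F" and zero: "\<And>z. F (dbl z) = 0"
  shows "F x = 0"
proof -
  obtain u v where x: "x = dbl u + \<i> *s dbl v" using dbl_decompose by blast
  define p where "p = line (dbl v) F (dbl u)"
  have "poly p (of_real t) = 0" for t :: real
  proof -
    have "dbl u + of_real t *s dbl v = dbl (u + t *\<^sub>R v)"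
      by (simp add: dbl_add dbl_scaleR) (simp add: vec_eq_iff scaleR_conv_of_real[where 'a
          = complex])
    then show ?thesis by (simp add: p_def poly_line F zero)
  qed
  then have "range (of_real :: real \<Rightarrow> complex) \<subseteq> {t. poly p t = 0}" by auto
  moreover have "infinite (range (of_real :: real \<Rightarrow> complex))"
    using finite_imageD[of of_real "UNIV :: real set"] by (auto simp: inj_on_def
        infinite_UNIV_char_0)
  ultimately have "p = 0" using poly_roots_finite[of p] finite_subset by blast
  then show ?thesis using poly_line[OF F, of "dbl v" "dbl u" \<i>] by (simp add: p_def x)
qed

lemma hpoly_dbl_eqI:
  assumes "hpoly F" "hpoly G" "\<And>z. F (dbl z) = G (dbl z)"
  shows "F x = G x"
  using hpoly_dbl_zero[of "\<lambda>x. F x - G x" x] assms by (auto intro: hpoly_diff)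

lemma has_derivative_hpoly_dbl:
  fixes F :: "complex ^ ('n::finite + 'n) \<Rightarrow> complex"
  assumes "hpoly F"
  shows "((\<lambda>z. F (dbl z)) has_derivative
           (\<lambda>v. \<Sum>k\<in>UNIV. pd k F (dbl z) * dbl v $ k)) (at z)"
proof -
  have "bounded_linear (dbl :: complex ^ 'n \<Rightarrow> _)" using linear_dbl
      by (simp add: linear_conv_bounded_linear)
  then show ?thesis
    using has_derivative_compose[OF bounded_linear_imp_has_derivative has_derivative_hpoly[OF
        assms]]
    by blast
qed

lemma sum_UNIV_sum:
  "(\<Sum>k\<in>(UNIV :: ('n::finite + 'n) set). f k) = (\<Sum>i\<in>UNIV. f (Inl i)) + (\<Sum>i\<in>UNIV. f (Inr i))"
  by (simp add: UNIV_Plus_UNIV[symmetric] sum.Plus del: UNIV_Plus_UNIV)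

text \<open>On the points \<open>dbl z\<close>, which determine a polynomial, \<open>star\<close> is complex conjugation.\<close>

definition star :: "(complex ^ ('n::finite + 'n) \<Rightarrow> complex) \<Rightarrow> complex ^ ('n + 'n) \<Rightarrow> complex" where
  "star F x = cnj (F (join (conj_vec (rpart x)) (conj_vec (lpart x))))"

lemma star_dbl: "star F (dbl z) = cnj (F (dbl z))"
  by (simp add: star_def) (simp add: dbl_def)

lemma hpoly_star: "hpoly F \<Longrightarrow> hpoly (star F)"
proof (induction rule: holomorphic_polynomial.induct)
  case (coord j)
  have "star (\<lambda>z. z $ j) = (\<lambda>x. x $ (case j of Inl i \<Rightarrow> Inr i | Inr i \<Rightarrow> Inl i))"
    by (auto simp: star_def fun_eq_iff split: sum.split)
  then show ?case by (simp add: hpoly_intros)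
qed (auto simp: star_def[abs_def] intro: hpoly_intros)

lemma pd_star:
  assumes "hpoly F"
  shows "pd (Inl i) (star F) x = cnj (pd (Inr i) F (join (conj_vec (rpart x)) (conj_vec (lpart
      x))))"
    and "pd (Inr i) (star F) x = cnj (pd (Inl i) F (join (conj_vec (rpart x)) (conj_vec (lpart
        x))))"
proof -
  define y where "y = join (conj_vec (rpart x)) (conj_vec (lpart x))"
  have "pd (Inl i) (star F) x = cnj (pd (Inr i) F y) \<and> pd (Inr i) (star F) x = cnj (pd (Inl i) F y)"
    using assms
  proof induction
    case (const c)
    then show ?case by (simp add: star_def[abs_def] pd_const)
  next
    case (coord j)
    have "star (\<lambda>z. z $ j) = (\<lambda>x. x $ (case j of Inl i \<Rightarrow> Inr i | Inr i \<Rightarrow> Inl i))"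
      by (auto simp: star_def fun_eq_iff split: sum.split)
    then show ?case by (auto simp: pd_coord split: sum.split)
  next
    case (add f g)
    have "star (\<lambda>z. f z + g z) = (\<lambda>x. star f x + star g x)" by (simp add: star_def fun_eq_iff)
    then show ?case using add by (simp add: pd_add hpoly_star)
  next
    case (mult f g)
    have "star (\<lambda>z. f z * g z) = (\<lambda>x. star f x * star g x)" by (simp add: star_def fun_eq_iff)
    moreover have "star f x = cnj (f y)" "star g x = cnj (g y)" by (simp_all add: star_def y_def)
    ultimately show ?case using mult by (simp add: pd_mult hpoly_star)
  qed
  then show "pd (Inl i) (star F) x = cnj (pd (Inr i) F (join (conj_vec (rpart x)) (conj_vec (lpart
      x))))"
    and "pd (Inr i) (star F) x = cnj (pd (Inl i) F (join (conj_vec (rpart x)) (conj_vec (lpart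
        x))))"
    by (simp_all add: y_def)
qed

section \<open>Comparison with polynomial functions of the real coordinates\<close>

lemma real_polynomial_function_dbl:
  assumes "real_polynomial_function (r :: complex ^ 'n::finite \<Rightarrow> real)"
  shows "\<exists>F. hpoly F \<and> (\<forall>z. of_real (r z) = F (dbl z))"
  using assms
proof induction
  case (linear f)
  then have lin: "linear f" by (rule bounded_linear.linear)
  have f: "f z = (\<Sum>j\<in>UNIV. Re (z $ j) * f (axis j 1) + Im (z $ j) * f (axis j \<i>))" for z
  proof -
    have "z = (\<Sum>j\<in>UNIV. Re (z $ j) *\<^sub>R axis j 1 + Im (z $ j) *\<^sub>R axis j \<i>)"
      by (simp add: vec_eq_iff sum_component axis_def complex_eq_iff if_distrib cong: if_cong)
    then have "f z = f (\<Sum>j\<in>UNIV. Re (z $ j) *\<^sub>R axis j 1 + Im (z $ j) *\<^sub>R axis j \<i>)" by simp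
    then show ?thesis
      by (simp add: linear_sum[OF lin] linear_add[OF lin] linear_scale[OF lin])
  qed
  define F where "F x = (\<Sum>j\<in>UNIV. (x $ Inl j + x $ Inr j) / 2 * of_real (f (axis j 1))
      + (x $ Inl j - x $ Inr j) / (2 * \<i>) * of_real (f (axis j \<i>)))" for x :: "complex ^ ('n + 'n)"
  have "hpoly F" unfolding F_def by (intro hpoly_closed hpoly_divide)
  moreover have "of_real (f z) = F (dbl z)" for z
  proof -
    have "(w + cnj w) / 2 = of_real (Re w)" "(w - cnj w) / (2 * \<i>) = of_real (Im w)" for w
      by (simp_all add: complex_eq_iff)
    then show ?thesis by (subst f) (simp add: F_def)
  qed
  ultimately show ?case by blast
next
  case (const c)
  then show ?case by (intro exI[of _ "\<lambda>_. of_real c"]) (auto intro: hpoly_intros)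
next
  case (add f g)
  then obtain F G where "hpoly F" "\<forall>z. of_real (f z) = F (dbl z)"
    "hpoly G" "\<forall>z. of_real (g z) = G (dbl z)" by blast
  then show ?case by (intro exI[of _ "\<lambda>x. F x + G x"]) (auto intro: hpoly_intros)
next
  case (mult f g)
  then obtain F G where "hpoly F" "\<forall>z. of_real (f z) = F (dbl z)"
    "hpoly G" "\<forall>z. of_real (g z) = G (dbl z)" by blast
  then show ?case by (intro exI[of _ "\<lambda>x. F x * G x"]) (auto intro: hpoly_intros)
qed

lemma polynomial_function_complex_iff:
  "polynomial_function (f :: 'a::real_normed_vector \<Rightarrow> complex) \<longleftrightarrow>
     real_polynomial_function (\<lambda>z. Re (f z)) \<and> real_polynomial_function (\<lambda>z. Im (f z))"
  by (subst polynomial_function_iff_Basis_inner) (auto simp: Basis_complex_def)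

lemma polynomial_function_iff_hpoly:
  fixes f :: "complex ^ 'n::finite \<Rightarrow> complex"
  shows "polynomial_function f \<longleftrightarrow> (\<exists>F. hpoly F \<and> f = (\<lambda>z. F (dbl z)))"
proof
  assume "polynomial_function f"
  then obtain F G where FG: "hpoly F" "\<And>z. of_real (Re (f z)) = F (dbl z)"
    "hpoly G" "\<And>z. of_real (Im (f z)) = G (dbl z)"
    unfolding polynomial_function_complex_iff using real_polynomial_function_dbl by meson
  have "f z = F (dbl z) + \<i> * G (dbl z)" for z
    unfolding FG(2,4)[symmetric] by (rule complex_eq)
  then show "\<exists>F. hpoly F \<and> f = (\<lambda>z. F (dbl z))"
    using FG(1,3) by (intro exI[of _ "\<lambda>x. F x + \<i> * G x"] conjI hpoly_intros) auto
next
  have "polynomial_function (\<lambda>z. F (dbl z))" if "hpoly F" for F :: "complex ^ ('n + 'n) \<Rightarrow> complex"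
    using that
  proof induction
    case (const c)
    then show ?case by simp
  next
    case (coord j)
    have "linear (\<lambda>z. dbl z $ j)" for j
      using linear_compose[OF linear_dbl bounded_linear.linear[OF bounded_linear_vec_nth], of j]
      by (simp add: o_def)
    then show ?case by (intro polynomial_function_bounded_linear) (simp add:
        linear_conv_bounded_linear)
  next
    case (add f g)
    then show ?case by (intro polynomial_function_add)
  next
    case (mult f g)
    then show ?case unfolding polynomial_function_complex_iff
      by (simp, intro conjI real_polynomial_function_diff real_polynomial_function.intros(3,4)) auto
  qed
  then show "\<exists>F. hpoly F \<and> f = (\<lambda>z. F (dbl z)) \<Longrightarrow> polynomial_function f" by auto
qed

lemma polynomial_function_dbl:
  fixes F :: "complex ^ ('n::finite + 'n) \<Rightarrow> complex"
  shows "hpoly F \<Longrightarrow> polynomial_function (\<lambda>z. F (dbl z))"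
  unfolding polynomial_function_iff_hpoly by blast

text \<open>Composition with \<open>dbl\<close> is a ring isomorphism from holomorphic polynomials
  in twice as many variables onto complex polynomial functions, so it carries common divisors to
  common divisors in both directions.\<close>

lemma relatively_prime_dbl:
  fixes X :: "(complex ^ ('n::finite + 'n) \<Rightarrow> complex) set"
  assumes X: "\<And>F. F \<in> X \<Longrightarrow> hpoly F"
  shows "relatively_prime polynomial_function ((\<lambda>F z. F (dbl z)) ` X) \<longleftrightarrow> relatively_prime hpoly X"
proof
  assume *: "relatively_prime polynomial_function ((\<lambda>F z. F (dbl z)) ` X)"
  show "relatively_prime hpoly X"
  proof (rule relatively_primeI)
    fix h assume h: "hpoly h" and dvd: "\<And>f. f \<in> X \<Longrightarrow> hdvd h f"
    have "polynomial_function (\<lambda>z. h (dbl z))" using h by (rule polynomial_function_dbl)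
    moreover have "\<exists>g. polynomial_function g \<and> f = (\<lambda>z. h (dbl z) * g z)"
      if fX: "f \<in> (\<lambda>F z. F (dbl z)) ` X" for f
    proof -
      obtain F where F: "F \<in> X" "f = (\<lambda>z. F (dbl z))" using fX by blast
      obtain k where "hpoly k" "\<And>x. F x = h x * k x"
        using dvd[OF F(1)] unfolding hdvd_def by blast
      then show ?thesis
        using F(2) by (intro exI[of _ "\<lambda>z. k (dbl z)"]) (simp add: polynomial_function_dbl)
    qed
    ultimately have "\<exists>c. c \<noteq> 0 \<and> (\<lambda>z. h (dbl z)) = (\<lambda>z. c)"
      by (intro *[unfolded relatively_prime_def, rule_format])
    then obtain c where c: "c \<noteq> 0" "(\<lambda>z. h (dbl z)) = (\<lambda>z. c)" by blast
    have "h x = c" for x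
      using hpoly_dbl_eqI[OF h holomorphic_polynomial.const[of c]] fun_cong[OF c(2)] by blast
    with c show "\<exists>c. c \<noteq> 0 \<and> h = (\<lambda>z. c)" by auto
  qed
next
  assume *: "relatively_prime hpoly X"
  show "relatively_prime polynomial_function ((\<lambda>F z. F (dbl z)) ` X)"
    unfolding relatively_prime_def
  proof (intro allI impI)
    fix h' :: "complex ^ 'n \<Rightarrow> complex"
    assume "polynomial_function h'"
    then obtain h where h: "hpoly h" "h' = (\<lambda>z. h (dbl z))" unfolding polynomial_function_iff_hpoly
        by blast
    assume dvd: "\<forall>f\<in>(\<lambda>F z. F (dbl z)) ` X. \<exists>g. polynomial_function g \<and> f = (\<lambda>z. h' z * g z)"
    have "hdvd h F" if FX: "F \<in> X" for F
    proof -
      from dvd[rule_format, OF imageI[OF FX]] obtain g'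
        where "polynomial_function g'" and g': "(\<lambda>z. F (dbl z)) = (\<lambda>z. h' z * g' z)"
        by blast
      then obtain g where g: "hpoly g" "g' = (\<lambda>z. g (dbl z))" unfolding
          polynomial_function_iff_hpoly by blast
      have "F x = h x * g x" for x
        by (rule hpoly_dbl_eqI) (use fun_cong[OF g'] g h X[OF FX] in \<open>auto intro: hpoly_intros\<close>)
      then show ?thesis using g(1) by (rule hdvdI[rotated])
    qed
    then have "\<exists>c. c \<noteq> 0 \<and> h = (\<lambda>x. c)" by (rule relatively_prime_constD[OF * h(1)])
    then obtain c where "c \<noteq> 0" "h = (\<lambda>x. c)" by blast
    then show "\<exists>c. c \<noteq> 0 \<and> h' = (\<lambda>z. c)" unfolding h(2) by (intro exI[of _ c]) simp
  qed
qed


lemma pd_join_left: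
  assumes "hpoly F"
  shows "pd j (\<lambda>z. F (join z w)) z = pd (Inl j) F (join z w)"
proof -
  have "hpoly (\<lambda>z. F (join z w))" by (rule hpoly_join[OF assms]) (simp_all add: hpoly_intros)
  moreover have "join (z + t *s axis j 1) w = join z w + t *s axis (Inl j) 1" for t
    by (rule vec_sum_eqI) (auto simp: axis_def)
  ultimately have "line (axis j 1) (\<lambda>z. F (join z w)) z = line (axis (Inl j) 1) F (join z w)"
    using assms by (intro line_unique) (auto simp: poly_line)
  then show ?thesis by (simp add: pd_def)
qed

lemma depends_on_lpart: "depends_on (range Inl) (\<lambda>x. f (lpart x))"
proof -
  have "lpart x = lpart y" if "\<forall>k\<in>range Inl. x $ k = y $ k" for x y :: "complex ^ ('a + 'a)"
    using that by (simp add: vec_eq_iff)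
  then show ?thesis unfolding depends_on_def by metis
qed

lemma pd_lpart:
  assumes "hpoly f"
  shows "pd (Inl j) (\<lambda>x. f (lpart x)) x = pd j f (lpart x)"
    and "pd (Inr j) (\<lambda>x. f (lpart x)) x = 0"
proof -
  have "pd j f (lpart x) = pd j (\<lambda>z. f (lpart (join z (rpart x)))) (lpart x)" by simp
  also have "\<dots> = pd (Inl j) (\<lambda>x. f (lpart x)) (join (lpart x) (rpart x))"
    by (rule pd_join_left[OF hpoly_lpart[OF assms]])
  finally show "pd (Inl j) (\<lambda>x. f (lpart x)) x = pd j f (lpart x)" by simp
  show "pd (Inr j) (\<lambda>x. f (lpart x)) x = 0"
    by (rule pd_depends_on[OF hpoly_lpart[OF assms] depends_on_lpart]) auto
qed

section \<open>Closed forms and leaf charts\<close>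

definition lin :: "('n::finite \<Rightarrow> complex) \<Rightarrow> (complex ^ 'n) \<Rightarrow>\<^sub>L complex" where
  "lin c = Blinfun (\<lambda>v. \<Sum>k\<in>UNIV. c k * v $ k)"

lemma blinfun_apply_lin: "blinfun_apply (lin c) v = (\<Sum>k\<in>UNIV. c k * v $ k)"
  unfolding lin_def
  by (subst bounded_linear_Blinfun_apply)
     (intro bounded_linear_sum bounded_linear_const_mult bounded_linear_vec_nth, simp)

lemma continuous_on_lin:
  fixes c :: "'a::t2_space \<Rightarrow> 'n::finite \<Rightarrow> complex"
  shows "(\<And>k. continuous_on S (\<lambda>x. c x k)) \<Longrightarrow> continuous_on S (\<lambda>x. lin (c x))"
  by (rule continuous_on_blinfun_componentwise) (simp add: blinfun_apply_lin continuous_intros)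

text \<open>The Poincare lemma on a ball: \<Phi>(z) is the integral of the form along the segment
  from \<open>x0\<close> to \<open>z\<close>. It is differentiated under the integral sign, and
  closedness turns the \<open>z\<close>-derivative of the integrand into a total derivative in the
  segment parameter.\<close>

lemma closed_form_primitive:
  fixes \<alpha> :: "'n::finite \<Rightarrow> complex ^ 'n \<Rightarrow> complex"
    and D :: "'n \<Rightarrow> 'n \<Rightarrow> complex ^ 'n \<Rightarrow> complex"
  assumes der: "\<And>j z. z \<in> ball x0 r \<Longrightarrow> (\<alpha> j has_derivative (\<lambda>v. \<Sum>k\<in>UNIV. D j k z * v $ k)) (at z)"
    and cont: "\<And>j k. continuous_on (ball x0 r) (D j k)"
    and closed: "\<And>j k z. z \<in> ball x0 r \<Longrightarrow> D j k z = D k j z"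
  shows "\<exists>\<Phi>. \<forall>z\<in>ball x0 r. (\<Phi> has_derivative (\<lambda>v. \<Sum>j\<in>UNIV. \<alpha> j z * v $ j)) (at z)"
proof -
  define B where "B = ball x0 r"
  define y where "y z s = x0 + s *\<^sub>R (z - x0)" for z and s :: real
  define f where "f z s = (\<Sum>j\<in>UNIV. \<alpha> j (y z s) * (z - x0) $ j)" for z s
  define fx where "fx z s = lin (\<lambda>k. s * (\<Sum>j\<in>UNIV. D j k (y z s) * (z - x0) $ j) + \<alpha> k (y z s))"
      for z s
  have conta: "continuous_on B (\<alpha> j)" for j
    unfolding B_def by (intro continuous_at_imp_continuous_on ballI has_derivative_continuous[OF
        der])
  have yB: "y z s \<in> B" if "z \<in> B" "s \<in> cbox 0 1" for z s
  proof -
    have "norm (s *\<^sub>R (z - x0)) \<le> norm (z - x0)"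
      using that(2) by (auto intro: mult_left_le_one_le)
    also have "\<dots> < r" using that(1) by (simp add: B_def dist_norm norm_minus_commute)
    finally show ?thesis by (simp add: y_def B_def dist_norm)
  qed
  have conty: "continuous_on (B \<times> cbox 0 1) (\<lambda>p. y (fst p) (snd p))"
    unfolding y_def by (intro continuous_intros)
  have yimg: "(\<lambda>p. y (fst p) (snd p)) ` (B \<times> cbox 0 1) \<subseteq> B" using yB by auto
  have contfx: "continuous_on (B \<times> cbox 0 1) (\<lambda>(z, s). fx z s)"
    unfolding fx_def case_prod_beta
    by (intro continuous_on_lin continuous_intros
        continuous_on_compose2[OF cont[folded B_def] conty yimg]
        continuous_on_compose2[OF conta conty yimg])
  have contf: "continuous_on (cbox 0 1) (f z)" if "z \<in> B" for z
    unfolding f_def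
    by (intro continuous_intros continuous_on_compose2[OF conta, of "cbox 0 1" "y z"])
       (use yB[OF that] in \<open>auto simp: y_def intro!: continuous_intros\<close>)
  have derf: "((\<lambda>z. f z s) has_derivative blinfun_apply (fx z s)) (at z within B)"
    if z: "z \<in> B" and s: "s \<in> cbox 0 1" for z s
  proof -
    have dy: "((\<lambda>z. y z s) has_derivative (\<lambda>v. s *\<^sub>R v)) (at z within B)"
      unfolding y_def by (auto intro!: derivative_eq_intros)
    have da: "((\<lambda>z. \<alpha> j (y z s)) has_derivative (\<lambda>v. \<Sum>k\<in>UNIV. D j k (y z s) * (s *\<^sub>R v) $ k))
        (at z within B)" for j
      by (rule has_derivative_compose[OF dy der]) (use yB[OF z s] in \<open>simp add: B_def\<close>)
    have dc: "((\<lambda>z. (z - x0) $ j) has_derivative (\<lambda>v. v $ j)) (at z within B)" for j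
      by (auto intro!: derivative_eq_intros bounded_linear_imp_has_derivative bounded_linear_vec_nth
          simp: vector_minus_component)
    have "((\<lambda>z. f z s) has_derivative (\<lambda>v. \<Sum>j\<in>UNIV. \<alpha> j (y z s) * v $ j +
        (\<Sum>k\<in>UNIV. D j k (y z s) * (s *\<^sub>R v) $ k) * (z - x0) $ j)) (at z within B)"
      unfolding f_def by (intro has_derivative_sum has_derivative_mult da dc)
    moreover have "(\<lambda>v. \<Sum>j\<in>UNIV. \<alpha> j (y z s) * v $ j +
        (\<Sum>k\<in>UNIV. D j k (y z s) * (s *\<^sub>R v) $ k) * (z - x0) $ j) = blinfun_apply (fx z s)"
    proof
      fix v :: "complex ^ 'n"
      have "(\<Sum>j\<in>UNIV. (\<Sum>k\<in>UNIV. D j k (y z s) * (s *\<^sub>R v) $ k) * (z - x0) $ j) =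
          (\<Sum>k\<in>UNIV. s * (\<Sum>j\<in>UNIV. D j k (y z s) * (z - x0) $ j) * v $ k)"
        unfolding sum_distrib_left sum_distrib_right
        by (subst sum.swap) (simp add: scaleR_conv_of_real[where 'a = complex] mult_ac)
      then show "(\<Sum>j\<in>UNIV. \<alpha> j (y z s) * v $ j +
        (\<Sum>k\<in>UNIV. D j k (y z s) * (s *\<^sub>R v) $ k) * (z - x0) $ j) = blinfun_apply (fx z s) v"
        by (simp add: fx_def blinfun_apply_lin sum.distrib distrib_right add.commute)
    qed
    ultimately show ?thesis by simp
  qed
  have int: "integral (cbox 0 1) (fx z) = lin (\<lambda>k. \<alpha> k z)" if z: "z \<in> B" for z
  proof (rule blinfun_eqI)
    fix v :: "complex ^ 'n"
    \<comment> \<open>The function s \<alpha>(y(s)), paired with \<open>v\<close>, is the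
      antiderivative of the differentiated integrand; this is where the symmetry of \<open>D\<close>
      enters.\<close>
    define G where "G s = (\<Sum>k\<in>UNIV. (of_real s * \<alpha> k (y z s)) * v $ k)" for s
    have "continuous_on (cbox 0 1) (fx z)"
    proof -
      have "continuous_on (cbox 0 1) (\<lambda>s::real. (z, s))" by (intro continuous_intros)
      from continuous_on_compose2[OF contfx this] show ?thesis using z by auto
    qed
    then have "fx z integrable_on cbox 0 1" by (rule integrable_continuous)
    then have "blinfun_apply (integral (cbox 0 1) (fx z)) v
        = integral (cbox 0 1) (\<lambda>s. blinfun_apply (fx z s) v)"
      by (rule blinfun_apply_integral)
    also have "((\<lambda>s. blinfun_apply (fx z s) v) has_integral (G 1 - G 0)) {0..1}"
    proof (rule fundamental_theorem_of_calculus)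
      fix s :: real assume s: "s \<in> {0..1}"
      have dy: "((\<lambda>s. y z s) has_derivative (\<lambda>h. h *\<^sub>R (z - x0))) (at s within {0..1})"
        unfolding y_def by (auto intro!: derivative_eq_intros)
      have da: "((\<lambda>s. \<alpha> k (y z s)) has_derivative (\<lambda>h. \<Sum>j\<in>UNIV. D k j (y z s) * (h *\<^sub>R (z
          - x0)) $ j)) (at s within {0..1})" for k
        by (rule has_derivative_compose[OF dy der]) (use yB[OF z, of s] s in \<open>simp add: B_def\<close>)
      have D_sym: "D k j (y z s) = D j k (y z s)" for j k
        using closed yB[OF z, of s] s by (simp add: B_def)
      have "(G has_derivative (\<lambda>h. \<Sum>k\<in>UNIV. (of_real s * (\<Sum>j\<in>UNIV. D k j (y z s) * (h *\<^sub>R (z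
          - x0)) $ j)
          + of_real h * \<alpha> k (y z s)) * v $ k)) (at s within {0..1})"
        unfolding G_def
        by (intro has_derivative_sum has_derivative_mult_left has_derivative_mult da
            has_derivative_of_real has_derivative_ident)
      moreover have "(\<lambda>h. \<Sum>k\<in>UNIV. (of_real s * (\<Sum>j\<in>UNIV. D k j (y z s) * (h *\<^sub>R (z - x0)) $ j)
          + of_real h * \<alpha> k (y z s)) * v $ k) = (\<lambda>h. h *\<^sub>R blinfun_apply (fx z s) v)"
      proof
        fix h :: real
        define W where "W k = (\<Sum>j\<in>UNIV. D j k (y z s) * (z - x0) $ j)" for k
        have W: "(\<Sum>j\<in>UNIV. D k j (y z s) * (h *\<^sub>R (z - x0)) $ j) = of_real h * W k" for k
          by (simp add: W_def sum_distrib_left D_sym[of k] scaleR_conv_of_real[where 'a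
              = complex] mult_ac)
        show "(\<Sum>k\<in>UNIV. (of_real s * (\<Sum>j\<in>UNIV. D k j (y z s) * (h *\<^sub>R (z - x0)) $ j)
          + of_real h * \<alpha> k (y z s)) * v $ k) = h *\<^sub>R blinfun_apply (fx z s) v"
          unfolding W fx_def blinfun_apply_lin W_def[symmetric]
          by (simp add: scaleR_conv_of_real[where 'a = complex] sum_distrib_left algebra_simps)
      qed
      ultimately show "(G has_vector_derivative blinfun_apply (fx z s) v) (at s within {0..1})"
        by (simp add: has_vector_derivative_def)
    qed simp
    then have "integral (cbox 0 1) (\<lambda>s. blinfun_apply (fx z s) v) = G 1 - G 0"
      by (simp add: integral_unique)
    also have "\<dots> = blinfun_apply (lin (\<lambda>k. \<alpha> k z)) v"
      by (simp add: G_def blinfun_apply_lin y_def)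
    finally show "blinfun_apply (integral (cbox 0 1) (fx z)) v
        = blinfun_apply (lin (\<lambda>k. \<alpha> k z)) v" .
  qed
  define \<Phi> where "\<Phi> z = integral (cbox 0 1) (f z)" for z
  have "(\<Phi> has_derivative (\<lambda>v. \<Sum>j\<in>UNIV. \<alpha> j z * v $ j)) (at z)" if z: "z \<in> B" for z
  proof -
    have "(\<Phi> has_derivative integral (cbox 0 1) (fx z)) (at z within B)"
      unfolding \<Phi>_def[abs_def]
      by (rule leibniz_rule[OF derf integrable_continuous[OF contf] contfx z]) (auto simp: B_def)
    moreover have "at z within B = at z" using z by (intro at_within_open) (auto simp: B_def)
    ultimately show ?thesis unfolding int[OF z] by (simp add: blinfun_apply_lin[abs_def])
  qed
  then show ?thesis unfolding B_def by blast
qed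

text \<open>The derivative of |r|^2 is at most 2 K |r|^2, so multiplying by exp(-2 K t) gives a
  nonincreasing function that starts at 0.\<close>

lemma gronwall_zero:
  fixes r m :: "real \<Rightarrow> complex"
  assumes der: "\<And>t. t \<in> {0..1} \<Longrightarrow> (r has_vector_derivative m t * r t) (at t)"
    and K: "\<And>t. t \<in> {0..1} \<Longrightarrow> cmod (m t) \<le> K" and "r 0 = 0"
  shows "r 1 = 0"
proof -
  define f where "f t = (r t \<bullet> r t) * exp (- 2 * K * t)" for t
  have "f 1 \<le> f 0"
  proof (rule DERIV_nonpos_imp_nonincreasing[where f = f])
    fix t :: real assume "0 \<le> t" "t \<le> 1"
    then have t: "t \<in> {0..1}" by simp
    have "(r has_derivative (\<lambda>h. h *\<^sub>R (m t * r t))) (at t)"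
      using der[OF t] by (simp add: has_vector_derivative_def)
    from has_derivative_inner[OF this this]
    have "((\<lambda>t. r t \<bullet> r t) has_field_derivative 2 * (r t \<bullet> (m t * r t))) (at t)"
      unfolding has_field_derivative_def
      by (rule has_derivative_eq_rhs) (simp add: fun_eq_iff inner_commute algebra_simps)
    then have "(f has_field_derivative 2 * (r t \<bullet> (m t * r t)) * exp (- 2 * K * t)
        + exp (- 2 * K * t) * (- 2 * K) * (r t \<bullet> r t)) (at t)"
      unfolding f_def by (auto intro!: derivative_eq_intros)
    moreover have "r t \<bullet> (m t * r t) \<le> K * (r t \<bullet> r t)"
    proof -
      have "r t \<bullet> (m t * r t) \<le> norm (r t) * norm (m t * r t)" by (rule norm_cauchy_schwarz)
      also have "\<dots> \<le> norm (r t) * (K * norm (r t))"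
        using K[OF t] by (intro mult_left_mono) (auto simp: norm_mult intro: mult_right_mono)
      also have "\<dots> = K * (r t \<bullet> r t)" by (simp add: dot_square_norm power2_eq_square)
      finally show ?thesis .
    qed
    then have "exp (- 2 * K * t) * (r t \<bullet> (m t * r t)) \<le> exp (- 2 * K * t) * (K * (r t \<bullet> r t))"
      by (intro mult_left_mono) auto
    ultimately show "\<exists>y. (f has_field_derivative y) (at t) \<and> y \<le> 0"
      by (intro exI[of _ "2 * (r t \<bullet> (m t * r t)) * exp (- 2 * K * t)
        + exp (- 2 * K * t) * (- 2 * K) * (r t \<bullet> r t)"]) (auto simp: algebra_simps)
  qed simp
  then have "r 1 \<bullet> r 1 \<le> 0" using \<open>r 0 = 0\<close> by (simp add: f_def mult_le_0_iff)
  then show ?thesis by (metis inner_eq_zero_iff inner_ge_zero order_antisym)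
qed

text \<open>Replacing the coordinate \<open>i\<close> by \<Phi> gives a local diffeomorphism \<Psi>.
  Two points on the same level of \<Phi> have images with equal coordinate \<open>i\<close>; the
  straight segment between the images pulls back to a curve inside the level set.\<close>

lemma level_set_chart:
  fixes \<alpha> :: "'n::finite \<Rightarrow> complex ^ 'n \<Rightarrow> complex"
  assumes r: "r > 0"
    and der: "\<And>z. z \<in> ball x0 r \<Longrightarrow> (\<Phi> has_derivative (\<lambda>v. \<Sum>j\<in>UNIV. \<alpha> j z * v $ j)) (at z)"
    and cont: "\<And>j. continuous_on (ball x0 r) (\<alpha> j)" and i: "\<alpha> i x0 \<noteq> 0"
  shows "\<exists>\<epsilon>>0. \<epsilon> \<le> r \<and> (\<forall>y\<in>ball x0 \<epsilon>. \<Phi> y = \<Phi> x0 \<longrightarrow>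
           (\<exists>c c'. c 0 = x0 \<and> c (1::real) = y \<and> continuous_on {0..1} c' \<and>
              (\<forall>t\<in>{0..1}. c t \<in> ball x0 r \<and> \<alpha> i (c t) \<noteq> 0 \<and>
                 (c has_vector_derivative c' t) (at t) \<and> (\<Sum>j\<in>UNIV. \<alpha> j (c t) * c' t $ j) = 0)))"
proof -
  define U where "U = {z \<in> ball x0 r. \<alpha> i z \<noteq> 0}"
  have "U = ball x0 r \<inter> \<alpha> i -` (- {0})" by (auto simp: U_def)
  then have U: "open U" using continuous_open_preimage[OF cont open_ball, of "- {0}"] by auto
  have x0: "x0 \<in> U" using r i by (simp add: U_def)
  have contU: "continuous_on U (\<alpha> j)" for j by (rule continuous_on_subset[OF cont]) (auto simp:
      U_def)
  define \<Psi> where "\<Psi> z = (\<chi> k. if k = i then \<Phi> z else z $ k)" for z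
  define d\<Psi> where "d\<Psi> z v = (\<chi> k. if k = i then (\<Sum>j\<in>UNIV. \<alpha> j z * v $ j) else v $ k)" for z v
  have blin: "bounded_linear (d\<Psi> z)" for z
    unfolding linear_conv_bounded_linear[symmetric] d\<Psi>_def
    by (intro linearI) (auto simp: vec_eq_iff sum.distrib algebra_simps scaleR_sum_right)
  have app: "blinfun_apply (Blinfun (d\<Psi> z)) = d\<Psi> z" for z
    by (rule bounded_linear_Blinfun_apply[OF blin])
  have der\<Psi>: "(\<Psi> has_derivative blinfun_apply (Blinfun (d\<Psi> z))) (at z)" if "z \<in> U" for z
  proof -
    have z: "z \<in> ball x0 r" using that by (simp add: U_def)
    have "((\<lambda>z. \<Psi> z $ k) has_derivative (\<lambda>v. d\<Psi> z v $ k)) (at z)" for k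
      using der[OF z] by (cases "k = i")
        (auto simp: \<Psi>_def d\<Psi>_def intro!: bounded_linear_imp_has_derivative bounded_linear_vec_nth)
    then show ?thesis
      unfolding app
      by (subst has_derivative_componentwise_within)
         (auto simp: Basis_vec_def inner_axis intro!: bounded_linear.has_derivative[OF
             bounded_linear_inner_left])
  qed
  have cont\<Psi>: "continuous_on U (\<lambda>z. Blinfun (d\<Psi> z))"
  proof (rule continuous_on_blinfun_componentwise)
    fix v :: "complex ^ 'n"
    have "continuous_on U (\<lambda>z. if k = i then (\<Sum>j\<in>UNIV. \<alpha> j z * v $ j) else v $ k)" for k
      by (cases "k = i") (auto intro!: continuous_intros contU)
    then show "continuous_on U (\<lambda>z. blinfun_apply (Blinfun (d\<Psi> z)) v)"
      unfolding app d\<Psi>_def by (intro continuous_on_vec_lambda)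
  qed
  \<comment> \<open>The inverse of the derivative of \<Psi> at \<open>x0\<close>, found by solving
    its component \<open>i\<close> for the missing coordinate.\<close>
  define inv\<Psi> where "inv\<Psi> w = (\<chi> k. if k = i then (w $ i - (\<Sum>j\<in>UNIV
      - {i}. \<alpha> j x0 * w $ j)) / \<alpha> i x0 else w $ k)" for w
  have blin': "bounded_linear inv\<Psi>"
    unfolding linear_conv_bounded_linear[symmetric] inv\<Psi>_def
    by (intro linearI)
       (auto simp: vec_eq_iff sum.distrib algebra_simps add_divide_distrib diff_divide_distrib
         scaleR_conv_of_real[where 'a = complex] sum_distrib_left sum_divide_distrib)
  have split_i: "(\<Sum>j\<in>UNIV. \<alpha> j z * v $ j) = \<alpha> i z * v $ i + (\<Sum>j\<in>UNIV - {i}. \<alpha> j z * v $ j)" for z v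
    by (simp add: sum.remove)
  have "Blinfun inv\<Psi> o\<^sub>L Blinfun (d\<Psi> x0) = id_blinfun"
  proof (rule blinfun_eqI)
    fix v
    have "(\<Sum>j\<in>UNIV - {i}. \<alpha> j x0 * d\<Psi> x0 v $ j) = (\<Sum>j\<in>UNIV - {i}. \<alpha> j x0 * v $ j)"
      by (intro sum.cong) (auto simp: d\<Psi>_def)
    then have "inv\<Psi> (d\<Psi> x0 v) = v"
      using i by (simp add: inv\<Psi>_def vec_eq_iff) (simp add: d\<Psi>_def split_i)
    then show "blinfun_apply (Blinfun inv\<Psi> o\<^sub>L Blinfun (d\<Psi> x0)) v = blinfun_apply id_blinfun v"
      by (simp add: app bounded_linear_Blinfun_apply[OF blin'])
  qed
  from inverse_function_theorem[OF U der\<Psi> cont\<Psi> x0 this]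
  obtain U' V g g' where U': "open U'" "U' \<subseteq> U" "x0 \<in> U'" and V: "open V" "\<Psi> x0 \<in> V"
    and hom: "homeomorphism U' V \<Psi> g"
    and g: "\<And>y. y \<in> V \<Longrightarrow> (g has_derivative (g' y)) (at y)"
    and g': "\<And>y. y \<in> V \<Longrightarrow> g' y = inv (blinfun_apply (Blinfun (d\<Psi> (g y))))"
    and bij: "\<And>y. y \<in> V \<Longrightarrow> bij (blinfun_apply (Blinfun (d\<Psi> (g y))))"
    by metis
  obtain \<delta> where \<delta>: "\<delta> > 0" "ball (\<Psi> x0) \<delta> \<subseteq> V" using V open_contains_ball by blast
  have "continuous_on U' \<Psi>" using hom by (simp add: homeomorphism_def)
  then have "open (U' \<inter> \<Psi> -` ball (\<Psi> x0) \<delta>)"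
    using U'(1) by (intro continuous_open_preimage) auto
  moreover have "x0 \<in> U' \<inter> \<Psi> -` ball (\<Psi> x0) \<delta>" using U' \<delta> by simp
  ultimately obtain e where e: "e > 0" "ball x0 e \<subseteq> U' \<inter> \<Psi> -` ball (\<Psi> x0) \<delta>"
    using open_contains_ball by blast
  show ?thesis
  proof (intro exI[of _ "min e r"] conjI ballI impI)
    fix y assume y: "y \<in> ball x0 (min e r)" and eq: "\<Phi> y = \<Phi> x0"
    have yU': "y \<in> U'" and y\<delta>: "\<Psi> y \<in> ball (\<Psi> x0) \<delta>" using e y by auto
    define d where "d = \<Psi> y - \<Psi> x0"
    define l where "l t = \<Psi> x0 + t *\<^sub>R d" for t :: real
    define c where "c t = g (l t)" for t
    define c' where "c' t = g' (l t) d" for t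
    have di: "d $ i = 0" using eq by (simp add: d_def \<Psi>_def)
    have lV: "l t \<in> V" if "t \<in> {0..1}" for t
    proof -
      have "norm (t *\<^sub>R d) \<le> norm d" using that by (auto intro: mult_left_le_one_le)
      also have "\<dots> < \<delta>" using y\<delta> by (simp add: d_def dist_norm norm_minus_commute)
      finally show ?thesis using \<delta>(2) by (auto simp: l_def dist_norm)
    qed
    have cU: "c t \<in> U" if "t \<in> {0..1}" for t
      using lV[OF that] hom U'(2) by (auto simp: c_def homeomorphism_def)
    have derc: "(c has_vector_derivative c' t) (at t)" if "t \<in> {0..1}" for t
    proof -
      have "(l has_derivative (\<lambda>h. h *\<^sub>R d)) (at t)" unfolding l_def
          by (auto intro!: derivative_eq_intros)
      from has_derivative_compose[OF this g[OF lV[OF that]]]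
      have "(c has_derivative (\<lambda>h. g' (l t) (h *\<^sub>R d))) (at t)" by (simp add: c_def[abs_def])
      moreover have "linear (g' (l t))" using g[OF lV[OF that]] has_derivative_linear by blast
      ultimately show ?thesis by (simp add: has_vector_derivative_def c'_def linear_scale)
    qed
    have dc': "d\<Psi> (c t) (c' t) = d" if "t \<in> {0..1}" for t
      using bij[OF lV[OF that]] g'[OF lV[OF that]]
      by (simp add: app c_def c'_def bij_is_surj surj_f_inv_f)
    have tang: "(\<Sum>j\<in>UNIV. \<alpha> j (c t) * c' t $ j) = 0" if "t \<in> {0..1}" for t
      using arg_cong[OF dc'[OF that], of "\<lambda>v. v $ i"] di by (simp add: d\<Psi>_def)
    have c'k: "c' t $ k = d $ k" if "t \<in> {0..1}" "k \<noteq> i" for t k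
      using arg_cong[OF dc'[OF that(1)], of "\<lambda>v. v $ k"] that(2) by (simp add: d\<Psi>_def)
    \<comment> \<open>Tangency determines the component \<open>i\<close> of the velocity from the
      constant other components; this formula makes \<open>c'\<close> continuous.\<close>
    have c'i: "c' t $ i = - (\<Sum>j\<in>UNIV - {i}. \<alpha> j (c t) * d $ j) / \<alpha> i (c t)" if "t \<in> {0..1}" for t
    proof -
      have "(\<Sum>j\<in>UNIV - {i}. \<alpha> j (c t) * c' t $ j) = (\<Sum>j\<in>UNIV - {i}. \<alpha> j (c t) * d $ j)"
        using c'k[OF that] by (intro sum.cong) auto
      then have "\<alpha> i (c t) * c' t $ i = - (\<Sum>j\<in>UNIV - {i}. \<alpha> j (c t) * d $ j)"
        using tang[OF that] unfolding split_i by (simp add: eq_neg_iff_add_eq_0)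
      moreover have "\<alpha> i (c t) \<noteq> 0" using cU[OF that] by (simp add: U_def)
      ultimately show ?thesis by (simp add: field_simps)
    qed
    have contc: "continuous_on {0..1} c"
      by (intro continuous_at_imp_continuous_on ballI has_vector_derivative_continuous[OF derc])
    have contac: "continuous_on {0..1} (\<lambda>t. \<alpha> j (c t))" for j
      by (rule continuous_on_compose2[OF contU contc]) (use cU in auto)
    have "continuous_on {0..1} c'"
    proof (subst continuous_on_cong[OF refl])
      show "c' t = (\<chi> k. if k = i then - (\<Sum>j\<in>UNIV - {i}. \<alpha> j (c t) * d $ j) / \<alpha> i (c t) else d $ k)"
        if "t \<in> {0..1}" for t
        using c'i[OF that] c'k[OF that] by (simp add: vec_eq_iff)
      have "continuous_on {0..1} (\<lambda>t. if k = i then - (\<Sum>j\<in>UNIV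
          - {i}. \<alpha> j (c t) * d $ j) / \<alpha> i (c t) else d $ k)" for k
        using cU by (cases "k = i") (auto intro!: continuous_intros contac simp: U_def)
      then show "continuous_on {0..1} (\<lambda>t. (\<chi> k. if k = i then - (\<Sum>j\<in>UNIV
          - {i}. \<alpha> j (c t) * d $ j) / \<alpha> i (c t) else d $ k))"
        by (intro continuous_on_vec_lambda)
    qed
    moreover have "c 0 = x0" "c 1 = y"
      using hom U'(3) yU' by (auto simp: c_def l_def d_def homeomorphism_def)
    ultimately show "\<exists>c c'. c 0 = x0 \<and> c (1::real) = y \<and> continuous_on {0..1} c' \<and>
              (\<forall>t\<in>{0..1}. c t \<in> ball x0 r \<and> \<alpha> i (c t) \<noteq> 0 \<and>
                 (c has_vector_derivative c' t) (at t) \<and> (\<Sum>j\<in>UNIV. \<alpha> j (c t) * c' t $ j) = 0)"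
      using derc tang cU by (intro exI[of _ c] exI[of _ c']) (auto simp: U_def)
  qed (use e r in auto)
qed

section \<open>Ratios that are constant along the leaves\<close>

lemma has_vector_derivative_hpoly_dbl:
  fixes F :: "complex ^ ('n::finite + 'n) \<Rightarrow> complex"
  assumes F: "hpoly F" and c: "(c has_vector_derivative v) (at t within T)"
  shows "((\<lambda>t. F (dbl (c t))) has_vector_derivative
           (\<Sum>j\<in>UNIV. pd (Inl j) F (dbl (c t)) * v $ j) +
           (\<Sum>j\<in>UNIV. pd (Inr j) F (dbl (c t)) * cnj (v $ j))) (at t within T)"
proof -
  have "(c has_derivative (\<lambda>h. h *\<^sub>R v)) (at t within T)"
    using c by (simp add: has_vector_derivative_def)
  from has_derivative_compose[OF this has_derivative_hpoly_dbl[OF F]] show ?thesis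
    unfolding has_vector_derivative_def
    by (rule has_derivative_eq_rhs)
       (simp add: fun_eq_iff sum_UNIV_sum scaleR_conv_of_real[where 'a
           = complex] sum_distrib_left algebra_simps)
qed

lemma continuous_on_dbl: "continuous_on S (dbl :: complex ^ 'n::finite \<Rightarrow> _)"
  by (rule linear_continuous_on) (simp add: linear_dbl linear_conv_bounded_linear[symmetric])

text \<open>\<open>integrating\<close> is the closedness in \<open>z\<close> of (H / star H)
  \<theta>, with the denominator cleared.\<close>

locale levi_data =
  fixes P :: "'n::finite \<Rightarrow> complex ^ 'n \<Rightarrow> complex" and H :: "complex ^ ('n + 'n) \<Rightarrow> complex"
  assumes hpoly_P: "\<And>i. hpoly (P i)" and hpoly_H: "hpoly H"
    and integrating: "\<And>i j x.
      H x * (P i (lpart x) * pd (Inl j) (star H) x - P j (lpart x) * pd (Inl i) (star H) x)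
      - star H x * (P i (lpart x) * pd (Inl j) H x - P j (lpart x) * pd (Inl i) H x)
      + H x * star H x * (pd i (P j) (lpart x) - pd j (P i) (lpart x)) = 0"
begin

abbreviation \<theta> :: "complex ^ 'n \<Rightarrow> complex ^ 'n \<Rightarrow> complex" where
  "\<theta> z v \<equiv> \<Sum>j\<in>UNIV. P j z * v $ j"

text \<open>
  The coefficients of the wedge products of \<open>\<theta>\<close> with the holomorphic part of \<open>dF\<close>, and of the
  conjugate of \<open>\<theta>\<close> with the antiholomorphic part.
\<close>

definition lbr :: "'n \<Rightarrow> 'n \<Rightarrow> (complex ^ ('n + 'n) \<Rightarrow> complex) \<Rightarrow> complex ^ ('n + 'n) \<Rightarrow> complex" where
  "lbr i j F x = P i (lpart x) * pd (Inl j) F x - P j (lpart x) * pd (Inl i) F x"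

definition rbr :: "'n \<Rightarrow> 'n \<Rightarrow> (complex ^ ('n + 'n) \<Rightarrow> complex) \<Rightarrow> complex ^ ('n + 'n) \<Rightarrow> complex" where
  "rbr i j F x = cnj (P i (conj_vec (rpart x))) * pd (Inr j) F x
     - cnj (P j (conj_vec (rpart x))) * pd (Inr i) F x"

lemma hpoly_lbr: "hpoly F \<Longrightarrow> hpoly (lbr i j F)"
  unfolding lbr_def[abs_def] by (intro hpoly_closed hpoly_pd hpoly_lpart hpoly_P)

lemma hpoly_rbr:
  assumes "hpoly F" shows "hpoly (rbr i j F)"
proof -
  have "(\<lambda>x. cnj (P i (conj_vec (rpart x)))) = star (\<lambda>x. P i (lpart x))" for i
    by (simp add: star_def fun_eq_iff)
  then have "hpoly (\<lambda>x. cnj (P i (conj_vec (rpart x))))" for i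
    using hpoly_star[OF hpoly_lpart[OF hpoly_P[of i]]] by simp
  then show ?thesis unfolding rbr_def[abs_def] by (intro hpoly_closed hpoly_pd assms)
qed

lemma lbr_mult: "hpoly F \<Longrightarrow> hpoly G \<Longrightarrow>
    lbr i j (\<lambda>x. F x * G x) x = lbr i j F x * G x + F x * lbr i j G x"
  by (simp add: lbr_def pd_mult algebra_simps)

lemma rbr_mult: "hpoly F \<Longrightarrow> hpoly G \<Longrightarrow>
    rbr i j (\<lambda>x. F x * G x) x = rbr i j F x * G x + F x * rbr i j G x"
  by (simp add: rbr_def pd_mult algebra_simps)

text \<open>If \<theta>(v) = 0, then P_i times the holomorphic part of dF(v) is a combination of the
  brackets alone. Multiplying by the conjugate of P_i and summing over \<open>i\<close> gives one
  formula valid wherever some P_i is nonzero.\<close>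

lemma derivative_along_tangent:
  assumes tangent: "\<theta> z v = 0"
  shows "(\<Sum>i\<in>UNIV. cnj (P i z) * P i z) *
      ((\<Sum>j\<in>UNIV. pd (Inl j) F (dbl z) * v $ j) + (\<Sum>j\<in>UNIV. pd (Inr j) F (dbl z) * cnj (v $ j))) =
    (\<Sum>i\<in>UNIV. \<Sum>j\<in>UNIV. cnj (P i z) * lbr i j F (dbl z) * v $ j) +
    (\<Sum>i\<in>UNIV. \<Sum>j\<in>UNIV. P i z * rbr i j F (dbl z) * cnj (v $ j))"
proof -
  have t': "(\<Sum>j\<in>UNIV. cnj (P j z) * cnj (v $ j)) = 0"
    using arg_cong[OF tangent, of cnj] by simp
  have "(\<Sum>j\<in>UNIV. cnj (P i z) * lbr i j F (dbl z) * v $ j) =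
      cnj (P i z) * P i z * (\<Sum>j\<in>UNIV. pd (Inl j) F (dbl z) * v $ j)
      - cnj (P i z) * pd (Inl i) F (dbl z) * \<theta> z v" for i
    by (simp add: lbr_def sum_distrib_left sum_subtractf[symmetric] algebra_simps)
  then have 1: "(\<Sum>j\<in>UNIV. cnj (P i z) * lbr i j F (dbl z) * v $ j) =
      cnj (P i z) * P i z * (\<Sum>j\<in>UNIV. pd (Inl j) F (dbl z) * v $ j)" for i
    by (simp add: tangent)
  have "(\<Sum>j\<in>UNIV. P i z * rbr i j F (dbl z) * cnj (v $ j)) =
      cnj (P i z) * P i z * (\<Sum>j\<in>UNIV. pd (Inr j) F (dbl z) * cnj (v $ j))
      - P i z * pd (Inr i) F (dbl z) * (\<Sum>j\<in>UNIV. cnj (P j z) * cnj (v $ j))" for i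
    by (simp add: rbr_def sum_distrib_left sum_subtractf[symmetric] algebra_simps)
  then have 2: "(\<Sum>j\<in>UNIV. P i z * rbr i j F (dbl z) * cnj (v $ j)) =
      cnj (P i z) * P i z * (\<Sum>j\<in>UNIV. pd (Inr j) F (dbl z) * cnj (v $ j))" for i
    by (simp add: t')
  show ?thesis by (simp add: 1 2 sum_distrib_right distrib_left)
qed

lemma norm_P_pos:
  assumes "P i z \<noteq> 0"
  shows "(\<Sum>i\<in>UNIV. cnj (P i z) * P i z) \<noteq> 0"
proof -
  have "(\<Sum>i\<in>UNIV. cnj (P i z) * P i z) = of_real (\<Sum>i\<in>UNIV. (cmod (P i z))\<^sup>2)"
    by (simp add: mult.commute[of "cnj _"] complex_norm_square[symmetric])
  moreover have "(\<Sum>i\<in>UNIV. (cmod (P i z))\<^sup>2) > 0"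
    using assms by (intro sum_pos2[of _ i]) auto
  ultimately show ?thesis by (metis of_real_eq_0_iff less_irrefl)
qed

text \<open>Since \<open>S\<close> divides its brackets, its restriction r to the curve satisfies r'
  = m r with \<open>m\<close> continuous, hence bounded, on the compact interval.\<close>

lemma zero_along_curve:
  assumes S: "hpoly S" and inv: "\<And>i j. hdvd S (lbr i j S)" "\<And>i j. hdvd S (rbr i j S)"
    and c: "\<And>t. t \<in> {0..1} \<Longrightarrow> (c has_vector_derivative c' t) (at t)"
    and c': "continuous_on {0..1} c'" and P: "\<And>t. t \<in> {0..1} \<Longrightarrow> P i (c t) \<noteq> 0"
    and tangent: "\<And>t. t \<in> {0..1} \<Longrightarrow> \<theta> (c t) (c' t) = 0"
    and zero: "S (dbl (c 0)) = 0"
  shows "S (dbl (c (1::real))) = 0"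
proof -
  obtain W where W: "\<And>i j. hpoly (W i j)" "\<And>i j x. lbr i j S x = S x * W i j x"
    using inv(1) unfolding hdvd_def by metis
  obtain W' where W': "\<And>i j. hpoly (W' i j)" "\<And>i j x. rbr i j S x = S x * W' i j x"
    using inv(2) unfolding hdvd_def by metis
  define n where "n t = (\<Sum>i\<in>UNIV. cnj (P i (c t)) * P i (c t))" for t
  define M where "M t = (\<Sum>i\<in>UNIV. \<Sum>j\<in>UNIV. cnj (P i (c t)) * W i j (dbl (c t)) * c' t $ j) +
    (\<Sum>i\<in>UNIV. \<Sum>j\<in>UNIV. P i (c t) * W' i j (dbl (c t)) * cnj (c' t $ j))" for t
  define m where "m t = M t / n t" for t
  have contc: "continuous_on {0..1} c"
    by (intro continuous_at_imp_continuous_on ballI has_vector_derivative_continuous[OF c])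
  have contP: "continuous_on {0..1} (\<lambda>t. P i (c t))" for i
    by (rule continuous_on_compose2[OF continuous_on_hpoly[OF hpoly_P] contc]) auto
  have contW: "continuous_on {0..1} (\<lambda>t. F (dbl (c t)))" if "hpoly F" for F :: "complex ^ ('n
      + 'n) \<Rightarrow> complex"
  proof (rule continuous_on_compose2[OF continuous_on_hpoly[OF that, of UNIV]])
    show "continuous_on {0..1} (\<lambda>t. dbl (c t))"
      by (rule continuous_on_compose2[OF continuous_on_dbl[of UNIV] contc]) simp
  qed auto
  have nz: "n t \<noteq> 0" if "t \<in> {0..1}" for t unfolding n_def by (rule norm_P_pos[OF P[OF that]])
  have "continuous_on {0..1} m"
    unfolding m_def M_def using nz
    by (intro continuous_intros contP contW W W' continuous_on_cnj c')
       (auto simp: n_def intro!: continuous_intros contP)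
  then have "compact (m ` {0..1})" by (intro compact_continuous_image compact_Icc)
  then obtain K where K: "\<And>t. t \<in> {0..1} \<Longrightarrow> cmod (m t) \<le> K"
    by (meson compact_imp_bounded bounded_iff imageI)
  show ?thesis
  proof (rule gronwall_zero[OF _ K, where r = "\<lambda>t. S (dbl (c t))"])
    fix t :: real assume t: "t \<in> {0..1}"
    let ?d = "(\<Sum>j\<in>UNIV. pd (Inl j) S (dbl (c t)) * c' t $ j)
        + (\<Sum>j\<in>UNIV. pd (Inr j) S (dbl (c t)) * cnj (c' t $ j))"
    have "n t * ?d = S (dbl (c t)) * M t"
      unfolding n_def derivative_along_tangent[OF tangent[OF t]] M_def
      by (simp add: W(2) W'(2) sum_distrib_left distrib_left mult_ac)
    moreover have "d = m t * S (dbl (c t))" if "n t * d = S (dbl (c t)) * M t" for d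
      using that nz[OF t] by (simp add: m_def field_simps)
    ultimately have "?d = m t * S (dbl (c t))" by blast
    then show "((\<lambda>t. S (dbl (c t))) has_vector_derivative m t * S (dbl (c t))) (at t)"
      using has_vector_derivative_hpoly_dbl[OF S c[OF t]] by simp
  qed (use zero in auto)
qed

text \<open>
  At a regular point \<open>x0\<close> both \<open>H\<close> and \<open>star H\<close> are nonzero at \<open>dbl x0 = (x0, cnj x0)\<close>, so the closed
  form \<open>(H / star H) \<theta>\<close> for the fixed second argument \<open>cnj x0\<close> is holomorphic near \<open>x0\<close>.
\<close>

lemma local_first_integral:
  assumes H: "H (dbl x0) \<noteq> 0" and P: "P i x0 \<noteq> 0"
  shows "\<exists>\<Phi> \<epsilon>. \<epsilon> > 0 \<and> (\<forall>z\<in>ball x0 \<epsilon>. \<exists>g. (\<Phi> has_derivative (\<lambda>v. g * \<theta> z v)) (at z)) \<and>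
    (\<forall>y\<in>ball x0 \<epsilon>. \<Phi> y = \<Phi> x0 \<longrightarrow> (\<exists>c c'. c 0 = x0 \<and> c (1::real) = y \<and> continuous_on {0..1} c' \<and>
       (\<forall>t\<in>{0..1}. P i (c t) \<noteq> 0 \<and> (c has_vector_derivative c' t) (at t) \<and>
          \<theta> (c t) (c' t) = (0::complex))))"
proof -
  define a s where "a z = H (join z (conj_vec x0))" and "s z = star H (join z (conj_vec x0))" for z
  have hp: "hpoly a" "hpoly s"
    unfolding a_def s_def
    by (rule hpoly_join[OF hpoly_H] hpoly_join[OF hpoly_star[OF hpoly_H]]; simp add: hpoly_intros)+
  have pda: "pd k a z = pd (Inl k) H (join z (conj_vec x0))"
    and pds: "pd k s z = pd (Inl k) (star H) (join z (conj_vec x0))" for k z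
    unfolding a_def s_def by (rule pd_join_left hpoly_star hpoly_H)+
  have closed: "a z * (P i z * pd j s z - P j z * pd i s z) - s z * (P i z * pd j a z
      - P j z * pd i a z)
      + a z * s z * (pd i (P j) z - pd j (P i) z) = 0" for i j z
    using integrating[of "join z (conj_vec x0)" i j] by (simp add: pda pds) (simp add: a_def s_def)
  define U where "U = {z. a z \<noteq> 0} \<inter> {z. s z \<noteq> 0}"
  have "open U" unfolding U_def
    by (intro open_Int open_Collect_neq continuous_on_hpoly hp continuous_on_const)
  moreover have "x0 \<in> U"
    using H star_dbl[of H x0] by (simp add: U_def a_def s_def dbl_def)
  ultimately obtain r where r: "r > 0" "ball x0 r \<subseteq> U" using open_contains_ball by blast
  define \<alpha> where "\<alpha> j z = a z * P j z / s z" for j z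
  define D where "D j k z = ((pd k a z * P j z + a z * pd k (P j) z) * s z
      - a z * P j z * pd k s z) / (s z * s z)" for j k z
  have nz: "a z \<noteq> 0" "s z \<noteq> 0" if "z \<in> ball x0 r" for z using r that by (auto simp: U_def)
  have "\<exists>\<Phi>. \<forall>z\<in>ball x0 r. (\<Phi> has_derivative (\<lambda>v. \<Sum>j\<in>UNIV. \<alpha> j z * v $ j)) (at z)"
  proof (rule closed_form_primitive[where D = D])
    fix j z assume z: "z \<in> ball x0 r"
    show "(\<alpha> j has_derivative (\<lambda>v. \<Sum>k\<in>UNIV. D j k z * v $ k)) (at z)"
      unfolding \<alpha>_def[abs_def] D_def
      by (rule has_derivative_hpoly_quotient[OF hp(1) hpoly_P hp(2) nz(2)[OF z]])
    fix k
    show "D j k z = D k j z"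
      unfolding D_def using closed[of z j k] by (simp add: algebra_simps)
  next
    fix j k
    show "continuous_on (ball x0 r) (D j k)"
      unfolding D_def using nz
      by (intro continuous_intros continuous_on_hpoly hp hpoly_P hpoly_pd) auto
  qed
  then obtain \<Phi> where \<Phi>: "\<And>z. z \<in> ball x0 r \<Longrightarrow> (\<Phi> has_derivative (\<lambda>v. \<Sum>j\<in>UNIV. \<alpha> j z * v $ j))
      (at z)"
    by blast
  have cont: "continuous_on (ball x0 r) (\<alpha> j)" for j
    unfolding \<alpha>_def using nz by (intro continuous_intros continuous_on_hpoly hp hpoly_P) auto
  have "\<alpha> i x0 \<noteq> 0" using nz[of x0] P r by (simp add: \<alpha>_def)
  from level_set_chart[OF r(1) \<Phi> cont this]
  obtain \<epsilon> where \<epsilon>: "\<epsilon> > 0" "\<epsilon> \<le> r" and chart: "\<And>y. y \<in> ball x0 \<epsilon> \<Longrightarrow> \<Phi> y = \<Phi> x0 \<Longrightarrow>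
           (\<exists>c c'. c 0 = x0 \<and> c (1::real) = y \<and> continuous_on {0..1} c' \<and>
              (\<forall>t\<in>{0..1}. c t \<in> ball x0 r \<and> \<alpha> i (c t) \<noteq> 0 \<and>
                 (c has_vector_derivative c' t) (at t) \<and> (\<Sum>j\<in>UNIV. \<alpha> j (c t) * c' t $ j) = 0))"
    by blast
  have sum\<alpha>: "(\<Sum>j\<in>UNIV. \<alpha> j z * v $ j) = a z / s z * \<theta> z v" for z v
    by (simp add: \<alpha>_def sum_distrib_left mult_ac)
  show ?thesis
  proof (intro exI[of _ \<Phi>] exI[of _ \<epsilon>] conjI ballI impI)
    fix z assume "z \<in> ball x0 \<epsilon>"
    then have "z \<in> ball x0 r" using \<epsilon> by auto
    from \<Phi>[OF this] show "\<exists>g. (\<Phi> has_derivative (\<lambda>v. g * \<theta> z v)) (at z)"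
      unfolding sum\<alpha> by (rule exI)
  next
    fix y assume "y \<in> ball x0 \<epsilon>" "\<Phi> y = \<Phi> x0"
    from chart[OF this] obtain c c' where c: "c 0 = x0" "c (1::real) = y" "continuous_on {0..1} c'"
      and t: "\<And>t. t \<in> {0..1} \<Longrightarrow> c t \<in> ball x0 r \<and> \<alpha> i (c t) \<noteq> 0 \<and>
                 (c has_vector_derivative c' t) (at t) \<and> (\<Sum>j\<in>UNIV. \<alpha> j (c t) * c' t $ j) = 0"
      by blast
    have "P i (c t) \<noteq> 0 \<and> \<theta> (c t) (c' t) = 0" if "t \<in> {0..1}" for t
      using t[OF that] nz[of "c t"] unfolding sum\<alpha> by (auto simp: \<alpha>_def)
    then show "\<exists>c c'. c 0 = x0 \<and> c (1::real) = y \<and> continuous_on {0..1} c' \<and>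
       (\<forall>t\<in>{0..1}. P i (c t) \<noteq> 0 \<and> (c has_vector_derivative c' t) (at t) \<and>
          \<theta> (c t) (c' t) = 0)"
      using c t by (intro exI[of _ c] exI[of _ c']) auto
  qed (use \<epsilon> in auto)
qed

text \<open>The hypotheses on brackets say that R / S has zero derivative along the leaves, with
  denominators cleared. Only the ends are assumed to avoid the zeros of \<open>S\<close>. In lowest
  terms the zero set of the denominator is invariant along leaves, so the path never meets it and
  the quotient can be differentiated throughout.\<close>

lemma constant_along_path:
  assumes R: "hpoly R" and S: "hpoly S"
    and RSl: "\<And>i j x. S x * lbr i j R x = R x * lbr i j S x"
    and RSr: "\<And>i j x. S x * rbr i j R x = R x * rbr i j S x"
    and S0: "\<exists>x. S x \<noteq> 0"
    and \<gamma>: "continuous_on {0..1} \<gamma>" and Z: "finite Z"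
    and der: "\<And>t. t \<in> {0..1} - Z \<Longrightarrow> (\<gamma> has_vector_derivative \<gamma>' t) (at t)"
    and tangent: "\<And>t. t \<in> {0..1} - Z \<Longrightarrow> \<theta> (\<gamma> t) (\<gamma>' t) = 0"
    and reg: "\<And>t. t \<in> {0..1} \<Longrightarrow> H (dbl (\<gamma> t)) \<noteq> 0" "\<And>t. t \<in> {0..1} \<Longrightarrow> \<exists>i. P i (\<gamma> t) \<noteq> 0"
    and ends: "S (dbl (\<gamma> 0)) \<noteq> 0" "S (dbl (\<gamma> (1::real))) \<noteq> 0"
  shows "R (dbl (\<gamma> 0)) / S (dbl (\<gamma> 0)) = R (dbl (\<gamma> 1)) / S (dbl (\<gamma> 1))"
proof -
  obtain D R' S' where D: "hpoly D" and R': "hpoly R'" "\<And>x. R x = D x * R' x"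
    and S': "hpoly S'" "\<And>x. S x = D x * S' x" and cop: "hcoprime R' S'"
    using hpoly_reduce[OF R S S0] by metis
  have D0: "\<exists>x. D x \<noteq> 0" using S0 S' by auto
  have R_eq: "R = (\<lambda>x. D x * R' x)" and S_eq: "S = (\<lambda>x. D x * S' x)" using R' S' by auto
  have l': "S' x * lbr i j R' x = R' x * lbr i j S' x" for i j x
  proof (rule hpoly_cancel[where F = "\<lambda>x. D x * D x"])
    fix x show "D x * D x * (S' x * lbr i j R' x) = D x * D x * (R' x * lbr i j S' x)"
      using RSl[of x i j] unfolding R_eq S_eq by (simp add: lbr_mult D R' S' algebra_simps)
  qed (use D0 in \<open>auto intro!: hpoly_intros D hpoly_lbr R' S'\<close>)
  have r': "S' x * rbr i j R' x = R' x * rbr i j S' x" for i j x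
  proof (rule hpoly_cancel[where F = "\<lambda>x. D x * D x"])
    fix x show "D x * D x * (S' x * rbr i j R' x) = D x * D x * (R' x * rbr i j S' x)"
      using RSr[of x i j] unfolding R_eq S_eq by (simp add: rbr_mult D R' S' algebra_simps)
  qed (use D0 in \<open>auto intro!: hpoly_intros D hpoly_rbr R' S'\<close>)
  \<comment> \<open>By \<open>l'\<close> and \<open>r'\<close>, \<open>S'\<close> divides the
    product of \<open>R'\<close> with each bracket of \<open>S'\<close>, and it is coprime to
    \<open>R'\<close>.\<close>
  have inv: "hdvd S' (lbr i j S')" "hdvd S' (rbr i j S')" for i j
  proof -
    show "hdvd S' (lbr i j S')"
      by (rule hcoprimeD1[OF cop hpoly_lbr[OF S'(1)]], rule hdvdI[OF hpoly_lbr[OF R'(1)]])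
         (simp only: l')
    show "hdvd S' (rbr i j S')"
      by (rule hcoprimeD1[OF cop hpoly_rbr[OF S'(1)]], rule hdvdI[OF hpoly_rbr[OF R'(1)]])
         (simp only: r')
  qed
  define q where "q t = S' (dbl (\<gamma> t))" for t
  have contF: "continuous_on {0..1} (\<lambda>t. F (dbl (\<gamma> t)))" if "hpoly F" for F :: "complex ^ ('n
      + 'n) \<Rightarrow> complex"
  proof (rule continuous_on_compose2[OF continuous_on_hpoly[OF that, of UNIV]])
    show "continuous_on {0..1} (\<lambda>t. dbl (\<gamma> t))"
      by (rule continuous_on_compose2[OF continuous_on_dbl[of UNIV] \<gamma>]) simp
  qed auto
  txt \<open>
    \<open>\<gamma>'\<close> may be unbounded near \<open>Z\<close>, so the linear differential equation for \<open>q\<close> cannot be used along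
    \<open>\<gamma>\<close> itself.  Instead, nearby points of \<open>\<gamma>\<close> are joined by continuously differentiable curves in a
    level set of a local first integral.
  \<close>
  have step: "\<exists>T. openin (top_of_set {0..1}) T \<and> t0 \<in> T \<and> (\<forall>t\<in>T. \<forall>u\<in>T. q t \<noteq> 0 \<longrightarrow> q u \<noteq> 0)"
    if t0: "t0 \<in> {0..1}" for t0
  proof (cases "q t0 = 0")
    case False
    have "openin (top_of_set {0..1}) ({0..1} \<inter> q -` (- {0}))"
      unfolding q_def by (intro continuous_openin_preimage_gen contF S') auto
    then show ?thesis using False t0 by (intro exI[of _ "{0..1} \<inter> q -` (- {0})"]) auto
  next
    case True
    obtain i where i: "P i (\<gamma> t0) \<noteq> 0" using reg(2)[OF t0] by blast
    from local_first_integral[OF reg(1)[OF t0] i]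
    obtain \<Phi> \<epsilon> where \<epsilon>: "\<epsilon> > 0"
      and d\<Phi>: "\<And>z. z \<in> ball (\<gamma> t0) \<epsilon> \<Longrightarrow> \<exists>g. (\<Phi> has_derivative (\<lambda>v. g * \<theta> z v)) (at z)"
      and chart: "\<And>y. y \<in> ball (\<gamma> t0) \<epsilon> \<Longrightarrow> \<Phi> y = \<Phi> (\<gamma> t0) \<Longrightarrow>
        (\<exists>c c'. c 0 = \<gamma> t0 \<and> c (1::real) = y \<and> continuous_on {0..1} c' \<and>
         (\<forall>t\<in>{0..1}. P i (c t) \<noteq> 0 \<and> (c has_vector_derivative c' t) (at t) \<and>
          \<theta> (c t) (c' t) = (0::complex)))"
      by blast
    obtain \<delta> where \<delta>: "\<delta> > 0" "\<And>t. t \<in> {0..1} \<Longrightarrow> dist t t0 < \<delta> \<Longrightarrow> dist (\<gamma> t) (\<gamma> t0) < \<epsilon>"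
      using \<gamma> t0 \<epsilon> unfolding continuous_on_iff by blast
    define T where "T = {0..1} \<inter> ball t0 \<delta>"
    have \<gamma>T: "\<gamma> t \<in> ball (\<gamma> t0) \<epsilon>" if "t \<in> T" for t
      using \<delta>(2)[of t] that by (auto simp: T_def dist_commute)
    have "continuous_on (ball (\<gamma> t0) \<epsilon>) \<Phi>"
      using d\<Phi> by (intro continuous_at_imp_continuous_on ballI) (blast intro:
          has_derivative_continuous)
    then have cont: "continuous_on T (\<lambda>t. \<Phi> (\<gamma> t))"
      by (rule continuous_on_compose2) (use \<gamma>T in \<open>auto simp: T_def intro: continuous_on_subset[OF
          \<gamma>]\<close>)
    have t0T: "t0 \<in> T" using t0 \<delta> by (simp add: T_def)
    \<comment> \<open>\<Phi> has zero derivative along \<gamma> off the finite set \<open>Z\<close>;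
      continuity carries constancy across \<open>Z\<close>.\<close>
    have const: "\<Phi> (\<gamma> t) = \<Phi> (\<gamma> t0)" if "t \<in> T" for t
    proof (rule has_derivative_zero_unique_strong_convex[OF _ Z cont t0T refl _ that])
      show "convex T" unfolding T_def by (intro convex_Int convex_ball convex_real_interval)
      fix u assume u: "u \<in> T - Z"
      then have u': "u \<in> {0..1} - Z" by (auto simp: T_def)
      obtain g where g: "(\<Phi> has_derivative (\<lambda>v. g * \<theta> (\<gamma> u) v)) (at (\<gamma> u))"
        using d\<Phi>[OF \<gamma>T] u by blast
      have "(\<gamma> has_derivative (\<lambda>h. h *\<^sub>R \<gamma>' u)) (at u within T)"
        using der[OF u'] unfolding has_vector_derivative_def by (rule has_derivative_at_withinI)
      from has_derivative_compose[OF this g]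
      show "((\<lambda>t. \<Phi> (\<gamma> t)) has_derivative (\<lambda>h. 0)) (at u within T)"
      proof (rule has_derivative_eq_rhs)
        have "\<theta> (\<gamma> u) (h *\<^sub>R \<gamma>' u) = of_real h * \<theta> (\<gamma> u) (\<gamma>' u)" for h
          by (simp add: scaleR_conv_of_real[where 'a = complex] sum_distrib_left mult_ac)
        then show "(\<lambda>h. g * \<theta> (\<gamma> u) (h *\<^sub>R \<gamma>' u)) = (\<lambda>h. 0)"
          by (simp add: tangent[OF u'])
      qed
    qed
    have "q t = 0" if tT: "t \<in> T" for t
    proof -
      obtain c c' where c: "c 0 = \<gamma> t0" "c (1::real) = \<gamma> t" "continuous_on {0..1} c'"
         "\<And>t. t \<in> {0..1} \<Longrightarrow> P i (c t) \<noteq> 0" "\<And>t. t \<in> {0..1} \<Longrightarrow> (c has_vector_derivative c' t) (at t)"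
         "\<And>t. t \<in> {0..1} \<Longrightarrow> \<theta> (c t) (c' t) = (0::complex)"
        using chart[OF \<gamma>T[OF tT] const[OF tT]] by blast
      have "S' (dbl (c 0)) = 0" using True c by (simp add: q_def)
      from zero_along_curve[OF S'(1) inv c(5,3,4,6) this] show ?thesis by (simp add: q_def c)
    qed
    moreover have "openin (top_of_set {0..1}) T" unfolding T_def
        by (intro openin_open_Int open_ball)
    ultimately show ?thesis using t0T by blast
  qed
  have q0: "q 0 \<noteq> 0" using ends(1) S'(2) by (auto simp: q_def)
  \<comment> \<open>By \<open>step\<close> the nonvanishing of \<open>q\<close> is a locally
    constant property, so it spreads from 0 over the connected interval.\<close>
  have q: "q t \<noteq> 0" if "t \<in> {0..1}" for t
    by (rule connected_induction_simple[OF connected_Icc _ that, of 0]) (use q0 step in auto)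
  define p where "p t = R' (dbl (\<gamma> t))" for t
  have "p 1 / q 1 = p 0 / q 0"
  proof (rule has_derivative_zero_unique_strong_convex[where S = "{0..1}" and f =
      "\<lambda>t. p t / q t", OF _ Z])
    show "continuous_on {0..1} (\<lambda>t. p t / q t)"
      using q unfolding p_def q_def by (intro continuous_intros contF R' S') auto
    fix t assume t: "t \<in> {0..1} - Z"
    let ?d = "\<lambda>F. (\<Sum>j\<in>UNIV. pd (Inl j) F (dbl (\<gamma> t)) * \<gamma>' t $ j)
        + (\<Sum>j\<in>UNIV. pd (Inr j) F (dbl (\<gamma> t)) * cnj (\<gamma>' t $ j))"
    have dp: "(p has_derivative (\<lambda>h. h *\<^sub>R ?d R')) (at t within {0..1})"
      and dq: "(q has_derivative (\<lambda>h. h *\<^sub>R ?d S')) (at t within {0..1})"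
      unfolding p_def q_def
      using has_vector_derivative_hpoly_dbl[OF R'(1) has_vector_derivative_at_within[OF der[OF t]]]
        has_vector_derivative_hpoly_dbl[OF S'(1) has_vector_derivative_at_within[OF der[OF t]]]
      by (simp_all add: has_vector_derivative_def)
    obtain i where "P i (\<gamma> t) \<noteq> 0" using reg(2) t by blast
    then have n: "(\<Sum>i\<in>UNIV. cnj (P i (\<gamma> t)) * P i (\<gamma> t)) \<noteq> 0" (is "?n \<noteq> 0") by (rule norm_P_pos)
    note dt = derivative_along_tangent[OF tangent[OF t]]
    have "q t * (?n * ?d R') = p t * (?n * ?d S')"
      unfolding dt unfolding distrib_left sum_distrib_left
    proof (intro arg_cong2[of _ _ _ _ "(+)"] sum.cong refl)
      have swap: "q t * (c * L * v) = p t * (c * L' * v)" if "q t * L = p t * L'" for c L L' v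
      proof -
        have "q t * (c * L * v) = c * (q t * L) * v" by (simp add: mult_ac)
        also have "\<dots> = p t * (c * L' * v)" unfolding that by (simp add: mult_ac)
        finally show ?thesis .
      qed
      fix i j
      show "q t * (cnj (P i (\<gamma> t)) * lbr i j R' (dbl (\<gamma> t)) * \<gamma>' t $ j) =
          p t * (cnj (P i (\<gamma> t)) * lbr i j S' (dbl (\<gamma> t)) * \<gamma>' t $ j)"
        by (rule swap) (simp add: p_def q_def l')
      show "q t * (P i (\<gamma> t) * rbr i j R' (dbl (\<gamma> t)) * cnj (\<gamma>' t $ j)) =
          p t * (P i (\<gamma> t) * rbr i j S' (dbl (\<gamma> t)) * cnj (\<gamma>' t $ j))"
        by (rule swap) (simp add: p_def q_def r')
    qed
    then have "?n * (q t * ?d R') = ?n * (p t * ?d S')" by (simp add: mult_ac)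
    then have eq: "q t * ?d R' = p t * ?d S'" using n by (simp only: mult_cancel_left) auto
    have "q t \<noteq> 0" using q t by auto
    from has_derivative_divide'[OF dp dq this]
    show "((\<lambda>t. p t / q t) has_derivative (\<lambda>h. 0)) (at t within {0..1})"
    proof (rule has_derivative_eq_rhs)
      show "(\<lambda>h. (h *\<^sub>R ?d R' * q t - p t * (h *\<^sub>R ?d S')) / (q t * q t)) = (\<lambda>h. 0)"
      proof
        fix h :: real
        have "h *\<^sub>R ?d R' * q t - p t * (h *\<^sub>R ?d S') = h *\<^sub>R (q t * ?d R' - p t * ?d S')"
          by (simp add: scaleR_conv_of_real[where 'a = complex] algebra_simps)
        then show "(h *\<^sub>R ?d R' * q t - p t * (h *\<^sub>R ?d S')) / (q t * q t) = 0"
          by (simp only: eq) simp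
      qed
    qed
  qed auto
  then show ?thesis
    using ends R'(2) S'(2) by (simp add: p_def q_def)
qed

end

section \<open>The two possibilities\<close>

text \<open>The 3-form \<omega> \<and> d\<omega>, extended to complex vectors, is trilinear and
  vanishes on the real vectors \<open>dbl u\<close>, hence on all vectors by
  \<open>dbl_decompose\<close>. Its component on dz_i, dz_j and the conjugate of dz_k is a
  polynomial in \<open>dbl z\<close>, so the identity extends to all \<open>x\<close>.\<close>

lemma integrable_form_complexified:
  fixes A B :: "'n::finite \<Rightarrow> complex ^ 'n \<Rightarrow> real" and E :: "'n \<Rightarrow> complex ^ ('n + 'n) \<Rightarrow> complex"
  assumes int: "integrable_form (real_form A B)" and E: "\<And>j. hpoly (E j)"
    and eq: "\<And>j z. E j (dbl z) = Complex (A j z) (- B j z)"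
  shows "E i x * (pd (Inl j) (star (E k)) x - pd (Inr k) (E j) x)
       + E j x * (pd (Inr k) (E i) x - pd (Inl i) (star (E k)) x)
       + star (E k) x * (pd (Inl i) (E j) x - pd (Inl j) (E i) x) = 0"
proof -
  \<comment> \<open>The coefficients of 2 \<omega> with respect to the dz_i and their
    conjugates.\<close>
  define \<Omega> where "\<Omega> k = (case k of Inl i \<Rightarrow> E i | Inr i \<Rightarrow> star (E i))" for k
  have \<Omega>: "hpoly (\<Omega> k)" for k
    by (cases k) (auto simp: \<Omega>_def intro: E hpoly_star)
  define w where "w x X = (\<Sum>k\<in>UNIV. \<Omega> k x * X $ k)" for x X
  define D where "D x X Y = (\<Sum>k\<in>UNIV. (\<Sum>l\<in>UNIV. pd l (\<Omega> k) x * X $ l) * Y $ k)" for x X Y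
  have real: "of_real (real_form A B z v) = w (dbl z) (dbl v) / 2" for z v
  proof -
    have "of_real (A j z * Re (v $ j) + B j z * Im (v $ j)) =
        (E j (dbl z) * v $ j + star (E j) (dbl z) * cnj (v $ j)) / 2" for j
      by (simp add: star_dbl eq complex_eq_iff)
    then have "of_real (real_form A B z v) =
        (\<Sum>j\<in>UNIV. (E j (dbl z) * v $ j + star (E j) (dbl z) * cnj (v $ j)) / 2)"
      by (simp only: real_form_def of_real_sum)
    then show ?thesis
      by (simp add: w_def sum_UNIV_sum \<Omega>_def sum.distrib sum_divide_distrib add_divide_distrib)
  qed
  have der: "of_real (frechet_derivative (\<lambda>x. real_form A B x v) (at z) u)
      = D (dbl z) (dbl u) (dbl v) / 2" for z u v
  proof -
    have "((\<lambda>x. w (dbl x) (dbl v)) has_derivative (\<lambda>u. D (dbl z) (dbl u) (dbl v))) (at z)"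
      unfolding w_def D_def
      by (intro has_derivative_sum has_derivative_mult_left has_derivative_hpoly_dbl \<Omega>)
    then have wd: "((\<lambda>x. w (dbl x) (dbl v) / 2) has_derivative (\<lambda>u. D (dbl z) (dbl u) (dbl v) / 2))
        (at z)"
      by (rule bounded_linear.has_derivative[OF bounded_linear_divide])
    then have "((\<lambda>x. Re (w (dbl x) (dbl v) / 2)) has_derivative (\<lambda>u. Re (D (dbl z) (dbl u) (dbl v)
        / 2))) (at z)"
      by (rule bounded_linear.has_derivative[OF bounded_linear_Re])
    then have r: "((\<lambda>x. real_form A B x v) has_derivative (\<lambda>u. Re (D (dbl z) (dbl u) (dbl v) / 2)))
        (at z)"
      unfolding real[symmetric] by simp
    have "((\<lambda>x. of_real (real_form A B x v)) has_derivative (\<lambda>u. of_real (Re (D (dbl z) (dbl u)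
        (dbl v) / 2)))) (at z)"
      by (rule bounded_linear.has_derivative[OF bounded_linear_of_real r])
    from has_derivative_unique[OF this wd[folded real]]
    have "complex_of_real (Re (D (dbl z) (dbl u) (dbl v) / 2)) = D (dbl z) (dbl u) (dbl v) / 2"
      by (rule fun_cong)
    moreover have "frechet_derivative (\<lambda>x. real_form A B x v) (at z) u
        = Re (D (dbl z) (dbl u) (dbl v) / 2)"
      by (rule fun_cong[OF frechet_derivative_at[OF r, symmetric]])
    ultimately show ?thesis by metis
  qed
  define T where "T x X Y Z = w x X * (D x Y Z - D x Z Y) + w x Y * (D x Z X - D x X Z)
      + w x Z * (D x X Y - D x Y X)" for x X Y Z
  have T0: "T (dbl z) (dbl u) (dbl v) (dbl v') = 0" for z u v v'
  proof -
    have "wedge12 (real_form A B) (ext_deriv (real_form A B)) z u v v' = 0"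
      using int by (simp add: integrable_form_def)
    moreover have "complex_of_real (wedge12 (real_form A B) (ext_deriv (real_form A B)) z u v v') =
        T (dbl z) (dbl u) (dbl v) (dbl v') / 4"
      by (simp add: wedge12_def ext_deriv_def real der T_def field_simps)
    ultimately show ?thesis by simp
  qed
  have lin: "w x (X + c *s X') = w x X + c * w x X'"
    "D x (X + c *s X') Y = D x X Y + c * D x X' Y"
    "D x Y (X + c *s X') = D x Y X + c * D x Y X'" for x X X' Y c
    by (simp_all add: w_def D_def sum.distrib sum_distrib_left sum_distrib_right algebra_simps)
  have Tlin: "T x (X + c *s X') Y Z = T x X Y Z + c * T x X' Y Z"
    "T x Y (X + c *s X') Z = T x Y X Z + c * T x Y X' Z"
    "T x Y Z (X + c *s X') = T x Y Z X + c * T x Y Z X'" for x X X' Y Z c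
    by (simp_all add: T_def lin algebra_simps)
  have T1: "T (dbl z) X Y Z = 0" for z X Y Z
  proof -
    obtain u v where X: "X = dbl u + \<i> *s dbl v" using dbl_decompose by blast
    obtain u' v' where Y: "Y = dbl u' + \<i> *s dbl v'" using dbl_decompose by blast
    obtain u'' v'' where Z: "Z = dbl u'' + \<i> *s dbl v''" using dbl_decompose by blast
    show ?thesis unfolding X Y Z by (simp add: Tlin T0)
  qed
  have ax: "w x (axis k 1) = \<Omega> k x" "D x (axis l 1) (axis k 1) = pd l (\<Omega> k) x" for x k l
    by (simp_all add: w_def D_def axis_def if_distrib[of "\<lambda>y. _ * y"] cong: if_cong)
  have zero: "E i (dbl z) * (pd (Inl j) (star (E k)) (dbl z) - pd (Inr k) (E j) (dbl z))
       + E j (dbl z) * (pd (Inr k) (E i) (dbl z) - pd (Inl i) (star (E k)) (dbl z))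
       + star (E k) (dbl z) * (pd (Inl i) (E j) (dbl z) - pd (Inl j) (E i) (dbl z)) = 0" for z
    using T1[of z "axis (Inl i) 1" "axis (Inl j) 1" "axis (Inr k) 1"]
    by (simp add: T_def ax \<Omega>_def)
  define F where "F x = E i x * (pd (Inl j) (star (E k)) x - pd (Inr k) (E j) x)
       + E j x * (pd (Inr k) (E i) x - pd (Inl i) (star (E k)) x)
       + star (E k) x * (pd (Inl i) (E j) x - pd (Inl j) (E i) x)" for x
  have "hpoly F" unfolding F_def by (intro hpoly_intros hpoly_diff hpoly_pd hpoly_star E)
  moreover have "F (dbl z) = 0" for z unfolding F_def by (rule zero)
  ultimately have "F x = 0" by (rule hpoly_dbl_zero)
  then show ?thesis by (simp only: F_def)
qed

text \<open>A common divisor in the doubled ring divides a nonzero polynomial in the first block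
  alone, so by \<open>depends_on_factor\<close> it belongs to the original ring.\<close>

lemma relatively_prime_lpart:
  fixes P :: "'i \<Rightarrow> complex ^ 'n::finite \<Rightarrow> complex"
  assumes P: "\<And>i. hpoly (P i)" and prime: "relatively_prime hpoly (range P)"
  shows "relatively_prime hpoly (range (\<lambda>i x. P i (lpart x)))"
proof (rule relatively_primeI)
  fix h :: "complex ^ ('n + 'n) \<Rightarrow> complex"
  assume h: "hpoly h" and "\<And>f. f \<in> range (\<lambda>i x. P i (lpart x)) \<Longrightarrow> hdvd h f"
  then have "hdvd h (\<lambda>x. P i (lpart x))" for i by blast
  then obtain k where k: "\<And>i. hpoly (k i)" "\<And>i x. P i (lpart x) = h x * k i x"
    unfolding hdvd_def by metis
  obtain i z where "P i z \<noteq> 0" using relatively_prime_nonzero[OF prime] by blast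
  have "depends_on (range Inl) h"
  proof (rule depends_on_factor[OF h k(1)[of i]])
    show "depends_on (range Inl) (\<lambda>x. h x * k i x)" using depends_on_lpart[of "P i"]
        by (simp add: k(2))
    have "h (join z 0) * k i (join z 0) \<noteq> 0" using \<open>P i z \<noteq> 0\<close> k(2)[of i "join z 0"] by simp
    then show "\<exists>x. h x * k i x \<noteq> 0" by blast
  qed
  then have h0: "h x = h (join (lpart x) 0)" for x unfolding depends_on_def by auto
  have hp: "hpoly (\<lambda>z. F (join z 0))" if "hpoly F" for F :: "complex ^ ('n + 'n) \<Rightarrow> complex"
    by (rule hpoly_join[OF that]) (simp_all add: hpoly_intros)
  have "hdvd (\<lambda>z. h (join z 0)) (P i)" for i
  proof (rule hdvdI[OF hp[OF k(1)[of i]]])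
    show "P i z = h (join z 0) * k i (join z 0)" for z using k(2)[of i "join z 0"] by simp
  qed
  then obtain c where c: "c \<noteq> 0" "(\<lambda>z. h (join z 0)) = (\<lambda>z. c)"
    using relatively_prime_constD[OF prime hp[OF h]] by blast
  then have "h = (\<lambda>x. c)" using h0 by (metis (no_types))
  then show "\<exists>c. c \<noteq> 0 \<and> h = (\<lambda>x. c)" using c(1) by blast
qed

section \<open>Separate scaling of the two blocks of variables\<close>

abbreviation scale_left :: "complex \<Rightarrow> complex ^ ('n::finite + 'n) \<Rightarrow> complex ^ ('n + 'n)" where
  "scale_left \<equiv> scale_coords (range Inl)"

abbreviation scale_right :: "complex \<Rightarrow> complex ^ ('n::finite + 'n) \<Rightarrow> complex ^ ('n + 'n)" where
  "scale_right \<equiv> scale_coords (range Inr)"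

lemma scale_left_eq: "scale_left c x = join (c *s lpart x) (rpart x)"
  by (rule vec_sum_eqI) (auto simp: scale_coords_def)

lemma scale_right_eq: "scale_right c x = join (lpart x) (c *s rpart x)"
  by (rule vec_sum_eqI) (auto simp: scale_coords_def)

lemma dbl_scale: "dbl (c *s z) = join (c *s z) (cnj c *s conj_vec z)"
  by (rule vec_sum_eqI) auto

lemma star_join: "star F (join z w) = cnj (F (join (conj_vec w) (conj_vec z)))"
  by (simp add: star_def)

lemma pd_homogeneous:
  assumes "hpoly p" "\<And>c z. p (c *s z) = c ^ m * p z" "m > 0"
  shows "c * pd j p (c *s z) = c ^ m * pd j p z"
proof (cases "c = 0")
  case False
  have "line (axis j 1) p (c *s z) = smult (c ^ m) (line (axis j 1) p z \<circ>\<^sub>p [:0, 1 / c:])"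
  proof (rule line_unique[OF assms(1)])
    fix t
    have eq: "c *s z + t *s axis j 1 = c *s (z + (t / c) *s axis j 1)"
      using False by (simp add: vec_eq_iff field_simps)
    have "p (c *s z + t *s axis j 1) = c ^ m * p (z + (t / c) *s axis j 1)"
      by (simp only: eq assms(2))
    then show "poly (smult (c ^ m) (line (axis j 1) p z \<circ>\<^sub>p [:0, 1 / c:])) t = p (c *s z
        + t *s axis j 1)"
      by (simp add: poly_pcompose poly_line assms(1))
  qed
  then show ?thesis using False by (simp add: pd_def coeff_pcompose_linear)
qed (use assms in simp)


text \<open>The data after the factorization \<eta> = H \<theta>. As \<theta> has weight k + 1 under
  homotheties, counting the dz_j, \<open>H\<close> has bidegree (d - k - 1, d);
  \<open>hom_left\<close> expresses the first entry without subtraction.\<close>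

locale levi_foliation = levi_data P H
  for P :: "'n::finite \<Rightarrow> complex ^ 'n \<Rightarrow> complex" and H +
  fixes A B :: "'n \<Rightarrow> complex ^ 'n \<Rightarrow> real" and d k :: nat
  assumes eta: "\<And>j z. Complex (A j z) (- B j z) = H (dbl z) * P j z"
    and prime_P: "relatively_prime hpoly (range P)"
    and coprime_H: "hcoprime H (star H)" and H_nonzero: "\<exists>x. H x \<noteq> 0"
    and radial: "\<And>z. (\<Sum>j\<in>UNIV. P j z * z $ j) = 0"
    and hom_P: "\<And>j c z. P j (c *s z) = c ^ k * P j z"
    and hom_left: "\<And>c x. c ^ (k + 1) * H (scale_left c x) = c ^ d * H x"
    and hom_right: "\<And>c x. H (scale_right c x) = c ^ d * H x"
    and d: "d \<ge> 1"
begin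

lemma eta_form: "eta_form A B z v = H (dbl z) * \<theta> z v"
  by (simp add: eta_form_def complex_form_def eta sum_distrib_left mult_ac)

lemma real_form: "real_form A B z v = Re (H (dbl z) * \<theta> z v)"
  by (metis Re_eta_form eta_form)

lemma regular_iff: "z \<in> regular_set A B \<longleftrightarrow> z \<noteq> 0 \<and> H (dbl z) \<noteq> 0 \<and> (\<exists>j. P j z \<noteq> 0)"
proof -
  have "(A j z \<noteq> 0 \<or> B j z \<noteq> 0) \<longleftrightarrow> H (dbl z) \<noteq> 0 \<and> P j z \<noteq> 0" for j
    using eta[of j z] by (metis complex.sel complex_eq_iff mult_eq_0_iff neg_equal_0_iff_equal
        zero_complex.sel)
  then show ?thesis by (auto simp: regular_set_def)
qed

lemma constant_along_leaf:
  assumes R: "hpoly R" and S: "hpoly S"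
    and RSl: "\<And>i j x. S x * lbr i j R x = R x * lbr i j S x"
    and RSr: "\<And>i j x. S x * rbr i j R x = R x * rbr i j S x"
    and leaf: "same_levi_leaf A B z w" and ends: "S (dbl z) \<noteq> 0" "S (dbl w) \<noteq> 0"
  shows "R (dbl z) / S (dbl z) = R (dbl w) / S (dbl w)"
proof -
  obtain \<gamma> Z where \<gamma>: "valid_path \<gamma>" "pathstart \<gamma> = z" "pathfinish \<gamma> = w"
    "path_image \<gamma> \<subseteq> regular_set A B" and Z: "finite Z"
    and tangent: "\<And>t. t \<in> {0..1} - Z \<Longrightarrow> eta_form A B (\<gamma> t) (vector_derivative \<gamma> (at t)) = 0"
    using leaf unfolding same_levi_leaf_def by blast
  obtain Z' where Z': "finite Z'" "\<gamma> C1_differentiable_on ({0..1} - Z')"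
      and cont: "continuous_on {0..1} \<gamma>"
    using \<gamma>(1) unfolding valid_path_def piecewise_C1_differentiable_on_def by blast
  have reg: "H (dbl (\<gamma> t)) \<noteq> 0" "\<exists>i. P i (\<gamma> t) \<noteq> 0" if "t \<in> {0..1}" for t
  proof -
    have "\<gamma> t \<in> regular_set A B" using \<gamma>(4) that by (auto simp: path_image_def)
    then show "H (dbl (\<gamma> t)) \<noteq> 0" "\<exists>i. P i (\<gamma> t) \<noteq> 0" by (simp_all add: regular_iff)
  qed
  have "R (dbl (\<gamma> 0)) / S (dbl (\<gamma> 0)) = R (dbl (\<gamma> 1)) / S (dbl (\<gamma> 1))"
  proof (rule constant_along_path[OF R S RSl RSr _ cont, where Z = "Z \<union> Z'"
        and \<gamma>' = "\<lambda>t. vector_derivative \<gamma> (at t)"])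
    show "finite (Z \<union> Z')" using Z Z' by simp
    fix t assume t: "t \<in> {0..1} - (Z \<union> Z')"
    then show "(\<gamma> has_vector_derivative vector_derivative \<gamma> (at t)) (at t)"
      using Z'(2) by (auto simp: C1_differentiable_on_eq vector_derivative_works[symmetric])
    show "\<theta> (\<gamma> t) (vector_derivative \<gamma> (at t)) = 0"
      using tangent[of t] t reg[of t] by (simp add: eta_form)
  qed (use reg ends \<gamma> in \<open>auto simp: pathstart_def pathfinish_def\<close>)
  then show ?thesis using \<gamma>(2,3) by (simp add: pathstart_def pathfinish_def)
qed

lemma lbr_lpart: "hpoly f \<Longrightarrow>
    lbr i j (\<lambda>x. f (lpart x)) x = P i (lpart x) * pd j f (lpart x)
        - P j (lpart x) * pd i f (lpart x)"
  by (simp add: lbr_def pd_lpart)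

lemma rbr_lpart: "hpoly f \<Longrightarrow> rbr i j (\<lambda>x. f (lpart x)) x = 0"
  by (simp add: rbr_def pd_lpart)

lemma rbr_star:
  assumes "hpoly F"
  shows "rbr i j (star F) x = cnj (lbr i j F (join (conj_vec (rpart x)) (conj_vec (lpart x))))"
  by (simp add: rbr_def lbr_def pd_star assms)

lemma lbr_star_lpart:
  assumes "hpoly f"
  shows "lbr i j (star (\<lambda>x. f (lpart x))) x = 0"
  by (simp add: lbr_def pd_star pd_lpart hpoly_lpart assms)

lemma integrating_lbr: "H x * lbr i j (star H) x - star H x * lbr i j H x
    + H x * star H x * (pd i (P j) (lpart x) - pd j (P i) (lpart x)) = 0"
  using integrating[of x i j] by (simp add: lbr_def)

lemma P_nonzero: "\<exists>i z. P i z \<noteq> 0"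
  using relatively_prime_nonzero[OF prime_P] by blast

lemma hom_right_join: "H (join z (c *s w)) = c ^ d * H (join z w)"
  using hom_right[of c "join z w"] by (simp add: scale_right_eq)

lemma hom_left_join: "c ^ (k + 1) * H (join (c *s z) w) = c ^ d * H (join z w)"
  using hom_left[of c "join z w"] by (simp add: scale_left_eq)

lemma conj_vec_scale: "conj_vec (c *s z) = cnj c *s conj_vec z"
  by (simp add: vec_eq_iff)

lemma hom_star_left: "star H (join (c *s z) w) = c ^ d * star H (join z w)"
  by (simp add: star_join conj_vec_scale hom_right_join)

text \<open>Here star H is \<psi>(z) times a function of \<open>w\<close>, so H / star H is a /
  \<psi> up to a factor in \<open>w\<close>. On the points \<open>dbl z\<close>, \<open>H\<close>
  equals a times the conjugate of \<psi>, that is |\<psi>|^2 a / \<psi>.\<close>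

lemma split_case:
  assumes split: "\<And>x. H x = a (lpart x) * b (rpart x)" and a: "hpoly a" and b: "hpoly b"
  shows "\<exists>a \<psi>. projective_rational_form a \<psi> \<and>
            closed_on {z. \<psi> z \<noteq> 0} (rational_form a \<psi>) \<and>
            defines_levi A B {z. \<psi> z \<noteq> 0} (rational_form a \<psi>) \<and>
            (\<forall>z v. \<psi> z \<noteq> 0 \<longrightarrow> real_form A B z v = (cmod (\<psi> z))\<^sup>2 * Re (rational_form a \<psi> z v))"
proof -
  define \<psi> where "\<psi> z = cnj (b (conj_vec z))" for z
  have "\<psi> = (\<lambda>z. star (\<lambda>x. b (rpart x)) (join z 0))" by (simp add: \<psi>_def fun_eq_iff star_join)
  moreover have "hpoly (\<lambda>z. star (\<lambda>x. b (rpart x)) (join z 0))"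
    by (rule hpoly_join[OF hpoly_star[OF hpoly_rpart[OF b]]]) (simp_all add: hpoly_intros)
  ultimately have \<psi>: "hpoly \<psi>" by simp
  have H_dbl: "H (dbl z) = a z * cnj (\<psi> z)" for z by (simp add: split \<psi>_def)
  have star_H: "star H x = \<psi> (lpart x) * cnj (a (conj_vec (rpart x)))" for x
    by (simp add: star_def split \<psi>_def mult.commute)
  obtain z1 where z1: "a z1 \<noteq> 0" "\<psi> z1 \<noteq> 0"
  proof -
    have "\<exists>z. H (dbl z) \<noteq> 0" using H_nonzero hpoly_dbl_zero[OF hpoly_H] by blast
    then show ?thesis using that by (auto simp: H_dbl)
  qed
  have b1: "b (conj_vec z1) \<noteq> 0" using z1 by (simp add: \<psi>_def)
  have hom_a: "c ^ (k + 1) * a (c *s z) = c ^ d * a z" for c z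
    using hom_left_join[of c z "conj_vec z1"] b1 by (simp add: split mult.assoc)
  have hom_b: "b (c *s w) = c ^ d * b w" for c w
    using hom_right_join[of z1 c w] z1 by (simp add: split)
  have hom_\<psi>: "\<psi> (c *s z) = c ^ d * \<psi> z" for c z
    by (simp add: \<psi>_def conj_vec_scale hom_b)
  let ?\<tau> = "rational_form (\<lambda>j z. a z * P j z) \<psi>"
  have form: "?\<tau> z v = a z / \<psi> z * \<theta> z v" for z v
    by (simp add: rational_form_def complex_form_def sum_distrib_left sum_divide_distrib mult_ac)
  have closed: "a z * (P i z * pd j \<psi> z - P j z * pd i \<psi> z) - \<psi> z * (P i z * pd j a z
      - P j z * pd i a z)
      + a z * \<psi> z * (pd i (P j) z - pd j (P i) z) = 0" for i j z
  proof -
    \<comment> \<open>At this second argument the factors of \<open>H\<close> and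
      \<open>star H\<close> in \<open>w\<close> are nonzero constants and cancel from
      \<open>integrating\<close>.\<close>
    define w where "w = conj_vec z1"
    define u v where "u = b w" and "v = cnj (a (conj_vec w))"
    have uv: "u \<noteq> 0" "v \<noteq> 0" using z1 b1 by (auto simp: u_def v_def w_def)
    have pdH: "pd (Inl l) H (join z w) = u * pd l a z" for l
    proof -
      have "pd (Inl l) H (join z w) = pd l (\<lambda>z. H (join z w)) z" by (simp add: pd_join_left hpoly_H)
      also have "(\<lambda>z. H (join z w)) = (\<lambda>z. u * a z)" by (simp add: split u_def mult.commute)
      finally show ?thesis by (simp add: pd_cmult a)
    qed
    have pdK: "pd (Inl l) (star H) (join z w) = v * pd l \<psi> z" for l
    proof -
      have "pd (Inl l) (star H) (join z w) = pd l (\<lambda>z. star H (join z w)) z"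
        by (simp add: pd_join_left hpoly_star hpoly_H)
      also have "(\<lambda>z. star H (join z w)) = (\<lambda>z. v * \<psi> z)" by (simp add: star_H v_def mult.commute)
      finally show ?thesis by (simp add: pd_cmult \<psi>)
    qed
    have "(u * v) * (a z * (P i z * pd j \<psi> z - P j z * pd i \<psi> z) - \<psi> z * (P i z * pd j a z
        - P j z * pd i a z)
      + a z * \<psi> z * (pd i (P j) z - pd j (P i) z)) = 0"
      using integrating[of "join z w" i j] unfolding pdH pdK
      by (simp add: split star_H u_def[symmetric] v_def[symmetric] algebra_simps)
    then show ?thesis using uv by simp
  qed
  have ratio: "projective_rational_form (\<lambda>j z. a z * P j z) \<psi>"
    unfolding projective_rational_form_def
  proof (intro conjI allI impI)
    show "hpoly (\<lambda>z. a z * P j z)" for j by (intro hpoly_intros a hpoly_P)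
    show "hpoly \<psi>" by (rule \<psi>)
    show "\<exists>z. \<psi> z \<noteq> 0" using z1 by blast
    show "\<exists>e. homogeneous e \<psi>" using hom_\<psi> by (auto simp: homogeneous_def)
    show "?\<tau> z z = 0" for z by (simp add: form radial)
    show "?\<tau> (c *s z) (c *s v) = ?\<tau> z v"
      if "c \<noteq> 0" "\<psi> z \<noteq> 0" for z v c
    proof -
      have "\<theta> (c *s z) (c *s v) = c ^ (k + 1) * \<theta> z v"
        by (simp add: hom_P sum_distrib_left mult_ac)
      then have "?\<tau> (c *s z) (c *s v) = c ^ (k + 1) * a (c *s z) / (c ^ d * \<psi> z) * \<theta> z v"
        by (simp only: form hom_\<psi>) simp
      also have "\<dots> = a z / \<psi> z * \<theta> z v" using that by (simp only: hom_a) simp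
      finally show ?thesis by (simp only: form)
    qed
    show "relatively_prime hpoly (insert \<psi> (range (\<lambda>j z. a z * P j z)))"
    proof (rule relatively_primeI)
      fix h assume h: "hpoly h" and dvd: "\<And>f. f \<in> insert \<psi> (range (\<lambda>j z. a z * P j z)) \<Longrightarrow> hdvd h f"
      have h\<psi>: "hdvd h \<psi>" and hP: "\<And>j. hdvd h (\<lambda>z. a z * P j z)" using dvd by blast+
      have h0: "\<exists>z. h z \<noteq> 0" using h\<psi> z1 unfolding hdvd_def by auto
      \<comment> \<open>Split a common divisor as h = D h' with a = D a' and a', h' coprime.
        \<open>D\<close> divides \<open>a\<close> and \<psi>, hence both \<open>H\<close> and
        \<open>star H\<close>, and is constant; h' then divides every P_j and is constant
        too.\<close>
      obtain D a' h' where D: "hpoly D" and a': "hpoly a'" "\<And>z. a z = D z * a' z"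
        and h': "hpoly h'" "\<And>z. h z = D z * h' z" and cop: "hcoprime a' h'"
        using hpoly_reduce[OF a h h0] by metis
      have D0: "\<exists>z. D z \<noteq> 0" using h0 h' by auto
      have DH: "hdvd (\<lambda>x. D (lpart x)) H"
        by (rule hdvdI[of "\<lambda>x. a' (lpart x) * b (rpart x)"])
           (auto simp: split a' intro!: hpoly_intros hpoly_lpart hpoly_rpart a' b)
      have DK: "hdvd (\<lambda>x. D (lpart x)) (star H)"
      proof -
        obtain m where m: "hpoly m" "\<And>z. \<psi> z = h z * m z" using h\<psi> unfolding hdvd_def by blast
        have "(\<lambda>x. cnj (a (conj_vec (rpart x)))) = star (\<lambda>x. a (lpart x))"
            by (simp add: star_def fun_eq_iff)
        then have "hpoly (\<lambda>x. cnj (a (conj_vec (rpart x))))" using hpoly_star[OF hpoly_lpart[OF a]]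
            by simp
        then show ?thesis
          by (intro hdvdI[of "\<lambda>x. h' (lpart x) * m (lpart x) * cnj (a (conj_vec (rpart x)))"]
              hpoly_intros hpoly_lpart h' m)
             (simp_all add: star_H m h' mult.assoc)
      qed
      have "\<exists>x. star H x \<noteq> 0" using z1 by (intro exI[of _ "dbl z1"]) (simp add: star_dbl H_dbl)
      from hcoprime_common_divisor[OF coprime_H hpoly_star[OF hpoly_H] this hpoly_lpart[OF D] DH DK]
      obtain c where c: "c \<noteq> 0" "(\<lambda>x :: complex ^ ('n + 'n). D (lpart x)) = (\<lambda>x. c)" by blast
      have Dc: "D z = c" for z using fun_cong[OF c(2), of "join z 0"] by simp
      have "hdvd h' (P j)" for j
      proof (rule hcoprimeD1[OF cop hpoly_P])
        obtain m where m: "hpoly m" "\<And>z. a z * P j z = h z * m z" using hP[of j] unfolding hdvd_def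
            by blast
        show "hdvd h' (\<lambda>z. a' z * P j z)"
          by (rule hdvdI[OF m(1)]) (use m(2) c(1) in \<open>simp add: a' h' Dc\<close>)
      qed
      then obtain c' where c': "c' \<noteq> 0" "h' = (\<lambda>z. c')"
        using relatively_prime_constD[OF prime_P h'(1)] by blast
      then show "\<exists>c. c \<noteq> 0 \<and> h = (\<lambda>z. c)" using c(1) h'(2) Dc by (intro exI[of _ "c * c'"]) auto
    qed
  qed
  have "closed_on {z. \<psi> z \<noteq> 0} ?\<tau>"
    unfolding closed_on_def
  proof (intro ballI allI)
    fix z u v assume "z \<in> {z. \<psi> z \<noteq> 0}"
    then have nz: "\<psi> z \<noteq> 0" by simp
    define D where "D j l = ((pd l a z * P j z + a z * pd l (P j) z) * \<psi> z
        - a z * P j z * pd l \<psi> z) / (\<psi> z * \<psi> z)" for j l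
    have sym: "D j l = D l j" for j l
      unfolding D_def using closed[of z j l] by (simp add: algebra_simps)
    have "((\<lambda>z. a z * P j z / \<psi> z) has_derivative (\<lambda>v. \<Sum>l\<in>UNIV. D j l * v $ l)) (at z)" for j
      unfolding D_def by (rule has_derivative_hpoly_quotient[OF a hpoly_P \<psi> nz])
    then have der: "((\<lambda>x. ?\<tau> x v) has_derivative
        (\<lambda>u. \<Sum>j\<in>UNIV. (\<Sum>l\<in>UNIV. D j l * u $ l) * v $ j)) (at z)" for v
      unfolding rational_form_def complex_form_def by (intro has_derivative_sum
          has_derivative_mult_left)
    have fd: "frechet_derivative (\<lambda>x. ?\<tau> x v) (at z) u =
        (\<Sum>j\<in>UNIV. \<Sum>l\<in>UNIV. D j l * u $ l * v $ j)" for u v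
      by (simp only: fun_cong[OF frechet_derivative_at[OF der], symmetric] sum_distrib_right)
    have "(\<Sum>j\<in>UNIV. \<Sum>l\<in>UNIV. D j l * u $ l * v $ j) = (\<Sum>j\<in>UNIV. \<Sum>l\<in>UNIV. D j l * v $ l * u $ j)"
      by (subst sum.swap) (simp add: sym mult_ac)
    then show "ext_deriv ?\<tau> z u v = 0"
      unfolding ext_deriv_def fd by simp
  qed
  moreover have "defines_levi A B {z. \<psi> z \<noteq> 0} ?\<tau>"
    unfolding defines_levi_def
  proof
    obtain i z2 where i: "P i z2 \<noteq> 0" using P_nonzero by blast
    \<comment> \<open>A product of nonzero polynomials is nonzero somewhere; at such a point the
      form is defined and does not vanish.\<close>
    have "\<exists>z. a z * \<psi> z * P i z \<noteq> 0"
      using hpoly_mult_eq_0[of "\<lambda>z. a z * \<psi> z" "P i" z2] a \<psi> hpoly_P[of i] z1 i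
      by (auto intro: hpoly_intros)
    then obtain z where z: "a z \<noteq> 0" "\<psi> z \<noteq> 0" "P i z \<noteq> 0" by auto
    have "\<theta> z (axis i 1) = P i z"
      by (simp add: axis_def if_distrib[of "\<lambda>y. _ * y"] cong: if_cong)
    then have "?\<tau> z (axis i 1) \<noteq> 0" using z by (simp add: form)
    then show "\<exists>z\<in>{z. \<psi> z \<noteq> 0}. \<exists>v. ?\<tau> z v \<noteq> 0" using z by blast
    show "\<forall>z\<in>{z. \<psi> z \<noteq> 0} \<inter> regular_set A B. (\<exists>v. ?\<tau> z v \<noteq> 0) \<longrightarrow>
        {v. ?\<tau> z v = 0} = {v. eta_form A B z v = 0}"
      by (auto simp: form eta_form H_dbl)
  qed
  moreover have "real_form A B z v = (cmod (\<psi> z))\<^sup>2 * Re (?\<tau> z v)"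
    if "\<psi> z \<noteq> 0" for z v
  proof -
    have "complex_of_real ((cmod (\<psi> z))\<^sup>2) * ?\<tau> z v = H (dbl z) * \<theta> z v"
      unfolding complex_norm_square form H_dbl using that by simp
    from arg_cong[OF this, of Re] have "Re (H (dbl z) * \<theta> z v) =
        Re (complex_of_real ((cmod (\<psi> z))\<^sup>2) * ?\<tau> z v)"
      by (rule sym)
    then show ?thesis unfolding real_form by (simp only: times_complex.sel Re_complex_of_real
        Im_complex_of_real)
  qed
  ultimately show ?thesis using ratio by blast
qed


text \<open>p / q is the quotient of H / star H at w = w1 by the same function at w = w0. The proof
  takes \<kappa> = H q^2 / G in lowest terms, where q^2 d(p / q) = G \<theta>.\<close>

lemma quotient_case:
  fixes w0 w1 z0 z1 :: "complex ^ 'n"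
  defines "p \<equiv> \<lambda>z. H (join z w1) * star H (join z w0)"
    and "q \<equiv> \<lambda>z. star H (join z w1) * H (join z w0)"
  assumes nonconst: "p z1 * q z0 \<noteq> q z1 * p z0"
  shows "\<exists>p q N M d'. rational_first_integral A B p q \<and>
            d' \<ge> 1 \<and> real_rational_bidegree d' N M \<and>
            constant_along_levi_leaves A B {z. N z \<noteq> 0 \<and> M z \<noteq> 0}
              (\<lambda>z. (N z / M z) / cnj (N z / M z)) \<and>
            (\<forall>z v. q z \<noteq> 0 \<longrightarrow> M z \<noteq> 0 \<longrightarrow>
               real_form A B z v =
                 Re (N z / M z * frechet_derivative (\<lambda>x. p x / q x) (at z) v))"
proof -
  have hp: "hpoly (\<lambda>z. F (join z w))" if "hpoly F" for F :: "complex ^ ('n + 'n) \<Rightarrow> complex" and w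
    by (rule hpoly_join[OF that]) (simp_all add: hpoly_intros)
  have hK: "hpoly (star H)" by (rule hpoly_star[OF hpoly_H])
  have p: "hpoly p" and q: "hpoly q"
    unfolding p_def q_def by (intro hpoly_intros hp hpoly_H hK)+
  obtain l where l: "\<And>c x. H (scale_left c x) = c ^ l * H x"
    using factor_homogeneous[OF hpoly_H holomorphic_polynomial.const[of 1], of "k
        + 1" "range Inl" d] hom_left H_nonzero
    by auto
  \<comment> \<open>The common degree of \<open>p\<close> and \<open>q\<close>: in the first block
    \<open>H\<close> has degree \<open>l\<close> and \<open>star H\<close> has degree
    \<open>d\<close>.\<close>
  define m where "m = l + d"
  have m: "m > 0" using d by (simp add: m_def)
  have H_left: "H (join (c *s z) w) = c ^ l * H (join z w)" for c z w
    using l[of c "join z w"] by (simp add: scale_left_eq)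
  have hom_p: "p (c *s z) = c ^ m * p z" and hom_q: "q (c *s z) = c ^ m * q z" for c z
    by (simp_all add: p_def q_def H_left hom_star_left m_def power_add)
  have ratio: "q z * (P i z * pd j p z - P j z * pd i p z) = p z * (P i z * pd j q z
      - P j z * pd i q z)" for i j z
  proof -
    have pd_p: "pd i p z = pd (Inl i) H (join z w1) * star H (join z w0)
        + H (join z w1) * pd (Inl i) (star H) (join z w0)"
      and pd_q: "pd i q z = pd (Inl i) (star H) (join z w1) * H (join z w0)
          + star H (join z w1) * pd (Inl i) H (join z w0)" for i
      unfolding p_def q_def by (simp_all add: pd_mult hp hpoly_H hK pd_join_left)
    \<comment> \<open>Eliminates d\<theta>, represented by \<open>c\<close>, between the two
      closedness relations at w1 and w0.\<close>
    have alg: "k * h0 * (Lh * k0 + h * Lk0) = h * k0 * (Lk * h0 + k * Lh0)"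
      if "h * Lk - k * Lh + h * k * c = 0" "h0 * Lk0 - k0 * Lh0 + h0 * k0 * c = 0"
      for h k h0 k0 Lh Lk Lh0 Lk0 c :: complex
      using that by algebra
    have "star H (join z w1) * H (join z w0) *
        (lbr i j H (join z w1) * star H (join z w0) + H (join z w1) * lbr i j (star H) (join z w0))
            =
        H (join z w1) * star H (join z w0) *
        (lbr i j (star H) (join z w1) * H (join z w0) + star H (join z w1) * lbr i j H (join z w0))"
      using integrating_lbr[of "join z w1" i j] integrating_lbr[of "join z w0" i j]
      by (intro alg[where c = "pd i (P j) z - pd j (P i) z"]) simp_all
    then show ?thesis
      unfolding pd_p pd_q by (simp add: p_def q_def lbr_def algebra_simps)
  qed
  define E where "E j z = q z * pd j p z - p z * pd j q z" for j z
  have hE: "hpoly (E j)" for j unfolding E_def by (intro hpoly_intros hpoly_diff hpoly_pd p q)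
  have "E i z * P j z = E j z * P i z" for i j z
    using ratio[of z i j] by (simp add: E_def algebra_simps)
  from proportional_multiple[OF hpoly_P prime_P hE this]
  obtain G where G: "hpoly G" "\<And>j z. E j z = G z * P j z" by blast
  have q_nz: "\<exists>z. q z \<noteq> 0" using nonconst by (metis mult_zero_left mult_zero_right)
  have p_nz: "\<exists>z. p z \<noteq> 0" using nonconst by (metis mult_zero_left mult_zero_right)
  have nonconst_ratio: False if eq: "\<And>z. p z = c * q z" for c
    using nonconst eq[of z0] eq[of z1] by (simp add: mult_ac)
  have G_nz: "\<exists>z. G z \<noteq> 0"
  proof (rule ccontr)
    assume "\<not> ?thesis"
    then have E0: "q z * pd j p z = p z * pd j q z" for j z using G(2)[of j z] by (simp add: E_def)
    obtain a where "q a \<noteq> 0" using q_nz by blast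
    from hpoly_proportional_const[OF p q this E0] show False by (rule nonconst_ratio)
  qed
  have hom_G: "c ^ (k + 1) * G (c *s z) = c ^ (2 * m) * G z" for c z
  proof -
    obtain i z2 where i: "P i z2 \<noteq> 0" using P_nonzero by blast
    have hG: "hpoly (\<lambda>z. c ^ (k + 1) * G (c *s z))"
      by (intro hpoly_intros hpoly_compose[OF G(1)]) (simp add: hpoly_intros)
    have "P i z * (c ^ (k + 1) * G (c *s z)) = P i z * (c ^ (2 * m) * G z)" for z
    proof -
      have "c * E i (c *s z) = c ^ m * q z * (c * pd i p (c *s z))
          - c ^ m * p z * (c * pd i q (c *s z))"
        by (simp add: E_def hom_p hom_q algebra_simps)
      also have "\<dots> = c ^ (2 * m) * E i z"
        unfolding pd_homogeneous[OF p hom_p m] pd_homogeneous[OF q hom_q m] mult_2 power_add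
        by (simp add: E_def algebra_simps)
      finally show ?thesis by (simp add: G(2) hom_P mult_ac)
    qed
    moreover have "hpoly (\<lambda>z. c ^ (2 * m) * G z)" by (intro hpoly_intros G)
    ultimately show ?thesis using i by (intro hpoly_cancel[OF hpoly_P[of i] hG]) auto
  qed
  define Q where "Q x = q (lpart x) ^ 2" for x
  have hQ: "hpoly Q" unfolding Q_def[abs_def] by (intro hpoly_power hpoly_lpart q)
  have hGl: "hpoly (\<lambda>x. G (lpart x))" by (rule hpoly_lpart[OF G(1)])
  have Gl_nz: "\<exists>x :: complex ^ ('n + 'n). G (lpart x) \<noteq> 0"
    using G_nz by (metis vec_simps(6))
  obtain D N M where D: "hpoly D" and N: "hpoly N" "\<And>x. H x * Q x = D x * N x"
    and M: "hpoly M" "\<And>x. G (lpart x) = D x * M x" and cop: "hcoprime N M"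
    using hpoly_reduce[OF holomorphic_polynomial.mult[OF hpoly_H hQ] hGl Gl_nz] by metis
  have hNM: "hpoly (\<lambda>x. N x * D x)" by (intro hpoly_intros N D)
  have HQ_nz: "\<exists>x. N x * D x \<noteq> 0"
  proof (rule ccontr)
    assume "\<not> ?thesis"
    then have "H x * Q x = 0" for x using N(2)[of x] by (simp add: mult.commute)
    then have "Q x = 0" for x using hpoly_mult_eq_0[OF hpoly_H hQ _ H_nonzero] by blast
    then have "q z = 0" for z using Q_def[of "join z 0"] by simp
    then show False using q_nz by blast
  qed
  have MD_nz: "\<exists>x. M x * D x \<noteq> 0" using Gl_nz M(2) by (metis mult.commute)
  \<comment> \<open>Degrees are compared by evaluating the scaling identities at c = 2, at a point
    where the polynomial is nonzero.\<close>
  have pow2: "a = b" if "(2::complex) ^ a = 2 ^ b" for a b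
    using that by (metis of_nat_eq_iff of_nat_numeral of_nat_power power_inject_exp
        one_less_numeral_iff semiring_norm(76))
  have Q_left: "Q (scale_left c x) = c ^ (2 * m) * Q x"
    and Q_right: "Q (scale_right c x) = Q x" for c x
    by (simp_all add: Q_def scale_left_eq scale_right_eq hom_q power_mult_distrib power_mult
        mult.commute[of 2])
  \<comment> \<open>H q^2 = N D has bidegree (d + 2 m - k - 1, d) and G = M D has bidegree (2 m - k
    - 1, 0). The cancelled factor \<open>D\<close> contributes equally to both, so \<open>N\<close>
    and \<open>M\<close> differ by (d, d).\<close>
  have ND_left: "c ^ (k + 1) * (N (scale_left c x) * D (scale_left c x)) = c ^ (d
      + 2 * m) * (N x * D x)" for c x
  proof -
    have "c ^ (k + 1) * (N (scale_left c x) * D (scale_left c x)) =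
        (c ^ (k + 1) * H (scale_left c x)) * Q (scale_left c x)"
      using N(2)[of "scale_left c x"] by (simp add: mult_ac)
    also have "\<dots> = (c ^ d * H x) * (c ^ (2 * m) * Q x)"
      by (simp only: hom_left Q_left)
    also have "\<dots> = c ^ (d + 2 * m) * (H x * Q x)"
      by (simp only: power_add mult_ac)
    finally show ?thesis by (simp only: N(2) mult.commute)
  qed
  have MD_left: "c ^ (k + 1) * (M (scale_left c x) * D (scale_left c x))
      = c ^ (2 * m) * (M x * D x)" for c x
    using hom_G[of c "lpart x"] M(2)[of "scale_left c x"] M(2)[of x]
    by (simp add: scale_left_eq mult.commute[of "M _"])
  have ND_right: "c ^ 0 * (N (scale_right c x) * D (scale_right c x)) = c ^ d * (N x * D x)" for c x
  proof -
    have "N (scale_right c x) * D (scale_right c x) =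
        H (scale_right c x) * Q (scale_right c x)"
      by (simp add: N(2) mult.commute)
    also have "\<dots> = c ^ d * (H x * Q x)" by (simp only: hom_right Q_right mult.assoc)
    finally show ?thesis by (simp add: N(2) mult.commute)
  qed
  have MD_right: "c ^ 0 * (M (scale_right c x) * D (scale_right c x)) = c ^ 0 * (M x * D x)" for c x
    using M(2)[of "scale_right c x"] M(2)[of x]
    by (simp add: scale_right_eq mult.commute[of "M _"])
  obtain n1 where n1: "\<And>c x. N (scale_left c x) = c ^ n1 * N x"
    using factor_homogeneous[OF N(1) D ND_left HQ_nz] by blast
  obtain n2 where n2: "\<And>c x. N (scale_right c x) = c ^ n2 * N x"
    using factor_homogeneous[OF N(1) D ND_right HQ_nz] by blast
  obtain m1 where m1: "\<And>c x. M (scale_left c x) = c ^ m1 * M x"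
    using factor_homogeneous[OF M(1) D MD_left MD_nz] by blast
  obtain m2 where m2: "\<And>c x. M (scale_right c x) = c ^ m2 * M x"
    using factor_homogeneous[OF M(1) D MD_right MD_nz] by blast
  obtain l1 where l1: "\<And>c x. D (scale_left c x) = c ^ l1 * D x"
    using factor_homogeneous[OF D M(1), where S = "range Inl"] MD_left MD_nz by (metis mult.commute)
  obtain l2 where l2: "\<And>c x. D (scale_right c x) = c ^ l2 * D x"
    using factor_homogeneous[OF D M(1), where S = "range Inr"] MD_right MD_nz
        by (metis mult.commute)
  obtain x1 x2 where x1: "N x1 \<noteq> 0" "D x1 \<noteq> 0" and x2: "M x2 \<noteq> 0" "D x2 \<noteq> 0" using HQ_nz MD_nz
      by auto
  have "k + 1 + (n1 + l1) = d + 2 * m"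
    using ND_left[of 2 x1] x1 by (intro pow2) (simp add: n1 l1 power_add mult_ac)
  moreover have "k + 1 + (m1 + l1) = 2 * m"
    using MD_left[of 2 x2] x2 by (intro pow2) (simp add: m1 l1 power_add mult_ac)
  ultimately have nm1: "n1 = m1 + d" by simp
  have "n2 + l2 = d" using ND_right[of 2 x1] x1 by (intro pow2) (simp add: n2 l2 power_add mult_ac)
  moreover have "m2 + l2 = 0" using MD_right[of 2 x2] x2
      by (intro pow2) (simp add: m2 l2 power_add mult_ac)
  ultimately have nm2: "n2 = m2 + d" by simp
  have dbl_sc: "dbl (c *s z) = scale_left c (scale_right (cnj c) (dbl z))" for c
      and z :: "complex ^ 'n"
    by (rule vec_sum_eqI) (auto simp: scale_left_eq scale_right_eq)
  have bideg: "real_rational_bidegree d (\<lambda>z. N (dbl z)) (\<lambda>z. M (dbl z))"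
    unfolding real_rational_bidegree_def
  proof (intro conjI)
    show "polynomial_function (\<lambda>z. N (dbl z))" "polynomial_function (\<lambda>z. M (dbl z))"
      by (intro polynomial_function_dbl N M)+
    show "\<exists>z. M (dbl z) \<noteq> 0" using hpoly_dbl_zero[OF M(1)] x2 by blast
    have "relatively_prime hpoly {N, M}"
      by (rule relatively_primeI) (use hcoprime_common_divisor[OF cop M(1)] x2 in blast)
    then show "relatively_prime polynomial_function {\<lambda>z. N (dbl z), \<lambda>z. M (dbl z)}"
      using relatively_prime_dbl[of "{N, M}"] N(1) M(1) by auto
    show "\<exists>a b. bihomogeneous (a + d) (b + d) (\<lambda>z. N (dbl z)) \<and> bihomogeneous a b (\<lambda>z. M (dbl z))"
      by (rule exI[of _ m1], rule exI[of _ m2])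
         (simp add: bihomogeneous_def dbl_sc n1 n2 m1 m2 nm1[symmetric] nm2[symmetric] mult_ac)
  qed
  have first: "rational_first_integral A B p q"
    unfolding rational_first_integral_def
  proof (intro conjI)
    show "\<exists>k. homogeneous k p \<and> homogeneous k q" using hom_p hom_q by (auto simp: homogeneous_def)
    show "\<not> (\<exists>c. \<forall>z. q z \<noteq> 0 \<longrightarrow> p z / q z = c)"
    proof
      assume "\<exists>c. \<forall>z. q z \<noteq> 0 \<longrightarrow> p z / q z = c"
      then obtain c where c: "\<And>z. q z \<noteq> 0 \<Longrightarrow> p z / q z = c" by blast
      have "p z = c * q z" for z
      proof (rule hpoly_cancel[OF q p _ _ q_nz])
        show "hpoly (\<lambda>z. c * q z)" by (intro hpoly_intros q)
        show "q z * p z = q z * (c * q z)" for z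
          using c[of z] by (cases "q z = 0") (auto simp: field_simps)
      qed
      then show False by (rule nonconst_ratio)
    qed
    show "constant_along_levi_leaves A B {z. q z \<noteq> 0} (\<lambda>z. p z / q z)"
      unfolding constant_along_levi_leaves_def
    proof (intro ballI impI)
      fix z w assume "z \<in> {z. q z \<noteq> 0}" "w \<in> {z. q z \<noteq> 0}" and leaf: "same_levi_leaf A B z w"
      then have "p (lpart (dbl z)) / q (lpart (dbl z)) = p (lpart (dbl w)) / q (lpart (dbl w))"
        by (intro constant_along_leaf[OF hpoly_lpart[OF p] hpoly_lpart[OF q] _ _ leaf])
           (simp_all add: lbr_lpart rbr_lpart p q ratio)
      then show "p z / q z = p w / q w" by simp
    qed
  qed (use p q q_nz in auto)
  have main: "real_form A B z v = Re (N (dbl z) / M (dbl z) * frechet_derivative (\<lambda>x. p x / q x)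
      (at z) v)"
    if qz: "q z \<noteq> 0" and Mz: "M (dbl z) \<noteq> 0" for z v
  proof -
    have "((\<lambda>x. p x / q x) has_derivative (\<lambda>v. ((\<Sum>j\<in>UNIV. pd j p z * v $ j) * q z
        - p z * (\<Sum>j\<in>UNIV. pd j q z * v $ j)) / (q z * q z))) (at z)"
      by (rule has_derivative_divide'[OF has_derivative_hpoly[OF p] has_derivative_hpoly[OF q] qz])
    then have "frechet_derivative (\<lambda>x. p x / q x) (at z) v = ((\<Sum>j\<in>UNIV. pd j p z * v $ j) * q z
        - p z * (\<Sum>j\<in>UNIV. pd j q z * v $ j)) / (q z * q z)"
      by (rule fun_cong[OF frechet_derivative_at, symmetric])
    also have "(\<Sum>j\<in>UNIV. pd j p z * v $ j) * q z - p z * (\<Sum>j\<in>UNIV. pd j q z * v $ j) =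
        (\<Sum>j\<in>UNIV. E j z * v $ j)"
      by (simp add: E_def sum_distrib_left sum_distrib_right sum_subtractf[symmetric] algebra_simps)
    also have "\<dots> = G z * \<theta> z v" by (simp add: G(2) sum_distrib_left mult.assoc)
    finally have fd: "frechet_derivative (\<lambda>x. p x / q x) (at z) v = G z * \<theta> z v / (q z * q z)" .
    have "N (dbl z) * G z = H (dbl z) * (q z * q z) * M (dbl z)"
      using N(2)[of "dbl z"] M(2)[of "dbl z"] by (simp add: Q_def power2_eq_square)
    then have "N (dbl z) / M (dbl z) * (G z * \<theta> z v / (q z * q z)) = H (dbl z) * \<theta> z v"
      using qz Mz by (simp add: field_simps)
    then show ?thesis by (simp only: fd real_form)
  qed
  have const: "constant_along_levi_leaves A B {z. N (dbl z) \<noteq> 0 \<and> M (dbl z) \<noteq> 0}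
      (\<lambda>z. (N (dbl z) / M (dbl z)) / cnj (N (dbl z) / M (dbl z)))"
  proof -
    \<comment> \<open>On the points \<open>dbl z\<close> the quotient R / S is \<kappa> divided by
      its conjugate.\<close>
    define R S where "R x = N x * star M x" and "S x = M x * star N x" for x
    have hs: "hpoly (star N)" "hpoly (star M)" "hpoly (star D)" "hpoly (star Q)"
      "hpoly (star (\<lambda>x. G (lpart x)))"
      by (intro hpoly_star N M D hQ hGl)+
    have hR: "hpoly R" and hS: "hpoly S"
      unfolding R_def[abs_def] S_def[abs_def] by (intro hpoly_intros N M hs)+
    have star_R: "star R = S" and star_S: "star S = R"
      by (simp_all add: R_def S_def star_def fun_eq_iff mult.commute)
    \<comment> \<open>This is dd(p / q) = 0, that is, closedness of (G / q^2) \<theta>, with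
      denominators cleared.\<close>
    have G_eq: "q z * (P i z * pd j G z - P j z * pd i G z) - 2 * G z * (P i z * pd j q z
        - P j z * pd i q z)
        = (pd i (P j) z - pd j (P i) z) * G z * q z" for i j z
    proof -
      have E_fun: "E j = (\<lambda>z. G z * P j z)" for j using G(2) by (simp add: fun_eq_iff)
      have "pd i (E j) z = pd i q z * pd j p z + q z * pd i (pd j p) z - (pd i p z * pd j q z
          + p z * pd i (pd j q) z)" for i j
        unfolding E_def[abs_def] by (simp add: pd_diff pd_mult hpoly_pd hpoly_intros p q)
      moreover have "pd i (E j) z = pd i G z * P j z + G z * pd i (P j) z" for i j
        unfolding E_fun by (simp add: pd_mult G hpoly_P)
      ultimately have "pd i G z * P j z + G z * pd i (P j) z - (pd j G z * P i z
          + G z * pd j (P i) z)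
          = 2 * (pd i q z * pd j p z - pd i p z * pd j q z)"
        using pd_commute[OF p, of i j z] pd_commute[OF q, of i j z]
            by (smt (verit) add_diff_eq diff_add_eq mult_2 diff_diff_eq2 add.commute
            add_diff_cancel_left' mult.commute)
      moreover have "q z * pd j p z - p z * pd j q z = G z * P j z"
        "q z * pd i p z - p z * pd i q z = G z * P i z"
        using G(2)[of j z] G(2)[of i z] by (simp_all add: E_def)
      ultimately show ?thesis by algebra
    qed
    have Q_lbr: "lbr i j Q x = 2 * q (lpart x) * (P i (lpart x) * pd j q (lpart x)
        - P j (lpart x) * pd i q (lpart x))" for i j x
    proof -
      have "Q = (\<lambda>x. q (lpart x) * q (lpart x))" by (simp add: Q_def fun_eq_iff power2_eq_square)
      then show ?thesis by (simp add: lbr_mult lbr_lpart hpoly_lpart q algebra_simps)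
    qed
    have GQ: "Q x * lbr i j (\<lambda>x. G (lpart x)) x - G (lpart x) * lbr i j Q x =
        (pd i (P j) (lpart x) - pd j (P i) (lpart x)) * G (lpart x) * Q x" for i j x
      using G_eq[of "lpart x" i j] unfolding Q_lbr lbr_lpart[OF G(1)] Q_def by algebra
    have lG: "lbr i j (star (\<lambda>x. G (lpart x))) x = 0" for i j x by (rule lbr_star_lpart[OF G(1)])
    have lQ: "lbr i j (star Q) x = 0" for i j x
    proof -
      have "Q = (\<lambda>x. (\<lambda>z. q z ^ 2) (lpart x))" by (simp add: Q_def fun_eq_iff)
      then show ?thesis using lbr_star_lpart[OF hpoly_power[OF q, of 2]] by simp
    qed
    define G' where "G' x = G (lpart x)" for x :: "complex ^ ('n + 'n)"
    have hG': "hpoly G'" using hGl by (simp add: G'_def[abs_def])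
    have RD: "D x * star D x * R x = H x * Q x * star G' x" for x
    proof -
      have "star D x * star M x = star G' x"
        using M(2)[of "join (conj_vec (rpart x)) (conj_vec (lpart x))"]
        by (simp add: star_def G'_def flip: complex_cnj_mult)
      moreover have "D x * star D x * R x = (D x * N x) * (star D x * star M x)"
        by (simp add: R_def mult_ac)
      ultimately show ?thesis by (simp only: N(2))
    qed
    have SD: "D x * star D x * S x = G' x * (star H x * star Q x)" for x
    proof -
      have "star D x * star N x = star H x * star Q x" using N(2)
          by (simp add: star_def) (metis complex_cnj_mult)
      moreover have "D x * star D x * S x = (D x * M x) * (star D x * star N x)"
        by (simp add: S_def mult_ac)
      ultimately show ?thesis by (simp only: M(2) G'_def)
    qed
    define C where "C x = D x * star D x" for x
    have hC: "hpoly C" unfolding C_def[abs_def] by (intro hpoly_intros D hs)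
    have C_nz: "\<exists>x. C x \<noteq> 0"
    proof -
      have "D (dbl z) \<noteq> 0 \<Longrightarrow> C (dbl z) \<noteq> 0" for z by (simp add: C_def star_dbl)
      then show ?thesis using hpoly_dbl_zero[OF D] x1 by blast
    qed
    \<comment> \<open>R / S is (H / star H) (Q / G) times star G / star Q, and the last factor has
      zero left bracket. Closedness of (H / star H) \<theta> and of (G / Q) \<theta> gives the claim
      after elimination of d\<theta>; C = D star D undoes the cancellation.\<close>
    have RSl: "S x * lbr i j R x = R x * lbr i j S x" for i j x
    proof (rule hpoly_cancel[where F = "\<lambda>x. C x * C x"])
      fix x
      have 1: "(\<lambda>x. C x * R x) = (\<lambda>x. H x * Q x * star G' x)" by (simp add: C_def RD)
      have 2: "(\<lambda>x. C x * S x) = (\<lambda>x. G' x * (star H x * star Q x))" by (simp add: C_def SD)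
      have lR: "lbr i j C x * R x + C x * lbr i j R x = (lbr i j H x * Q x
          + H x * lbr i j Q x) * star G' x"
        using arg_cong[OF 1, of "\<lambda>F. lbr i j F x"] lG[of i j x]
        by (simp add: lbr_mult hC hR hpoly_H hQ hs hG' hpoly_star hpoly_intros G'_def[abs_def])
      have lS: "lbr i j C x * S x + C x * lbr i j S x = (lbr i j G' x * star H x
          + G' x * lbr i j (star H) x) * star Q x"
        using arg_cong[OF 2, of "\<lambda>F. lbr i j F x"] lQ[of i j x]
        by (simp add: lbr_mult hC hS hpoly_H hQ hs hG' hpoly_star hpoly_intros algebra_simps)
      have "C x * S x * (C x * lbr i j R x + lbr i j C x * R x) = C x * R x * (C x * lbr i j S x
          + lbr i j C x * S x)"
        using lR lS fun_cong[OF 1, of x] fun_cong[OF 2, of x] integrating_lbr[of x i j] GQ[of x i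
            j, folded G'_def[abs_def], folded G'_def]
        by algebra
      then show "C x * C x * (S x * lbr i j R x) = C x * C x * (R x * lbr i j S x)"
          by (simp add: algebra_simps)
    qed (use C_nz in \<open>auto intro!: hpoly_intros hpoly_lbr hR hS hC\<close>)
    \<comment> \<open>Conjugation exchanges \<open>R\<close> with \<open>S\<close> and left brackets
      with right brackets, so this is the conjugate of \<open>RSl\<close>.\<close>
    have RSr: "S x * rbr i j R x = R x * rbr i j S x" for i j x
    proof -
      define y where "y = join (conj_vec (rpart x)) (conj_vec (lpart x))"
      have "S x = cnj (R y)" "R x = cnj (S y)"
        using fun_cong[OF star_R, of x] fun_cong[OF star_S, of x] by (simp_all add: star_def y_def)
      moreover have "rbr i j R x = cnj (lbr i j S y)" "rbr i j S x = cnj (lbr i j R y)"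
        using rbr_star[OF hS, of i j x] rbr_star[OF hR, of i j x]
            by (simp_all add: star_R star_S y_def)
      ultimately show ?thesis using RSl[of y i j] by (metis complex_cnj_mult)
    qed
    show ?thesis
      unfolding constant_along_levi_leaves_def
    proof (intro ballI impI)
      fix z w assume zw: "z \<in> {z. N (dbl z) \<noteq> 0 \<and> M (dbl z) \<noteq> 0}" "w \<in> {z. N (dbl z) \<noteq> 0
          \<and> M (dbl z) \<noteq> 0}"
        and leaf: "same_levi_leaf A B z w"
      have "R (dbl z) / S (dbl z) = R (dbl w) / S (dbl w)"
        by (rule constant_along_leaf[OF hR hS RSl RSr leaf]) (use zw in \<open>auto simp: S_def star_dbl\<close>)
      then show "N (dbl z) / M (dbl z) / cnj (N (dbl z) / M (dbl z))
          = N (dbl w) / M (dbl w) / cnj (N (dbl w) / M (dbl w))"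
        by (simp add: R_def S_def star_dbl)
    qed
  qed
  have "rational_first_integral A B p q \<and> d \<ge> 1 \<and>
      real_rational_bidegree d (\<lambda>z. N (dbl z)) (\<lambda>z. M (dbl z)) \<and>
      constant_along_levi_leaves A B {z. N (dbl z) \<noteq> 0 \<and> M (dbl z) \<noteq> 0}
        (\<lambda>z. (N (dbl z) / M (dbl z)) / cnj (N (dbl z) / M (dbl z))) \<and>
      (\<forall>z v. q z \<noteq> 0 \<longrightarrow> M (dbl z) \<noteq> 0 \<longrightarrow>
         real_form A B z v = Re (N (dbl z) / M (dbl z) * frechet_derivative (\<lambda>x. p x / q x)
             (at z) v))"
    using first d bideg const main by blast
  then show ?thesis
    by - (rule exI[of _ p], rule exI[of _ q], rule exI[of _ "\<lambda>z. N (dbl z)"],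
        rule exI[of _ "\<lambda>z. M (dbl z)"], rule exI[of _ d])
qed

end

text \<open>The identity is polynomial in \<open>c\<close> and its conjugate, which may therefore be
  replaced by independent variables \<open>s\<close> and \<open>t\<close>. This is the doubling
  principle once more, now for the single variable \<open>c\<close>, whence the type
  \<open>complex ^ (1 + 1)\<close>.\<close>

lemma scale_identity_bivariate:
  fixes H :: "complex ^ ('n::finite + 'n) \<Rightarrow> complex"
  assumes H: "hpoly H" and hom: "\<And>c z. c ^ (k + 1) * H (dbl (c *s z)) = (c * cnj c) ^ d * H (dbl z)"
  shows "s ^ (k + 1) * H (join (s *s lpart x) (t *s rpart x)) = (s * t) ^ d * H x"
proof -
  have 1: "c ^ (k + 1) * H (join (c *s lpart x) (cnj c *s rpart x)) = (c * cnj c) ^ d * H x" for c x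
  proof (rule hpoly_dbl_eqI)
    show "hpoly (\<lambda>x. c ^ (k + 1) * H (join (c *s lpart x) (cnj c *s rpart x)))"
      by (rule holomorphic_polynomial.mult[OF holomorphic_polynomial.const hpoly_join[OF H]])
         (auto intro: hpoly_intros)
    show "hpoly (\<lambda>x. (c * cnj c) ^ d * H x)" by (intro hpoly_intros H)
    show "c ^ (k + 1) * H (join (c *s lpart (dbl z)) (cnj c *s rpart (dbl z)))
        = (c * cnj c) ^ d * H (dbl z)" for z :: "complex ^ 'n"
      using hom[of c z] by (simp only: dbl_scale vec_simps)
  qed
  define f where "f y = (y $ Inl 1) ^ (k + 1) * H (join ((y $ Inl 1) *s lpart x) ((y $ Inr 1) *s
      rpart x))"
    for y :: "complex ^ (1 + 1)"
  define g where "g y = (y $ Inl 1 * y $ Inr 1) ^ d * H x" for y :: "complex ^ (1 + 1)"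
  have hj: "hpoly (\<lambda>y :: complex ^ (1 + 1). H (join ((y $ Inl 1) *s lpart x) ((y $ Inr 1) *s rpart
      x)))"
    by (rule hpoly_join[OF H]) (auto intro: hpoly_intros)
  have f: "hpoly f" unfolding f_def
    by (rule holomorphic_polynomial.mult[OF hpoly_power[OF holomorphic_polynomial.coord] hj])
  have g: "hpoly g" unfolding g_def by (intro hpoly_intros hpoly_power)
  have "f (dbl z) = g (dbl z)" for z :: "complex ^ 1"
    unfolding f_def g_def vec_simps by (rule 1)
  then have "f (join (vec s) (vec t)) = g (join (vec s) (vec t))" by (rule hpoly_dbl_eqI[OF f g])
  then show ?thesis by (simp add: f_def g_def)
qed

text \<open>By coprimality with \<open>K\<close>, \<open>H\<close> divides a(z) b(w). Its common
  factor with a(z) depends only on \<open>z\<close>; what remains is coprime to the rest of a(z), so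
  it divides b(w) and depends only on \<open>w\<close>.\<close>

lemma separated_factors:
  fixes H K :: "complex ^ ('n::finite + 'n) \<Rightarrow> complex"
  assumes H: "hpoly H" "\<exists>x. H x \<noteq> 0" and K: "hpoly K" and cop: "hcoprime H K"
    and a: "hpoly a" "\<exists>z. a z \<noteq> 0" and b: "hpoly b" "\<exists>z. b z \<noteq> 0" and k: "hpoly k"
    and eq: "\<And>x. K x * (a (lpart x) * b (rpart x)) = H x * k x"
  shows "\<exists>a b. hpoly a \<and> hpoly b \<and> (\<forall>x. H x = a (lpart x) * b (rpart x))"
proof -
  have ha: "hpoly (\<lambda>x. a (lpart x))" and hb: "hpoly (\<lambda>x. b (rpart x))"
    using a b by (auto intro: hpoly_lpart hpoly_rpart)
  have "hdvd H (\<lambda>x. a (lpart x) * b (rpart x))"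
    by (rule hcoprimeD2[OF cop holomorphic_polynomial.mult[OF ha hb] hdvdI[OF k eq]])
  then obtain m where m: "hpoly m" "\<And>x. a (lpart x) * b (rpart x) = H x * m x"
      by (auto simp: hdvd_def)
  obtain za where za: "a za \<noteq> 0" using a by blast
  obtain zb where zb: "b zb \<noteq> 0" using b by blast
  have a_nz: "\<exists>x :: complex ^ ('n + 'n). a (lpart x) \<noteq> 0"
      by (rule exI[of _ "join za 0"]) (simp add: za)
  obtain D h a' where D: "hpoly D" and h: "hpoly h" "\<And>x. H x = D x * h x"
    and a': "hpoly a'" "\<And>x. a (lpart x) = D x * a' x" and cop': "hcoprime h a'"
    using hpoly_reduce[OF H(1) ha a_nz] by metis
  have D_nz: "\<exists>x. D x \<noteq> 0" using a_nz a' by auto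
  have dD: "depends_on (range Inl) D"
  proof (rule depends_on_factor[OF D a'(1)])
    show "depends_on (range Inl) (\<lambda>x. D x * a' x)" using depends_on_lpart[of a] by (simp add: a'(2))
    show "\<exists>x. D x * a' x \<noteq> 0" using a_nz a'(2) by auto
  qed
  have "a' x * b (rpart x) = h x * m x" for x
    by (rule hpoly_cancel[OF D _ _ _ D_nz])
       (use m(2) h(2) a'(2) in \<open>auto intro!: hpoly_intros a' hb h m simp: mult.assoc[symmetric]\<close>)
  then have "hdvd h (\<lambda>x. a' x * b (rpart x))" by (rule hdvdI[OF m(1)])
  then have "hdvd h (\<lambda>x. b (rpart x))" by (rule hcoprimeD2[OF cop' hb])
  then obtain k' where k': "hpoly k'" "\<And>x. b (rpart x) = h x * k' x" by (auto simp: hdvd_def)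
  have dh: "depends_on (range Inr) h"
  proof (rule depends_on_factor[OF h(1) k'(1)])
    have "rpart x = rpart y" if "\<forall>k\<in>range Inr. x $ k = y $ k" for x y :: "complex ^ ('n + 'n)"
      using that by (simp add: vec_eq_iff)
    then show "depends_on (range Inr) (\<lambda>x. h x * k' x)"
      unfolding depends_on_def k'(2)[symmetric] by metis
    have "h (join 0 zb) * k' (join 0 zb) \<noteq> 0" using zb k'(2)[of "join 0 zb"] by simp
    then show "\<exists>x. h x * k' x \<noteq> 0" by blast
  qed
  have "H x = D (join (lpart x) 0) * h (join 0 (rpart x))" for x
  proof -
    have "D x = D (join (lpart x) 0)" using dD unfolding depends_on_def by auto
    moreover have "h x = h (join 0 (rpart x))" using dh unfolding depends_on_def by auto
    ultimately show ?thesis using h(2)[of x] by simp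
  qed
  moreover have "hpoly (\<lambda>z. D (join z 0))" "hpoly (\<lambda>z. h (join 0 z))"
    by (rule hpoly_join[OF D] hpoly_join[OF h(1)]; simp add: hpoly_intros)+
  ultimately show ?thesis by blast
qed

theorem theorem3:
  fixes n d :: nat
    and A B :: "'n::finite \<Rightarrow> complex ^ 'n \<Rightarrow> real"
  assumes "n \<ge> 2" and "CARD('n) = n + 1"
    and "\<And>j. real_polynomial_function (A j)" and "\<And>j. real_polynomial_function (B j)"
    and "relatively_prime polynomial_function
           (range (\<lambda>j z. complex_of_real (A j z)) \<union> range (\<lambda>j z. complex_of_real (B j z)))"
    and "integrable_form (real_form A B)"
    and "\<And>z. real_form A B z z = 0" and "\<And>z. sharp_form A B z z = 0"
    and "d \<ge> 1"
    and "\<And>c z v. c \<noteq> 0 \<Longrightarrow> real_form A B (c *s z) (c *s v) = cmod c ^ (2 * d) * real_form A B z v"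
    and "levi_flat A B"
    and "levi_foliation_holomorphic A B"
  shows "(\<exists>a \<psi>. projective_rational_form a \<psi> \<and>
            closed_on {z. \<psi> z \<noteq> 0} (rational_form a \<psi>) \<and>
            defines_levi A B {z. \<psi> z \<noteq> 0} (rational_form a \<psi>) \<and>
            (\<forall>z v. \<psi> z \<noteq> 0 \<longrightarrow> real_form A B z v = (cmod (\<psi> z))\<^sup>2 * Re (rational_form a \<psi> z v)))
       \<or> (\<exists>p q N M d'. rational_first_integral A B p q \<and>
            d' \<ge> 1 \<and> real_rational_bidegree d' N M \<and>
            constant_along_levi_leaves A B {z. N z \<noteq> 0 \<and> M z \<noteq> 0}
              (\<lambda>z. (N z / M z) / cnj (N z / M z)) \<and>
            (\<forall>z v. q z \<noteq> 0 \<longrightarrow> M z \<noteq> 0 \<longrightarrow>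
               real_form A B z v =
                 Re (N z / M z * frechet_derivative (\<lambda>x. p x / q x) (at z) v)))"
proof -
  have "\<forall>j. \<exists>F. hpoly F \<and> (\<forall>z. of_real (A j z) = F (dbl z))"
    using real_polynomial_function_dbl[OF assms(3)] by blast
  then obtain A' where A': "\<And>j. hpoly (A' j)" "\<And>j z. of_real (A j z) = A' j (dbl z)" by metis
  have "\<forall>j. \<exists>F. hpoly F \<and> (\<forall>z. of_real (B j z) = F (dbl z))"
    using real_polynomial_function_dbl[OF assms(4)] by blast
  then obtain B' where B': "\<And>j. hpoly (B' j)" "\<And>j z. of_real (B j z) = B' j (dbl z)" by metis
  have prime: "relatively_prime hpoly (range A' \<union> range B')"
  proof -
    have "(\<lambda>F z. F (dbl z)) ` (range A' \<union> range B') =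
        range (\<lambda>j z. complex_of_real (A j z)) \<union> range (\<lambda>j z. complex_of_real (B j z))"
      by (simp add: image_Un image_image A'(2) B'(2))
    then show ?thesis using assms(5) relatively_prime_dbl[of "range A' \<union> range B'"] A'(1) B'(1)
        by auto
  qed
  define E where "E j x = A' j x - \<i> * B' j x" for j x
  have E: "hpoly (E j)" for j unfolding E_def by (intro hpoly_diff hpoly_intros A' B')
  have E_dbl: "E j (dbl z) = Complex (A j z) (- B j z)" for j z
    by (simp add: E_def A'(2)[symmetric] B'(2)[symmetric] complex_eq_iff)
  obtain P where fol: "holomorphic_foliation P" and def: "defines_levi A B UNIV (complex_form P)"
    using assms(12) unfolding levi_foliation_holomorphic_def by blast
  have P: "\<And>j. hpoly (P j)" and primeP: "relatively_prime hpoly (range P)" and radial: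
      "\<And>z. complex_form P z z = 0"
    using fol by (auto simp: holomorphic_foliation_def)
  obtain k where k: "\<And>j c z. P j (c *s z) = c ^ k * P j z"
    using fol by (auto simp: holomorphic_foliation_def homogeneous_def)
  have cross0: "E i (dbl z) * P j z = E j (dbl z) * P i z" if "z \<noteq> 0" for i j z
  proof (cases "z \<in> regular_set A B \<and> (\<exists>v. complex_form P z v \<noteq> 0)")
    case True
    \<comment> \<open>This vector is annihilated by \<theta>, hence by \<eta>, and \<eta>(v) is the
      cross difference that has to vanish.\<close>
    define v where "v = P j z *s axis i 1 - P i z *s axis j 1"
    have ax: "(\<Sum>l\<in>UNIV. F l * axis i 1 $ l) = F i" for F :: "'n \<Rightarrow> complex" and i
      by (simp add: axis_def if_distrib[of "\<lambda>y. _ * y"] cong: if_cong)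
    have form: "complex_form F z v = F i z * P j z - F j z * P i z" for F
    proof -
      have "complex_form F z v = P j z * (\<Sum>l\<in>UNIV. F l z * axis i 1 $ l)
          - P i z * (\<Sum>l\<in>UNIV. F l z * axis j 1 $ l)"
        by (simp add: complex_form_def v_def sum_distrib_left sum_subtractf[symmetric]
            algebra_simps)
      then show ?thesis by (simp only: ax mult.commute)
    qed
    have "{v. complex_form P z v = 0} = {v. eta_form A B z v = 0}"
      using def True unfolding defines_levi_def by auto
    then have "complex_form P z v = 0 \<longleftrightarrow> eta_form A B z v = 0" by auto
    then have "eta_form A B z v = 0" by (simp add: form)
    then have "complex_form (\<lambda>j z. E j (dbl z)) z v = 0"
      by (simp add: eta_form_def E_dbl)
    then show ?thesis by (simp add: form)
  next
    case False
    have "E i (dbl z) = 0 \<and> E j (dbl z) = 0" if "z \<notin> regular_set A B"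
      using that \<open>z \<noteq> 0\<close> by (auto simp: regular_set_def E_dbl complex_eq_iff)
    moreover have "P l z = 0" if "\<forall>v. complex_form P z v = 0" for l
    proof -
      have "complex_form P z (axis l 1) = P l z"
        by (simp add: complex_form_def axis_def if_distrib[of "\<lambda>y. _ * y"] cong: if_cong)
      then show ?thesis using that by simp
    qed
    ultimately show ?thesis using False by auto
  qed
  have cross: "E i x * P j (lpart x) = E j x * P i (lpart x)" for i j x
  proof -
    define F where "F x = E i x * P j (lpart x) - E j x * P i (lpart x)" for x
    have F: "hpoly F" unfolding F_def by (intro hpoly_diff hpoly_intros E hpoly_lpart P)
    \<comment> \<open>Multiplication by a coordinate covers the point z = 0, which
      \<open>cross0\<close> excludes.\<close>
    have "x $ Inl i * F x = 0" for x
    proof (rule hpoly_dbl_zero[where F = "\<lambda>x. x $ Inl i * F x"])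
      show "hpoly (\<lambda>x. x $ Inl i * F x)" by (intro hpoly_intros F)
      show "dbl z $ Inl i * F (dbl z) = 0" for z
        using cross0[of z i j] by (cases "z = 0") (auto simp: F_def)
    qed
    moreover have "\<exists>x :: complex ^ ('n + 'n). x $ Inl i \<noteq> 0"
      by (rule exI[of _ "axis (Inl i) 1"]) (simp add: axis_def)
    ultimately have "F x = 0"
      by (rule hpoly_mult_eq_0[OF holomorphic_polynomial.coord[of "Inl i"] F])
    then show ?thesis by (simp add: F_def)
  qed
  have Pl: "hpoly (\<lambda>x. P i (lpart x))" for i by (rule hpoly_lpart[OF P])
  obtain H where H: "hpoly H" and EH: "\<And>i x. E i x = H x * P i (lpart x)"
    using proportional_multiple[OF Pl relatively_prime_lpart[OF P primeP] E cross] by blast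
  \<comment> \<open>Recovering the real coefficients from \<eta> and its conjugate lets a common
    divisor of \<open>H\<close> and \<open>star H\<close> divide all of them.\<close>
  have AB: "A' j x = (E j x + star (E j) x) / 2" "B' j x = (star (E j) x - E j x) / (2 * \<i>)" for j x
  proof -
    show "A' j x = (E j x + star (E j) x) / 2"
      by (rule hpoly_dbl_eqI[OF A'(1) hpoly_divide[OF holomorphic_polynomial.add[OF E hpoly_star[OF
          E]]]])
         (simp add: star_dbl E_dbl A'(2)[symmetric] complex_eq_iff)
    show "B' j x = (star (E j) x - E j x) / (2 * \<i>)"
      by (rule hpoly_dbl_eqI[OF B'(1) hpoly_divide[OF hpoly_diff[OF hpoly_star[OF E] E]]])
         (simp add: star_dbl E_dbl B'(2)[symmetric] complex_eq_iff)
  qed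
  have starE: "star (E j) x = star H x * star (\<lambda>x. P j (lpart x)) x" for j x
    by (simp add: star_def EH)
  have H_nz: "\<exists>x. H x \<noteq> 0"
  proof (rule ccontr)
    assume "\<not> ?thesis"
    then have "E j x = 0" "star (E j) x = 0" for j x by (simp_all add: starE EH) (simp add:
        star_def)
    then have "A' j x = 0" "B' j x = 0" for j x by (simp_all add: AB)
    then show False using relatively_prime_nonzero[OF prime] by auto
  qed
  have sH_nz: "\<exists>x. star H x \<noteq> 0"
  proof -
    obtain z where "H (dbl z) \<noteq> 0" using H_nz hpoly_dbl_zero[OF H] by blast
    then show ?thesis by (intro exI[of _ "dbl z"]) (simp add: star_dbl)
  qed
  have coprime: "hcoprime H (star H)"
  proof (rule hcoprimeI[OF H hpoly_star[OF H] sH_nz])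
    fix h :: "complex ^ ('n + 'n) \<Rightarrow> complex"
    assume h: "hpoly h" and "hdvd h H" "hdvd h (star H)"
    then obtain u v where u: "hpoly u" "\<And>x. H x = h x * u x" and v: "hpoly v" "\<And>x. star H x
        = h x * v x"
      by (auto simp: hdvd_def)
    have sP: "hpoly (star (\<lambda>x. P j (lpart x)))" for j by (rule hpoly_star[OF Pl])
    have "hdvd h (A' j)" for j
    proof (rule hdvdI)
      show "hpoly (\<lambda>x. (u x * P j (lpart x) + v x * star (\<lambda>x. P j (lpart x)) x) / 2)"
        by (intro hpoly_divide hpoly_intros u v Pl sP)
      show "A' j x = h x * ((u x * P j (lpart x) + v x * star (\<lambda>x. P j (lpart x)) x) / 2)" for x
        unfolding AB starE EH u v by (simp add: algebra_simps)
    qed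
    moreover have "hdvd h (B' j)" for j
    proof (rule hdvdI)
      show "hpoly (\<lambda>x. (v x * star (\<lambda>x. P j (lpart x)) x - u x * P j (lpart x)) / (2 * \<i>))"
        by (intro hpoly_divide hpoly_diff hpoly_intros u v Pl sP)
      show "B' j x = h x * ((v x * star (\<lambda>x. P j (lpart x)) x - u x * P j (lpart x)) / (2 * \<i>))"
          for x
        unfolding AB starE EH u v by (simp add: algebra_simps)
    qed
    ultimately show "\<exists>c. c \<noteq> 0 \<and> h = (\<lambda>x. c)" using relatively_prime_constD[OF prime h] by blast
  qed
  obtain i0 z0 where i0: "P i0 z0 \<noteq> 0" using relatively_prime_nonzero[OF primeP] by blast
  \<comment> \<open>After substituting E_j = H P_j, the terms with antiholomorphic derivatives of
    \<open>H\<close> cancel. The conjugate of P_i0 is a common factor; \<open>i0\<close> is chosen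
    so that it can be removed.\<close>
  have closed: "H x * (P i (lpart x) * pd (Inl j) (star H) x
      - P j (lpart x) * pd (Inl i) (star H) x)
      - star H x * (P i (lpart x) * pd (Inl j) H x - P j (lpart x) * pd (Inl i) H x)
      + H x * star H x * (pd i (P j) (lpart x) - pd j (P i) (lpart x)) = 0" (is "?X x = 0")
          for i j x
  proof (rule hpoly_mult_eq_0[where F = "star (\<lambda>x. P i0 (lpart x))"])
    let ?s = "star (\<lambda>x. P i0 (lpart x))"
    show hs: "hpoly ?s" by (rule hpoly_star[OF Pl])
    show "\<exists>x. ?s x \<noteq> 0" by (rule exI[of _ "dbl z0"]) (simp add: star_dbl i0)
    show "hpoly ?X"
      by (intro hpoly_intros hpoly_diff hpoly_pd Pl hpoly_star H hpoly_lpart[OF hpoly_pd] P)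
    fix x
    have E_fun: "E j = (\<lambda>x. H x * P j (lpart x))" for j by (simp add: EH fun_eq_iff)
    have sE_fun: "star (E i0) = (\<lambda>x. star H x * ?s x)" by (simp add: starE fun_eq_iff)
    have pdE: "pd (Inl l) (E j) x = pd (Inl l) H x * P j (lpart x) + H x * pd l (P j) (lpart x)"
      "pd (Inr l) (E j) x = pd (Inr l) H x * P j (lpart x)" for j l
      unfolding E_fun by (simp_all add: pd_mult H Pl pd_lpart P)
    have pds: "pd (Inl l) (star (E i0)) x = pd (Inl l) (star H) x * ?s x" for l
      unfolding sE_fun by (simp add: pd_mult hpoly_star H Pl pd_star pd_lpart P)
    show "?s x * ?X x = 0"
      using integrable_form_complexified[OF assms(6) E E_dbl, of i x j i0]
      unfolding pdE pds unfolding starE unfolding EH by (simp add: algebra_simps)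
  qed
  \<comment> \<open>\<open>H\<close> carries what remains of |c|^(2 d) after \<theta> has taken the
    weight k + 1. For c = 0 both sides vanish because d is positive.\<close>
  have hom: "c ^ (k + 1) * H (dbl (c *s z)) = (c * cnj c) ^ d * H (dbl z)" for c z
  proof (cases "c = 0")
    case False
    \<comment> \<open>Homotheties commute with multiplication by \<i>, so the scaling hypothesis
      passes from \<omega> to \<eta>.\<close>
    have eta_real: "eta_form A B z v = Complex (real_form A B z v) (- real_form A B z (\<i> *s v))"
        for z v
    proof -
      have "real_form A B z (\<i> *s v) = - Im (eta_form A B z v)"
        by (simp add: Im_eta_form sharp_form_def real_form_def sum_negf[symmetric] algebra_simps)
      then show ?thesis by (simp add: complex_eq_iff Re_eta_form)
    qed
    have "eta_form A B (c *s z) (c *s v) = of_real (cmod c ^ (2 * d)) * eta_form A B z v" for z v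
    proof -
      have "\<i> *s (c *s v) = c *s (\<i> *s v)" by (simp add: vec_eq_iff)
      then show ?thesis
        by (simp only: eta_real assms(10)[OF False]) (simp add: complex_eq_iff)
    qed
    moreover have "eta_form A B z (c *s axis j 1) = c * E j (dbl z)" for z c j
      by (simp add: eta_form_def complex_form_def E_dbl axis_def if_distrib[of
          "\<lambda>y. _ * y"] cong: if_cong)
    ultimately have E_hom: "c * E j (dbl (c *s z)) = of_real (cmod c ^ (2 * d)) * E j (dbl z)"
        for j z
      by (metis vector_smult_lid mult_1)
    have *: "c ^ (k + 1) * H (dbl (c *s z)) * P j z = (c * cnj c) ^ d * H (dbl z) * P j z" for j z
    proof -
      have "(c * cnj c) ^ d = of_real (cmod c ^ (2 * d))"
        unfolding complex_norm_square[symmetric] of_real_power[symmetric] power_mult[symmetric]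
            by (rule refl)
      then show ?thesis using E_hom[of j z] by (simp add: EH k mult_ac)
    qed
    define F where "F x = c ^ (k + 1) * H (join (c *s lpart x) (cnj c *s rpart x))
        - (c * cnj c) ^ d * H x" for x
    have hJ: "hpoly (\<lambda>x. H (join (c *s lpart x) (cnj c *s rpart x)))"
      by (rule hpoly_join[OF H]) (auto intro: hpoly_intros)
    have F: "hpoly F"
      unfolding F_def by (intro hpoly_diff holomorphic_polynomial.mult holomorphic_polynomial.const
          H hJ)
    have F_dbl: "F (dbl z) = c ^ (k + 1) * H (dbl (c *s z)) - (c * cnj c) ^ d * H (dbl z)" for z
      by (simp only: F_def dbl_scale vec_simps)
    have "P i0 (lpart x) * F x = 0" for x
    proof (rule hpoly_dbl_zero[where F = "\<lambda>x. P i0 (lpart x) * F x"])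
      show "hpoly (\<lambda>x. P i0 (lpart x) * F x)" by (intro hpoly_intros Pl F)
      show "P i0 (lpart (dbl z)) * F (dbl z) = 0" for z
        using *[of z i0] unfolding F_dbl by (simp add: algebra_simps)
    qed
    moreover have "\<exists>x :: complex ^ ('n + 'n). P i0 (lpart x) \<noteq> 0"
      by (rule exI[of _ "dbl z0"]) (simp add: i0)
    ultimately have "F (dbl z) = 0" by (rule hpoly_mult_eq_0[OF Pl F])
    then show ?thesis by (simp add: F_dbl)
  qed (use assms(9) in simp)
  note hom2 = scale_identity_bivariate[OF H hom]
  interpret levi_foliation P H A B d k
  proof unfold_locales
    show "Complex (A j z) (- B j z) = H (dbl z) * P j z" for j z using EH[of j "dbl z"]
        by (simp add: E_dbl)
    show "(\<Sum>j\<in>UNIV. P j z * z $ j) = 0" for z using radial[of z] by (simp add: complex_form_def)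
    show "c ^ (k + 1) * H (scale_left c x) = c ^ d * H x" for c x
      using hom2[of c x 1] by (simp add: scale_left_eq)
    show "H (scale_right c x) = c ^ d * H x" for c x
      using hom2[of 1 x c] by (simp add: scale_right_eq)
  qed (use P H closed primeP coprime H_nz k assms(9) in auto)
  obtain z0' where z0': "H (dbl z0') \<noteq> 0" using H_nz hpoly_dbl_zero[OF H] by blast
  \<comment> \<open>The second argument conjugate to z0' makes both \<open>H\<close> and
    \<open>star H\<close> nonzero at the base point.\<close>
  define w0 where "w0 = conj_vec z0'"
  have nz: "H (join z0' w0) \<noteq> 0" "star H (join z0' w0) \<noteq> 0"
    using z0' star_dbl[of H z0'] by (auto simp: w0_def dbl_def)
  show ?thesis
  proof (cases "\<exists>w1 z1. H (join z1 w1) * star H (join z1 w0) * (star H (join z0' w1) * H (join z0'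
      w0)) \<noteq>
      star H (join z1 w1) * H (join z1 w0) * (H (join z0' w1) * star H (join z0' w0))")
    case True
    then show ?thesis using quotient_case[of _ _ w0 z0'] by blast
  next
    case False
    \<comment> \<open>For every second argument \<open>w\<close>, the quotient at \<open>z\<close>
      equals its value at z0'. This separates the variables in H / star H.\<close>
    then have eq: "H (join z w) * star H (join z w0) * (star H (join z0' w) * H (join z0' w0)) =
      star H (join z w) * H (join z w0) * (H (join z0' w) * star H (join z0' w0))" for z w by blast
    have hl: "hpoly (\<lambda>z. F (join z w0))" and hr: "hpoly (\<lambda>w. F (join z0' w))" if "hpoly F"
        for F :: "complex ^ ('n + 'n) \<Rightarrow> complex"
      by (rule hpoly_join[OF that]; simp add: hpoly_intros)+
    have sH: "hpoly (star H)" by (rule hpoly_star[OF H])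
    have "\<exists>a b. hpoly a \<and> hpoly b \<and> (\<forall>x. H x = a (lpart x) * b (rpart x))"
    proof (rule separated_factors[OF H H_nz sH coprime])
      show "hpoly (\<lambda>z. H (join z w0))" by (rule hl[OF H])
      show "hpoly (\<lambda>w. H (join z0' w) * star H (join z0' w0))" by (intro hpoly_intros hr[OF H])
      show "hpoly (\<lambda>x. star H (join (lpart x) w0) * (star H (join z0' (rpart x)) * H (join z0'
          w0)))"
        by (intro hpoly_intros hpoly_lpart[OF hl[OF sH]] hpoly_rpart[OF hr[OF sH]])
      show "\<exists>z. H (join z w0) \<noteq> 0" "\<exists>w. H (join z0' w) * star H (join z0' w0) \<noteq> 0"
        using nz by auto
      show "star H x * (H (join (lpart x) w0) * (H (join z0' (rpart x)) * star H (join z0' w0))) =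
          H x * (star H (join (lpart x) w0) * (star H (join z0' (rpart x)) * H (join z0' w0)))"
              for x
        using eq[of "lpart x" "rpart x"] by (simp add: mult.assoc)
    qed
    then obtain a b where "hpoly a" "hpoly b" "\<And>x. H x = a (lpart x) * b (rpart x)" by blast
    from split_case[OF this(3,1,2)] show ?thesis by (rule disjI1)
  qed
qed

end
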